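(* Let $\Lambda$ be a compact path-connected metric space and let $f_n\colon\Lambda\times\mathbb{R}^d\to\mathbb{R}^d$, $n\in\mathbb{Z}$, be continuous with $f_n(\lambda,0)=0$ for all $n,\lambda$, satisfying (F0)–(F3). If $$J(\operatorname{IM}\mathbb{P}^+(\overline{\kappa}))\neq J(\operatorname{IM}\mathbb{P}^-(\underline{\kappa}))\in J(\Lambda),$$ where $\mathbb{P}^\pm,\overline{\kappa},\underline{\kappa}$ are as in (F2), then the equation $\phi(n+1)=f_n(\lambda,\phi(n))$, $n\in\mathbb{Z}$, has a bifurcation point from the trivial branch, i.e. there is $\lambda_*\in\Lambda$ such that every neighborhood of $(\lambda_*,0)$ in $\Lambda\times\ell_0(\mathbb{R}^d)$ contains $(\lambda,\phi)$ with $\phi\neq0$ and $\phi(n+1)=f_n(\lambda,\phi(n))$ for all $n$.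
   Context: $\ell_0(\mathbb{R}^d)$: sequences $\mathbb{Z}\to\mathbb{R}^d$ converging to $0$ at $\pm\infty$, sup norm. $D_d(0,r)$: closed ball in $\mathbb{R}^d$. $\mathbb{Z}^+_\kappa=\mathbb{Z}\cap[\kappa,\infty)$, $\mathbb{Z}^-_\kappa=\mathbb{Z}\cap(-\infty,\kappa]$. (F0): each $f_n$ is differentiable in the second variable with $D_2f_n$ continuous on $\Lambda\times\mathbb{R}^d$. (F1): there is $r_0>0$ such that $\{f_n\}_n$ is equicontinuous on $\Lambda\times D_d(0,r_0)$ and $\{D_2f_n\}_n$ is equicontinuous and pointwise bounded on $\Lambda\times D_d(0,r_0)$. Let $\mathbb{A}_n(\lambda):=D_2f_n(\lambda,0)$. (F2): $\mathbb{A}$ has an exponential dichotomy on $\mathbb{Z}^+_{\overline{\kappa}}$ and on $\mathbb{Z}^-_{\underline{\kappa}}$, for some $\underline{\kappa}<0<\overline{\kappa}$, with parametrized projectors $\mathbb{P}^+\colon\Lambda\times\mathbb{Z}^+_{\overline{\kappa}}\to\mathcal{L}(\mathbb{R}^d)$, $\mathbb{P}^-\colon\Lambda\times\mathbb{Z}^-_{\underline{\kappa}}\to\mathcal{L}(\mathbb{R}^d)$. (F3): there is $\lambda_0\in\Lambda$ such that $\mathbb{A}(\lambda_0)$ has an exponential dichotomy on all of $\mathbb{Z}$. Definitions: for $\mathbb{B}\colon\mathbb{Z}\to\mathcal{L}(\mathbb{R}^d)$, $\Phi(k,n)=\mathbb{B}_{k-1}\cdots\mathbb{B}_n$ ($k>n$),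 $\Phi(n,n)=\mathrm{id}$. A projector on $\mathbb{I}\subset\mathbb{Z}$ is $\mathbb{P}\colon\mathbb{I}\to\mathcal{L}(\mathbb{R}^d)$ with $\mathbb{P}(n)^2=\mathbb{P}(n)$; invariant if $\mathbb{B}_n\mathbb{P}(n)=\mathbb{P}(n+1)\mathbb{B}_n$ whenever $n,n+1\in\mathbb{I}$ and $\sup\|\mathbb{P}(n)\|<\infty$; regular if moreover $\mathbb{B}_n|_{\ker\mathbb{P}(n)}\colon\ker\mathbb{P}(n)\to\ker\mathbb{P}(n+1)$ is an isomorphism. $\mathbb{B}$ has an ED on $\mathbb{I}$ if there are an invariant regular projector $\mathbb{P}$, $K\geq1$, $\alpha\in(0,1)$ with $|\Phi(k,n)\mathbb{P}(n)x|\leq K\alpha^{k-n}|\mathbb{P}(n)x|$ and $|\Phi(k,n)(I-\mathbb{P}(n))x|\geq K^{-1}\alpha^{-(k-n)}|(I-\mathbb{P}(n))x|$ for $k\geq n$ in $\mathbb{I}$. For a parametrized field, an ED on $\mathbb{I}$ with parametrized projector $\mathbb{P}\colon\Lambda\times\mathbb{I}\to\mathcal{L}(\mathbb{R}^d)$ means each $\mathbb{P}_n\colon\Lambda\to\mathcal{L}(\mathbb{R}^d)$ is continuous and, with $K,\alpha$ independent of $\lambda$, each $\mathbb{A}(\lambda)$ has an ED on $\mathbb{I}$ w.r.t. $\mathbb{P}(\lambda)$. $\operatorname{IM}\mathbb{P}^\pm(\kappa):=\{(\lambda,x): x\in\operatorname{im}\mathbb{P}^\pm(\lambda,\kappa)\}$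 (a vector bundle over $\Lambda$). $\widetilde{KO}(\Lambda)$ is the reduced real K-group (classes $[E]-[F]$ with $\operatorname{rank}E=\operatorname{rank}F$). $J(\Lambda)$ is the quotient of $\widetilde{KO}(\Lambda)$ by the subgroup generated by $[E]-[F]$ with $E,F$ stably fibrewise homotopy equivalent (i.e. the sphere bundles of $E\oplus\Theta(\mathbb{R}^n)$ and $F\oplus\Theta(\mathbb{R}^m)$ are fibre-homotopy equivalent for some $n,m$), and $J\colon\widetilde{KO}(\Lambda)\to J(\Lambda)$ is the quotient map; for a bundle $E$ of rank $r$ write $J(E):=J([E]-[\Theta(\mathbb{R}^r)])$, $\Theta(\mathbb{R}^r)=\Lambda\times\mathbb{R}^r$. *)

theory Defs
  imports "HOL-Analysis.Analysis"
begin

fun trans_op :: "(int \<Rightarrow> real^'n^'n) \<Rightarrow> int \<Rightarrow> nat \<Rightarrow> real^'n^'n" where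
  "trans_op B n 0 = mat 1"
| "trans_op B n (Suc m) = B (n + int m) ** trans_op B n m"

definition Phi :: "(int \<Rightarrow> real^'n^'n) \<Rightarrow> int \<Rightarrow> int \<Rightarrow> real^'n^'n" where
  "Phi B k n = trans_op B n (nat (k - n))"

definition projector_on :: "int set \<Rightarrow> (int \<Rightarrow> real^'n^'n) \<Rightarrow> bool" where
  "projector_on I P \<longleftrightarrow> (\<forall>n\<in>I. P n ** P n = P n)"

definition invariant_proj :: "(int \<Rightarrow> real^'n^'n) \<Rightarrow> int set \<Rightarrow> (int \<Rightarrow> real^'n^'n) \<Rightarrow> bool" where
  "invariant_proj B I P \<longleftrightarrow> projector_on I P \<and>
     (\<forall>n. n \<in> I \<longrightarrow> n + 1 \<in> I \<longrightarrow> B n ** P n = P (n + 1) ** B n) \<and>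
     (\<exists>C. \<forall>n\<in>I. norm (P n) \<le> C)"

definition regular_proj :: "(int \<Rightarrow> real^'n^'n) \<Rightarrow> int set \<Rightarrow> (int \<Rightarrow> real^'n^'n) \<Rightarrow> bool" where
  "regular_proj B I P \<longleftrightarrow> invariant_proj B I P \<and>
     (\<forall>n. n \<in> I \<longrightarrow> n + 1 \<in> I \<longrightarrow>
        bij_betw (\<lambda>x. B n *v x) {x. P n *v x = 0} {x. P (n + 1) *v x = 0})"

definition ED_with :: "(int \<Rightarrow> real^'n^'n) \<Rightarrow> int set \<Rightarrow> (int \<Rightarrow> real^'n^'n) \<Rightarrow> real \<Rightarrow> real \<Rightarrow> bool" where
  "ED_with B I P K \<alpha> \<longleftrightarrow> regular_proj B I P \<and> K \<ge> 1 \<and> 0 < \<alpha> \<and> \<alpha> < 1 \<and>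
     (\<forall>k\<in>I. \<forall>n\<in>I. \<forall>x. n \<le> k \<longrightarrow>
        norm (Phi B k n *v (P n *v x)) \<le> K * \<alpha> ^ nat (k - n) * norm (P n *v x) \<and>
        norm (Phi B k n *v (x - P n *v x)) \<ge> (1 / K) * (1 / \<alpha>) ^ nat (k - n) * norm (x - P n *v x))"

definition has_ED :: "(int \<Rightarrow> real^'n^'n) \<Rightarrow> int set \<Rightarrow> bool" where
  "has_ED B I \<longleftrightarrow> (\<exists>P K \<alpha>. ED_with B I P K \<alpha>)"

definition has_param_ED :: "'a::topological_space set \<Rightarrow> ('a \<Rightarrow> int \<Rightarrow> real^'n^'n) \<Rightarrow> int set
    \<Rightarrow> ('a \<Rightarrow> int \<Rightarrow> real^'n^'n) \<Rightarrow> bool" where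
  "has_param_ED \<Lambda> A I P \<longleftrightarrow> (\<forall>n\<in>I. continuous_on \<Lambda> (\<lambda>l. P l n)) \<and>
     (\<exists>K \<alpha>. \<forall>l\<in>\<Lambda>. ED_with (A l) I (P l) K \<alpha>)"

definition equicontinuous_on :: "'b::metric_space set \<Rightarrow> (int \<Rightarrow> 'b \<Rightarrow> 'c::metric_space) \<Rightarrow> bool" where
  "equicontinuous_on S F \<longleftrightarrow>
     (\<forall>p\<in>S. \<forall>e>0. \<exists>\<delta>>0. \<forall>n. \<forall>q\<in>S. dist q p < \<delta> \<longrightarrow> dist (F n q) (F n p) < e)"

definition pointwise_bounded_on :: "'b set \<Rightarrow> (int \<Rightarrow> 'b \<Rightarrow> 'c::real_normed_vector) \<Rightarrow> bool" where
  "pointwise_bounded_on S F \<longleftrightarrow> (\<forall>p\<in>S. \<exists>C. \<forall>n. norm (F n p) \<le> C)"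

text \<open>A vector bundle over the compact space \<Lambda> is represented (up to isomorphism, as
  every bundle over a compact Hausdorff space is) by a continuous family of idempotent
  N x N matrices; its fibre over l is the image of P l.  Vectors of R^N are functions
  nat => real supported in {..<N}; matrices are nat => nat => real.\<close>

type_synonym rvec = "nat \<Rightarrow> real"
type_synonym rmat = "nat \<Rightarrow> nat \<Rightarrow> real"
type_synonym 'a vbundle = "nat \<times> ('a \<Rightarrow> rmat)"

definition mvr :: "nat \<Rightarrow> nat \<Rightarrow> rmat \<Rightarrow> rvec \<Rightarrow> rvec" where
  "mvr M N A x = (\<lambda>i. if i < M then (\<Sum>j<N. A i j * x j) else 0)"

definition is_vbundle :: "'a::topological_space set \<Rightarrow> 'a vbundle \<Rightarrow> bool" where
  "is_vbundle \<Lambda> E \<longleftrightarrow> (case E of (N, P) \<Rightarrow>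
     (\<forall>i<N. \<forall>j<N. continuous_on \<Lambda> (\<lambda>l. P l i j)) \<and>
     (\<forall>l\<in>\<Lambda>. \<forall>i j. (N \<le> i \<or> N \<le> j) \<longrightarrow> P l i j = 0) \<and>
     (\<forall>l\<in>\<Lambda>. \<forall>i<N. \<forall>j<N. (\<Sum>k<N. P l i k * P l k j) = P l i j))"

definition fibre :: "'a vbundle \<Rightarrow> 'a \<Rightarrow> rvec set" where
  "fibre E l = (case E of (N, P) \<Rightarrow> range (mvr N N (P l)))"

definition bundle_iso :: "'a::topological_space set \<Rightarrow> 'a vbundle \<Rightarrow> 'a vbundle \<Rightarrow> bool" where
  "bundle_iso \<Lambda> E F \<longleftrightarrow> (case E of (N, P) \<Rightarrow> case F of (M, Q) \<Rightarrow>
     (\<exists>A B. (\<forall>i<M. \<forall>j<N. continuous_on \<Lambda> (\<lambda>l. A l i j)) \<and>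
            (\<forall>i<N. \<forall>j<M. continuous_on \<Lambda> (\<lambda>l. B l i j)) \<and>
            (\<forall>l\<in>\<Lambda>. (\<forall>x\<in>fibre E l. mvr M N (A l) x \<in> fibre F l \<and> mvr N M (B l) (mvr M N (A l) x) = x) \<and>
                     (\<forall>y\<in>fibre F l. mvr N M (B l) y \<in> fibre E l \<and> mvr M N (A l) (mvr N M (B l) y) = y))))"

definition same_rank :: "'a set \<Rightarrow> 'a vbundle \<Rightarrow> 'a vbundle \<Rightarrow> bool" where
  "same_rank \<Lambda> E F \<longleftrightarrow> (case E of (N, P) \<Rightarrow> case F of (M, Q) \<Rightarrow>
     (\<forall>l\<in>\<Lambda>. \<exists>A. bij_betw (mvr M N A) (fibre E l) (fibre F l)))"

definition dsum :: "'a vbundle \<Rightarrow> 'a vbundle \<Rightarrow> 'a vbundle" where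
  "dsum E F = (case E of (N, P) \<Rightarrow> case F of (M, Q) \<Rightarrow>
     (N + M, \<lambda>l i j. if i < N \<and> j < N then P l i j
                     else if N \<le> i \<and> i < N + M \<and> N \<le> j \<and> j < N + M then Q l (i - N) (j - N)
                     else 0))"

definition triv :: "nat \<Rightarrow> 'a vbundle" where
  "triv r = (r, \<lambda>l i j. if i < r \<and> i = j then 1 else 0)"

definition sphere_bundle :: "'a set \<Rightarrow> 'a vbundle \<Rightarrow> ('a \<times> rvec) set" where
  "sphere_bundle \<Lambda> E = {(l, x). l \<in> \<Lambda> \<and> x \<in> fibre E l \<and> (\<Sum>i<fst E. (x i)\<^sup>2) = 1}"

definition fibre_homotopy_equiv :: "'a::topological_space set \<Rightarrow> 'a vbundle \<Rightarrow> 'a vbundle \<Rightarrow> bool" where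
  "fibre_homotopy_equiv \<Lambda> E F \<longleftrightarrow>
     (let SE = sphere_bundle \<Lambda> E; SF = sphere_bundle \<Lambda> F in
      \<exists>f g. continuous_on SE f \<and> f ` SE \<subseteq> SF \<and> (\<forall>z\<in>SE. fst (f z) = fst z) \<and>
            continuous_on SF g \<and> g ` SF \<subseteq> SE \<and> (\<forall>z\<in>SF. fst (g z) = fst z) \<and>
            homotopic_with_canon (\<lambda>h. \<forall>z\<in>SE. fst (h z) = fst z) SE SE (g \<circ> f) id \<and>
            homotopic_with_canon (\<lambda>h. \<forall>z\<in>SF. fst (h z) = fst z) SF SF (f \<circ> g) id)"

definition stably_fhe :: "'a::topological_space set \<Rightarrow> 'a vbundle \<Rightarrow> 'a vbundle \<Rightarrow> bool" where
  "stably_fhe \<Lambda> E F \<longleftrightarrow> (\<exists>n m. fibre_homotopy_equiv \<Lambda> (dsum E (triv n)) (dsum F (triv m)))"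

text \<open>A pair (E, F) of equal-rank bundles represents [E] - [F] in KO-tilde; two pairs
  represent the same class iff E + D + K and C + F + K are isomorphic for some bundle K.\<close>
definition ko_eq :: "'a::topological_space set \<Rightarrow> 'a vbundle \<times> 'a vbundle \<Rightarrow> 'a vbundle \<times> 'a vbundle \<Rightarrow> bool" where
  "ko_eq \<Lambda> x y \<longleftrightarrow> (case x of (A, B) \<Rightarrow> case y of (C, D) \<Rightarrow>
     (\<exists>K. is_vbundle \<Lambda> K \<and> bundle_iso \<Lambda> (dsum (dsum A D) K) (dsum (dsum C B) K)))"

text \<open>Representatives of the elements of the subgroup of KO-tilde generated by the
  differences [E] - [F] with E, F stably fibre homotopy equivalent: finite sums of
  generators and their inverses (sum of classes = class of Whitney sums).\<close>
inductive_set J_kernel_reps :: "'a::topological_space set \<Rightarrow> ('a vbundle \<times> 'a vbundle) set"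
  for \<Lambda> :: "'a set" where
  zero: "(triv 0, triv 0) \<in> J_kernel_reps \<Lambda>"
| gen: "is_vbundle \<Lambda> E \<Longrightarrow> is_vbundle \<Lambda> F \<Longrightarrow> same_rank \<Lambda> E F \<Longrightarrow> stably_fhe \<Lambda> E F
        \<Longrightarrow> (E, F) \<in> J_kernel_reps \<Lambda>"
| inv: "is_vbundle \<Lambda> E \<Longrightarrow> is_vbundle \<Lambda> F \<Longrightarrow> same_rank \<Lambda> E F \<Longrightarrow> stably_fhe \<Lambda> E F
        \<Longrightarrow> (F, E) \<in> J_kernel_reps \<Lambda>"
| add: "(A, B) \<in> J_kernel_reps \<Lambda> \<Longrightarrow> (C, D) \<in> J_kernel_reps \<Lambda>
        \<Longrightarrow> (dsum A C, dsum B D) \<in> J_kernel_reps \<Lambda>"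

text \<open>J(E) = J(F) in J(\<Lambda>), where J(E) = J([E] - [Theta(R^r)]), r = rank E, s = rank F:
  the difference [E + Theta^s] - [F + Theta^r] lies in the kernel subgroup.\<close>
definition J_eq :: "'a::topological_space set \<Rightarrow> 'a vbundle \<Rightarrow> 'a vbundle \<Rightarrow> bool" where
  "J_eq \<Lambda> E F \<longleftrightarrow> (\<exists>r s. same_rank \<Lambda> E (triv r) \<and> same_rank \<Lambda> F (triv s) \<and>
     (\<exists>p\<in>J_kernel_reps \<Lambda>. ko_eq \<Lambda> (dsum E (triv s), dsum F (triv r)) p))"

definition idx_enum :: "nat \<Rightarrow> 'd::finite" where
  "idx_enum = (SOME g. bij_betw g {..<CARD('d)} (UNIV :: 'd set))"

text \<open>IM P(kappa) = {(l,x). x in im P(l,kappa)}, transported to R^CARD('d) along a fixed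
  enumeration of the index type.\<close>
definition IM_bundle :: "('a \<Rightarrow> int \<Rightarrow> real^'d^'d) \<Rightarrow> int \<Rightarrow> 'a vbundle" where
  "IM_bundle P \<kappa> = (CARD('d), \<lambda>l i j. if i < CARD('d) \<and> j < CARD('d)
       then P l \<kappa> $ idx_enum i $ idx_enum j else 0)"

definition ell0 :: "(int \<Rightarrow> 'v::real_normed_vector) set" where
  "ell0 = {\<phi>. (\<phi> \<longlongrightarrow> 0) at_top \<and> (\<phi> \<longlongrightarrow> 0) at_bot}"

end

theory Submission
  imports Defs
begin

text \<open>
  Suppose there is no bifurcation. For large \<open>N\<close>, truncate the equation to \<open>[-N, N]\<close> with the
  boundary conditions \<open>(1 - P\<^sup>+(N)) x(N) = 0\<close> and \<open>P\<^sup>-(-N) x(-N) = 0\<close>. The dichotomy estimates and a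
  compactness argument show that the truncated problem has no solution of small fixed sup norm, so it
  induces a fibrewise map from the sphere bundle of a trivial bundle to that of
  \<open>\<Theta> \<oplus> ker P\<^sup>+(N) \<oplus> im P\<^sup>-(-N)\<close>. Over \<open>\<lambda>\<^sub>0\<close> this map is homotopic to a linear isomorphism.
  Being a homotopy equivalence on a fibre is an open and closed condition on the base, so no degree theory
  is needed, and Dold's theorem makes the map a fibre homotopy equivalence.
  Regularity of the projectors identifies \<open>ker P\<^sup>+(N)\<close> with \<open>ker P\<^sup>+\<close> at the initial time and
  \<open>ker P\<^sup>-(-N)\<close> with \<open>ker P\<^sup>-\<close> at the final one, which yields equality of the two classes in \<open>J(\<Lambda>)\<close>.
\<close>

subsection \<open>Fibrewise homotopy theory\<close>

text \<open>The linearised equation on the whole line is known to be invertible at a single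
  parameter, so the nonlinear map is deformed to a linear one there and nowhere else; over the other
  parameters the argument has to handle a nonlinear fibrewise map. The boundary conditions are
  chosen so that each switches off one term of the dichotomy estimate on its half-line: a truncated
  solution that is small on a fixed middle window is then small everywhere, so a solution of size
  exactly \<open>\<delta>\<close> cannot escape towards the ends as \<open>N\<close> grows. The
  unknowns fill \<open>2N + 1\<close> copies of the phase space, the equations \<open>2N\<close>
  copies plus two boundary values, and the dimensions match because the whole-line dichotomy forces
  both projectors to have the same rank. Two obstacles shape the estimates. The coefficients need
  not be invertible, so backward propagation lives on kernels of projectors. And a dichotomy bounds
  its projectors for each parameter separately, so a uniform bound is extracted from
  \<open>K\<close>, \<open>\<alpha>\<close> and a bound on the coefficients, at the price of a
  shorter negative half-line.\<close>

definition over :: "'a set \<Rightarrow> ('a \<times> 'b) set \<Rightarrow> ('a \<times> 'b) set" where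
  "over A S = S \<inter> (A \<times> UNIV)"

definition fmap :: "('a::topological_space \<times> 'b::topological_space) set
    \<Rightarrow> ('a \<times> 'c::topological_space) set \<Rightarrow> ('a \<times> 'b \<Rightarrow> 'a \<times> 'c) \<Rightarrow> bool" where
  "fmap S T f \<longleftrightarrow> continuous_on S f \<and> f ` S \<subseteq> T \<and> (\<forall>z\<in>S. fst (f z) = fst z)"

definition fhom :: "('a::topological_space \<times> 'b::topological_space) set
    \<Rightarrow> ('a \<times> 'c::topological_space) set \<Rightarrow> ('a \<times> 'b \<Rightarrow> 'a \<times> 'c) \<Rightarrow> ('a \<times> 'b \<Rightarrow> 'a \<times> 'c) \<Rightarrow> bool" where
  "fhom S T f g \<longleftrightarrow> homotopic_with_canon (\<lambda>h. \<forall>z\<in>S. fst (h z) = fst z) S T f g"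

text \<open>The map stays explicit, whereas \<open>fibre_homotopy_equiv\<close> only asserts that
  some map exists: restriction to part of the base and comparison of different fibres both concern
  one fixed map.\<close>

definition fheq :: "('a::topological_space \<times> 'b::topological_space) set
    \<Rightarrow> ('a \<times> 'c::topological_space) set \<Rightarrow> ('a \<times> 'b \<Rightarrow> 'a \<times> 'c) \<Rightarrow> bool" where
  "fheq S T f \<longleftrightarrow> fmap S T f \<and> (\<exists>g. fmap T S g \<and> fhom S S (g \<circ> f) id \<and> fhom T T (f \<circ> g) id)"

lemma over_iff: "z \<in> over A S \<longleftrightarrow> z \<in> S \<and> fst z \<in> A"
  by (cases z) (auto simp: over_def)

lemma over_over: "over A (over B S) = over (A \<inter> B) S"
  by (auto simp: over_def)

lemma fmapI:
  assumes "continuous_on S f" "\<And>z. z \<in> S \<Longrightarrow> f z \<in> T" "\<And>z. z \<in> S \<Longrightarrow> fst (f z) = fst z"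
  shows "fmap S T f"
  using assms by (auto simp: fmap_def)

lemma fmapD:
  assumes "fmap S T f"
  shows "continuous_on S f" "\<And>z. z \<in> S \<Longrightarrow> f z \<in> T" "\<And>z. z \<in> S \<Longrightarrow> fst (f z) = fst z"
  using assms by (auto simp: fmap_def)

lemma fmap_id: "fmap S S id"
  by (simp add: fmap_def)

lemma fmap_comp: "fmap S T f \<Longrightarrow> fmap T U g \<Longrightarrow> fmap S U (g \<circ> f)"
  using continuous_on_compose[of S f g] continuous_on_subset[of T g "f ` S"]
  unfolding fmap_def by (simp add: image_subset_iff)

lemma fmap_over: "fmap S T f \<Longrightarrow> fmap (over A S) (over A T) f"
  unfolding fmap_def image_subset_iff by (auto simp: over_iff intro: continuous_on_subset)

lemma fhomI:
  assumes "continuous_on ({0..1} \<times> S) h"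
    and "\<And>t z. t \<in> {0..1::real} \<Longrightarrow> z \<in> S \<Longrightarrow> h (t, z) \<in> T"
    and "\<And>t z. t \<in> {0..1::real} \<Longrightarrow> z \<in> S \<Longrightarrow> fst (h (t, z)) = fst z"
    and "\<And>z. z \<in> S \<Longrightarrow> h (0, z) = f z" "\<And>z. z \<in> S \<Longrightarrow> h (1, z) = g z"
  shows "fhom S T f g"
  unfolding fhom_def
proof (subst homotopic_with)
  show "(\<exists>h. continuous_map (prod_topology (top_of_set {0..1::real}) (top_of_set S)) (top_of_set T) h \<and>
         (\<forall>x\<in>topspace (top_of_set S). h (0, x) = f x) \<and>
         (\<forall>x\<in>topspace (top_of_set S). h (1, x) = g x) \<and>
         (\<forall>t\<in>{0..1}. \<forall>z\<in>S. fst (h (t, z)) = fst z))"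
    by (intro exI[of _ h] conjI ballI) (use assms in \<open>auto simp: image_subset_iff\<close>)
qed auto

lemma fhomE:
  assumes "fhom S T f g"
  obtains h where "continuous_on ({0..1} \<times> S) h"
    and "\<And>t z. t \<in> {0..1::real} \<Longrightarrow> z \<in> S \<Longrightarrow> h (t, z) \<in> T"
    and "\<And>t z. t \<in> {0..1::real} \<Longrightarrow> z \<in> S \<Longrightarrow> fst (h (t, z)) = fst z"
    and "\<And>z. z \<in> S \<Longrightarrow> h (0, z) = f z" "\<And>z. z \<in> S \<Longrightarrow> h (1, z) = g z"
proof -
  from assms have "\<exists>h. continuous_on ({0..1::real} \<times> S) h \<and> h \<in> {0..1} \<times> S \<rightarrow> T \<and>
      (\<forall>x. h (0, x) = f x) \<and> (\<forall>x. h (1, x) = g x) \<and>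
      (\<forall>t\<in>{0..1}. \<forall>z\<in>S. fst (h (t, z)) = fst z)"
    unfolding fhom_def homotopic_with_def by (simp del: split_paired_All)
  then obtain h where
    h: "continuous_on ({0..1::real} \<times> S) h" "h \<in> {0..1} \<times> S \<rightarrow> T"
      "\<forall>x. h (0, x) = f x" "\<forall>x. h (1, x) = g x"
      "\<forall>t\<in>{0..1}. \<forall>z\<in>S. fst (h (t, z)) = fst z"
    by (elim exE conjE)
  show ?thesis
    by (rule that[of h]) (use h in \<open>auto simp: Pi_iff simp del: split_paired_All\<close>)
qed

lemma fhom_eq: "fmap S T f \<Longrightarrow> (\<And>z. z \<in> S \<Longrightarrow> f z = g z) \<Longrightarrow> fhom S T f g"
  unfolding fhom_def by (rule homotopic_with_equal) (auto simp: fmap_def)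

lemma fhom_sym: "fhom S T f g \<Longrightarrow> fhom S T g f"
  by (simp add: fhom_def homotopic_with_sym)

lemma fhom_trans [trans]: "fhom S T f g \<Longrightarrow> fhom S T g h \<Longrightarrow> fhom S T f h"
  unfolding fhom_def by (rule homotopic_with_trans)

lemma fhom_fmap: assumes "fhom S T f g" shows "fmap S T f" "fmap S T g"
proof -
  note a = assms[unfolded fhom_def]
  show "fmap S T f" "fmap S T g"
    unfolding fmap_def
    using homotopic_with_imp_continuous[OF a] homotopic_with_imp_property[OF a]
      homotopic_with_imp_subset1[OF a] homotopic_with_imp_subset2[OF a] by simp_all
qed

lemma fhom_comp_left: "fhom S T f g \<Longrightarrow> fmap T U h \<Longrightarrow> fhom S U (h \<circ> f) (h \<circ> g)"
proof (elim fhomE)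
  fix k :: "real \<times> 'a \<times> 'b \<Rightarrow> 'a \<times> 'c"
  assume *: "fmap T U h" "continuous_on ({0..1} \<times> S) k" "\<And>t z. t \<in> {0..1} \<Longrightarrow> z \<in> S \<Longrightarrow> k (t, z) \<in> T"
    "\<And>t z. t \<in> {0..1} \<Longrightarrow> z \<in> S \<Longrightarrow> fst (k (t, z)) = fst z"
    "\<And>z. z \<in> S \<Longrightarrow> k (0, z) = f z" "\<And>z. z \<in> S \<Longrightarrow> k (1, z) = g z"
  show "fhom S U (h \<circ> f) (h \<circ> g)"
  proof (rule fhomI[of _ "h \<circ> k"])
    show "continuous_on ({0..1} \<times> S) (h \<circ> k)"
      by (rule continuous_on_compose[OF *(2) continuous_on_subset[OF fmapD(1)[OF *(1)]]]) (use * in auto)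
  qed (use * fmapD[OF *(1)] in auto)
qed

lemma fhom_comp_right: "fhom T U f g \<Longrightarrow> fmap S T h \<Longrightarrow> fhom S U (f \<circ> h) (g \<circ> h)"
proof (elim fhomE)
  fix k :: "real \<times> 'a \<times> 'b \<Rightarrow> 'a \<times> 'c"
  assume *: "fmap S T h" "continuous_on ({0..1} \<times> T) k" "\<And>t z. t \<in> {0..1} \<Longrightarrow> z \<in> T \<Longrightarrow> k (t, z) \<in> U"
    "\<And>t z. t \<in> {0..1} \<Longrightarrow> z \<in> T \<Longrightarrow> fst (k (t, z)) = fst z"
    "\<And>z. z \<in> T \<Longrightarrow> k (0, z) = f z" "\<And>z. z \<in> T \<Longrightarrow> k (1, z) = g z"
  show "fhom S U (f \<circ> h) (g \<circ> h)"
  proof (rule fhomI[of _ "\<lambda>p. k (fst p, h (snd p))"])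
    show "continuous_on ({0..1} \<times> S) (\<lambda>p. k (fst p, h (snd p)))"
    proof (rule continuous_on_compose2[OF *(2)])
      show "continuous_on ({0..1} \<times> S) (\<lambda>p. (fst p, h (snd p)))"
        by (intro continuous_on_Pair continuous_on_fst continuous_on_id
            continuous_on_compose2[OF fmapD(1)[OF *(1)] continuous_on_snd[OF continuous_on_id]]) auto
    qed (use fmapD[OF *(1)] in auto)
  qed (use * fmapD[OF *(1)] in auto)
qed

lemma fhom_over: "fhom S T f g \<Longrightarrow> fhom (over A S) (over A T) f g"
proof (elim fhomE)
  fix h :: "real \<times> 'a \<times> 'b \<Rightarrow> 'a \<times> 'c"
  assume "continuous_on ({0..1} \<times> S) h" "\<And>t z. t \<in> {0..1} \<Longrightarrow> z \<in> S \<Longrightarrow> h (t, z) \<in> T"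
    "\<And>t z. t \<in> {0..1} \<Longrightarrow> z \<in> S \<Longrightarrow> fst (h (t, z)) = fst z"
    "\<And>z. z \<in> S \<Longrightarrow> h (0, z) = f z" "\<And>z. z \<in> S \<Longrightarrow> h (1, z) = g z"
  then show "fhom (over A S) (over A T) f g"
    by (intro fhomI[of _ h]) (auto simp: over_iff intro: continuous_on_subset)
qed

lemma fheqI:
  "fmap S T f \<Longrightarrow> fmap T S g \<Longrightarrow> fhom S S (g \<circ> f) id \<Longrightarrow> fhom T T (f \<circ> g) id \<Longrightarrow> fheq S T f"
  by (auto simp: fheq_def)

lemma fheq_over: "fheq S T f \<Longrightarrow> fheq (over A S) (over A T) f"
  unfolding fheq_def by (meson fmap_over fhom_over)

lemma fheq_hom:
  assumes f: "fheq S T f" and h: "fhom S T f f'"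
  shows "fheq S T f'"
proof -
  obtain g where g: "fmap T S g" "fhom S S (g \<circ> f) id" "fhom T T (f \<circ> g) id"
    using f by (auto simp: fheq_def)
  show ?thesis
  proof (rule fheqI[OF fhom_fmap(2)[OF h] g(1)])
    show "fhom S S (g \<circ> f') id"
      by (rule fhom_trans[OF fhom_comp_left[OF fhom_sym[OF h] g(1)] g(2)])
    show "fhom T T (f' \<circ> g) id"
      by (rule fhom_trans[OF fhom_comp_right[OF fhom_sym[OF h] g(1)] g(3)])
  qed
qed

lemma fheq_comp:
  assumes f: "fheq S T f" and f': "fheq T U f'"
  shows "fheq S U (f' \<circ> f)"
proof -
  obtain g where g: "fmap S T f" "fmap T S g" "fhom S S (g \<circ> f) id" "fhom T T (f \<circ> g) id"
    using f by (auto simp: fheq_def)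
  obtain g' where g': "fmap T U f'" "fmap U T g'" "fhom T T (g' \<circ> f') id" "fhom U U (f' \<circ> g') id"
    using f' by (auto simp: fheq_def)
  show ?thesis
  proof (rule fheqI[OF fmap_comp[OF g(1) g'(1)] fmap_comp[OF g'(2) g(2)]])
    have "fhom S S (g \<circ> (g' \<circ> f') \<circ> f) (g \<circ> id \<circ> f)"
      by (rule fhom_comp_right[OF fhom_comp_left[OF g'(3) g(2)] g(1)])
    then show "fhom S S (g \<circ> g' \<circ> (f' \<circ> f)) id"
      using g(3) by (simp add: o_assoc) (rule fhom_trans)
    have "fhom U U (f' \<circ> (f \<circ> g) \<circ> g') (f' \<circ> id \<circ> g')"
      by (rule fhom_comp_right[OF fhom_comp_left[OF g(4) g'(1)] g'(2)])
    then show "fhom U U (f' \<circ> f \<circ> (g \<circ> g')) id"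
      using g'(4) by (simp add: o_assoc) (rule fhom_trans)
  qed
qed

text \<open>If \<open>g'\<close> is a two-sided homotopy inverse of \<open>f\<close>, then
  \<open>g'\<close> is homotopic to \<open>g' \<circ> f \<circ> g\<close> and hence to
  \<open>g\<close>. This lets right inverses alone carry the local-to-global argument.\<close>

lemma fheq_inverse:
  assumes "fheq S T f" "fmap T S g" "fhom T T (f \<circ> g) id"
  shows "fheq T S g"
proof -
  obtain g' where g': "fmap S T f" "fmap T S g'" "fhom S S (g' \<circ> f) id" "fhom T T (f \<circ> g') id"
    using assms(1) by (auto simp: fheq_def)
  have "fhom T S (g' \<circ> (f \<circ> g)) (g' \<circ> id)"
    by (rule fhom_comp_left[OF assms(3) g'(2)])
  moreover have "fhom T S ((g' \<circ> f) \<circ> g) (id \<circ> g)"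
    by (rule fhom_comp_right[OF g'(3) assms(2)])
  ultimately have "fhom T S g' g"
    by (simp add: o_assoc) (meson fhom_sym fhom_trans)
  moreover have "fheq T S g'"
    by (rule fheqI[OF g'(2,1) g'(4,3)])
  ultimately show ?thesis
    by (rule fheq_hom[rotated])
qed

section \<open>Dold's theorem: gluing homotopy inverses over a cover of the base\<close>

definition clamp01 :: "real \<Rightarrow> real" where
  "clamp01 t = max 0 (min 1 t)"

lemma clamp01 [simp]: "0 \<le> clamp01 t" "clamp01 t \<le> 1" "t \<le> 0 \<Longrightarrow> clamp01 t = 0" "1 \<le> t \<Longrightarrow> clamp01 t = 1"
  by (auto simp: clamp01_def)

lemma continuous_on_clamp01 [continuous_intros]:
  "continuous_on S f \<Longrightarrow> continuous_on S (\<lambda>x. clamp01 (f x))"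
  unfolding clamp01_def by (intro continuous_intros)

lemma continuous_on_If_le:
  fixes \<phi> :: "'a::topological_space \<Rightarrow> real" and c :: real
  assumes "continuous_on S \<phi>" "continuous_on {x\<in>S. \<phi> x \<le> c} f" "continuous_on {x\<in>S. c \<le> \<phi> x} g"
    and "\<And>x. x \<in> S \<Longrightarrow> \<phi> x = c \<Longrightarrow> f x = g x"
  shows "continuous_on S (\<lambda>x. if \<phi> x \<le> c then f x else g x)"
proof -
  have S: "S = {x\<in>S. \<phi> x \<le> c} \<union> {x\<in>S. c \<le> \<phi> x}" by auto
  have 1: "closedin (top_of_set S) {x\<in>S. \<phi> x \<le> c}"
    using continuous_closedin_preimage[OF assms(1), of "{..c}"] by (simp add: vimage_def Int_def)
  have 2: "closedin (top_of_set S) {x\<in>S. c \<le> \<phi> x}"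
    using continuous_closedin_preimage[OF assms(1), of "{c..}"] by (simp add: vimage_def Int_def)
  show ?thesis
    by (subst S, rule continuous_on_cases_local) (use 1 2 S assms in auto)
qed

lemma continuous_on_Pair_compose:
  assumes "continuous_on (I \<times> S) k" "continuous_on X u" "continuous_on X v"
    and "\<And>x. x \<in> X \<Longrightarrow> u x \<in> I" "\<And>x. x \<in> X \<Longrightarrow> v x \<in> S"
  shows "continuous_on X (\<lambda>x. k (u x, v x))"
  by (rule continuous_on_compose2[OF assms(1) continuous_on_Pair[OF assms(2,3)]]) (use assms(4,5) in auto)

text \<open>Dold's gluing step: a self-map homotopic to the identity over both members of a cover need not be
  homotopic to the identity, but the loop of homotopies over the overlap supplies a right inverse.\<close>

lemma right_inverse_of_locally_id:
  fixes T :: "('a::topological_space \<times> 'c::topological_space) set" and \<phi> :: "'a \<Rightarrow> real"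
  assumes e: "fmap T T e" and \<phi>: "continuous_on T (\<lambda>z. \<phi> (fst z))"
    and a: "fhom (over {l. \<phi> l \<le> 2/3} T) (over {l. \<phi> l \<le> 2/3} T) id e"
    and b: "fhom (over {l. 1/3 \<le> \<phi> l} T) (over {l. 1/3 \<le> \<phi> l} T) id e"
  shows "\<exists>g. fmap T T g \<and> fhom T T (e \<circ> g) id"
proof -
  define p :: "'a \<times> 'c \<Rightarrow> real" where "p z = \<phi> (fst z)" for z
  have p_pair: "p (l, x) = \<phi> l" for l x
    by (simp add: p_def)
  have p: "continuous_on X p" if "X \<subseteq> T" for X
    using continuous_on_subset[OF \<phi> that] by (simp add: p_def)
  have ps: "continuous_on X (\<lambda>q. p (snd q))" if "X \<subseteq> UNIV \<times> T" for X :: "(real \<times> 'a \<times> 'c) set"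
    by (rule continuous_on_compose2[OF p[OF order_refl] continuous_on_snd[OF continuous_on_id]]) (use that in auto)
  obtain ha where ha: "continuous_on ({0..1::real} \<times> over {l. \<phi> l \<le> 2/3} T) ha"
    "\<And>t z. t \<in> {0..1::real} \<Longrightarrow> z \<in> T \<Longrightarrow> p z \<le> 2/3 \<Longrightarrow> ha (t, z) \<in> T \<and> fst (ha (t, z)) = fst z"
    "\<And>z. z \<in> T \<Longrightarrow> p z \<le> 2/3 \<Longrightarrow> ha (0, z) = z" "\<And>z. z \<in> T \<Longrightarrow> p z \<le> 2/3 \<Longrightarrow> ha (1, z) = e z"
    using a by (elim fhomE) (simp add: over_iff p_def)
  \<comment> \<open>The cutoff \<open>6 * p z - 3\<close> runs from 0 at level 1/2 to 1 at level
    2/3, so \<open>e1\<close> is the identity up to level 1/2 and agrees with \<open>e\<close>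
    beyond level 2/3.\<close>
  define e1 where "e1 z = (if p z \<le> 2/3 then ha (clamp01 (6 * p z - 3), z) else e z)" for z
  have cont_e: "continuous_on X e" if "X \<subseteq> T" for X
    using continuous_on_subset[OF fmapD(1)[OF e] that] .
  have ee1: "fhom T T e e1"
  proof (rule fhomI[of _ "\<lambda>q. if p (snd q) \<le> 2/3
      then ha (max (1 - fst q) (clamp01 (6 * p (snd q) - 3)), snd q) else e (snd q)"])
    show "continuous_on ({0..1::real} \<times> T) (\<lambda>q. if p (snd q) \<le> 2/3
      then ha (max (1 - fst q) (clamp01 (6 * p (snd q) - 3)), snd q) else e (snd q))"
    proof (rule continuous_on_If_le)
      show "continuous_on {x \<in> {0..1::real} \<times> T. p (snd x) \<le> 2 / 3}
         (\<lambda>q. ha (max (1 - fst q) (clamp01 (6 * p (snd q) - 3)), snd q))"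
        by (rule continuous_on_Pair_compose[OF ha(1)])
          (auto intro!: continuous_intros ps simp: over_iff p_pair)
      show "continuous_on {x \<in> {0..1::real} \<times> T. 2 / 3 \<le> p (snd x)} (\<lambda>q. e (snd q))"
        by (rule continuous_on_compose2[OF cont_e[OF order_refl]]) (auto intro!: continuous_intros)
    qed (use ha in \<open>auto intro!: ps\<close>)
  qed (use ha fmapD[OF e] in \<open>auto simp: e1_def\<close>)
  have e1: "fmap T T e1"
    using fhom_fmap[OF ee1] by simp
  have e1_id: "e1 z = z" if "z \<in> T" "p z \<le> 1/2" for z
    using that ha by (simp add: e1_def)
  have "fhom (over {l. 1/3 \<le> \<phi> l} T) (over {l. 1/3 \<le> \<phi> l} T) id e1"
    by (rule fhom_trans[OF b fhom_over[OF ee1]])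
  then obtain hb where hb: "continuous_on ({0..1::real} \<times> over {l. 1/3 \<le> \<phi> l} T) hb"
    "\<And>t z. t \<in> {0..1::real} \<Longrightarrow> z \<in> T \<Longrightarrow> 1/3 \<le> p z \<Longrightarrow> hb (t, z) \<in> T \<and> fst (hb (t, z)) = fst z"
    "\<And>z. z \<in> T \<Longrightarrow> 1/3 \<le> p z \<Longrightarrow> hb (0, z) = z" "\<And>z. z \<in> T \<Longrightarrow> 1/3 \<le> p z \<Longrightarrow> hb (1, z) = e1 z"
    by (elim fhomE) (simp add: over_iff p_def)
  \<comment> \<open>Between levels 1/3 and 1/2 the map \<open>e1\<close> is the identity, so there
    \<open>hb\<close> is a loop based at the identity; \<open>g\<close> runs through it once, which
    makes the three formulas agree at both levels.\<close>
  define g where "g z = (if p z \<le> 1/3 then z else if p z \<le> 1/2 then hb (clamp01 (6 * p z - 2), z) else z)" for z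
  have g: "fmap T T g"
  proof (rule fmapI)
    show "continuous_on T g"
      unfolding g_def
    proof (rule continuous_on_If_le[OF p continuous_on_id continuous_on_If_le[OF p _ continuous_on_id]])
      show "continuous_on {x \<in> {x \<in> T. 1 / 3 \<le> p x}. p x \<le> 1 / 2} (\<lambda>x. hb (clamp01 (6 * p x - 2), x))"
        by (rule continuous_on_Pair_compose[OF hb(1)])
          (auto intro!: continuous_intros p simp: over_iff p_pair)
    qed (use hb e1_id in auto)
  qed (use hb in \<open>auto simp: g_def\<close>)
  \<comment> \<open>On all of \<open>1/3 \<le> p z\<close> the composite is \<open>hb\<close> at
    parameter \<open>clamp01 (6 * p z - 2)\<close>: below 1/2 because \<open>e1\<close> does nothing
    there, above because \<open>hb\<close> ends at \<open>e1\<close>. Shrinking the parameter to 0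
    deforms it to the identity.\<close>
  have "fhom T T (e1 \<circ> g) id"
  proof (rule fhomI[of _ "\<lambda>q. if p (snd q) \<le> 1/3 then snd q
      else hb ((1 - fst q) * clamp01 (6 * p (snd q) - 2), snd q)"])
    have r: "(1 - s) * clamp01 t \<in> {0..1}" if "s \<in> {0..1}" for s t
      using that by (auto intro: mult_le_one)
    show "continuous_on ({0..1::real} \<times> T) (\<lambda>q. if p (snd q) \<le> 1/3 then snd q
      else hb ((1 - fst q) * clamp01 (6 * p (snd q) - 2), snd q))"
    proof (rule continuous_on_If_le)
      show "continuous_on {x \<in> {0..1::real} \<times> T. 1 / 3 \<le> p (snd x)}
         (\<lambda>q. hb ((1 - fst q) * clamp01 (6 * p (snd q) - 2), snd q))"
        by (rule continuous_on_Pair_compose[OF hb(1)])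
          (use r in \<open>auto intro!: continuous_intros ps simp: over_iff p_pair\<close>)
      show "continuous_on {x \<in> {0..1::real} \<times> T. p (snd x) \<le> 1 / 3} (\<lambda>q. snd q)"
        by (intro continuous_intros)
    qed (use hb in \<open>auto intro!: ps\<close>)
    fix t :: real and z assume tz: "t \<in> {0..1}" "z \<in> T"
    show "(if p (snd (t, z)) \<le> 1/3 then snd (t, z)
          else hb ((1 - fst (t, z)) * clamp01 (6 * p (snd (t, z)) - 2), snd (t, z))) \<in> T"
      "fst (if p (snd (t, z)) \<le> 1/3 then snd (t, z)
          else hb ((1 - fst (t, z)) * clamp01 (6 * p (snd (t, z)) - 2), snd (t, z))) = fst z"
      using tz r[OF tz(1)] hb(2) by auto
  next
    fix z assume z: "z \<in> T"
    have "p (hb (clamp01 (6 * p z - 2), z)) = p z" if "1/3 \<le> p z"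
      using hb(2)[of _ z] z that by (simp add: p_def)
    then show "(if p (snd (0, z)) \<le> 1/3 then snd (0, z)
          else hb ((1 - fst (0, z)) * clamp01 (6 * p (snd (0, z)) - 2), snd (0, z))) = (e1 \<circ> g) z"
      using z hb e1_id by (auto simp: g_def)
    show "(if p (snd (1, z)) \<le> 1/3 then snd (1, z)
          else hb ((1 - fst (1, z)) * clamp01 (6 * p (snd (1, z)) - 2), snd (1, z))) = id z"
      using z hb by auto
  qed
  then have "fhom T T (e \<circ> g) id"
    by (rule fhom_trans[OF fhom_comp_right[OF ee1 g]])
  with g show ?thesis by blast
qed

text \<open>Over the overlap \<open>gU\<close> is homotopic to
  \<open>gV \<circ> f \<circ> gU\<close> and hence to \<open>gV\<close>; interpolating along this
  homotopy gives a global \<open>g\<close>. It may fail to be a right inverse, but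
  \<open>f \<circ> g\<close> is homotopic to the identity over each of two overlapping closed
  pieces, and \<open>right_inverse_of_locally_id\<close> supplies the correction. The first piece
  has to come with a right inverse only, so the output can serve as input of the next
  gluing.\<close>

lemma right_inverse_glue:
  fixes S :: "('a::topological_space \<times> 'b::topological_space) set"
    and T :: "('a \<times> 'c::topological_space) set" and \<phi> :: "'a \<Rightarrow> real"
  assumes f: "fmap S T f" and \<phi>: "continuous_on T (\<lambda>z. \<phi> (fst z))"
    and gU: "fmap (over {l. \<phi> l < 1} T) (over {l. \<phi> l < 1} S) gU"
            "fhom (over {l. \<phi> l < 1} T) (over {l. \<phi> l < 1} T) (f \<circ> gU) id"
    and V: "fheq (over {l. 0 < \<phi> l} S) (over {l. 0 < \<phi> l} T) f"
  shows "\<exists>g. fmap T S g \<and> fhom T T (f \<circ> g) id"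
proof -
  define p :: "'a \<times> 'c \<Rightarrow> real" where "p z = \<phi> (fst z)" for z
  have p_pair: "p (l, x) = \<phi> l" for l x
    by (simp add: p_def)
  have p: "continuous_on X p" if "X \<subseteq> T" for X
    using continuous_on_subset[OF \<phi> that] by (simp add: p_def)
  have ps: "continuous_on X (\<lambda>q. p (snd q))" if "X \<subseteq> UNIV \<times> T" for X :: "(real \<times> 'a \<times> 'c) set"
    by (rule continuous_on_compose2[OF p[OF order_refl] continuous_on_snd[OF continuous_on_id]]) (use that in auto)
  obtain gV where gV: "fmap (over {l. 0 < \<phi> l} T) (over {l. 0 < \<phi> l} S) gV"
    "fhom (over {l. 0 < \<phi> l} S) (over {l. 0 < \<phi> l} S) (gV \<circ> f) id"
    "fhom (over {l. 0 < \<phi> l} T) (over {l. 0 < \<phi> l} T) (f \<circ> gV) id"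
    using V by (auto simp: fheq_def)
  define W where "W = {l. \<phi> l < 1} \<inter> {l. 0 < \<phi> l}"
  have W: "W \<subseteq> {l. \<phi> l < 1}" "W \<subseteq> {l. 0 < \<phi> l}" by (auto simp: W_def)
  have res: "fhom (over A X) (over A Y) h k" if "fhom (over B X) (over B Y) h k" "A \<subseteq> B"
    for A B h k and X :: "('a \<times> 'x::topological_space) set" and Y :: "('a \<times> 'y::topological_space) set"
    using fhom_over[OF that(1), of A] that(2) by (simp add: over_over Int_absorb2)
  have resm: "fmap (over A X) (over A Y) h" if "fmap (over B X) (over B Y) h" "A \<subseteq> B"
    for A B h and X :: "('a \<times> 'x::topological_space) set" and Y :: "('a \<times> 'y::topological_space) set"
    using fmap_over[OF that(1), of A] that(2) by (simp add: over_over Int_absorb2)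
  have "fhom (over W T) (over W S) (gV \<circ> (f \<circ> gU)) (gV \<circ> id)"
    by (rule fhom_comp_left[OF res[OF gU(2) W(1)] resm[OF gV(1) W(2)]])
  moreover have "fhom (over W T) (over W S) ((gV \<circ> f) \<circ> gU) (id \<circ> gU)"
    by (rule fhom_comp_right[OF res[OF gV(2) W(2)] resm[OF gU(1) W(1)]])
  ultimately have "fhom (over W T) (over W S) gU gV"
    by (simp add: o_assoc) (meson fhom_sym fhom_trans)
  then obtain k where k: "continuous_on ({0..1::real} \<times> over W T) k"
    "\<And>t z. t \<in> {0..1::real} \<Longrightarrow> z \<in> T \<Longrightarrow> 0 < p z \<Longrightarrow> p z < 1 \<Longrightarrow> k (t, z) \<in> S \<and> fst (k (t, z)) = fst z"
    "\<And>z. z \<in> T \<Longrightarrow> 0 < p z \<Longrightarrow> p z < 1 \<Longrightarrow> k (0, z) = gU z"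
    "\<And>z. z \<in> T \<Longrightarrow> 0 < p z \<Longrightarrow> p z < 1 \<Longrightarrow> k (1, z) = gV z"
    by (elim fhomE) (simp add: over_iff p_def W_def)
  have kc: "continuous_on X (\<lambda>x. k (u x, v x))"
    if "continuous_on X u" "continuous_on X v" "\<And>x. x \<in> X \<Longrightarrow> u x \<in> {0..1} \<and> v x \<in> T \<and> 0 < p (v x) \<and> p (v x) < 1"
    for X :: "'x::topological_space set" and u v
    by (rule continuous_on_Pair_compose[OF k(1) that(1,2)]) (use that(3) in \<open>auto simp: over_iff W_def p_def\<close>)
  have gUc: "continuous_on X (\<lambda>x. gU (v x))"
    if "continuous_on X v" "\<And>x. x \<in> X \<Longrightarrow> v x \<in> T \<and> p (v x) < 1" for X :: "'x::topological_space set" and v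
    by (rule continuous_on_compose2[OF fmapD(1)[OF gU(1)] that(1)])
      (use that(2) in \<open>auto simp: over_iff p_def\<close>)
  have gVc: "continuous_on X (\<lambda>x. gV (v x))"
    if "continuous_on X v" "\<And>x. x \<in> X \<Longrightarrow> v x \<in> T \<and> 0 < p (v x)" for X :: "'x::topological_space set" and v
    by (rule continuous_on_compose2[OF fmapD(1)[OF gV(1)] that(1)])
      (use that(2) in \<open>auto simp: over_iff p_def\<close>)
  have gUm: "gU z \<in> S \<and> fst (gU z) = fst z" if "z \<in> T" "p z < 1" for z
    using fmapD(2,3)[OF gU(1), of z] that by (simp add: over_iff p_def)
  have gVm: "gV z \<in> S \<and> fst (gV z) = fst z" if "z \<in> T" "0 < p z" for z
    using fmapD(2,3)[OF gV(1), of z] that by (simp add: over_iff p_def)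
  \<comment> \<open>The middle third sweeps the homotopy \<open>k\<close> once, from
    \<open>gU\<close> at level 1/3 to \<open>gV\<close> at level 2/3.\<close>
  define g where "g z = (if p z \<le> 1/3 then gU z else if p z \<le> 2/3 then k (clamp01 (3 * p z - 1), z) else gV z)" for z
  have g: "fmap T S g"
  proof (rule fmapI)
    show "continuous_on T g"
      unfolding g_def
    proof (rule continuous_on_If_le[OF p gUc[OF continuous_on_id] continuous_on_If_le[OF p _ gVc[OF continuous_on_id]]])
      show "continuous_on {x \<in> {x \<in> T. 1 / 3 \<le> p x}. p x \<le> 2 / 3} (\<lambda>x. k (clamp01 (3 * p x - 1), x))"
        by (rule kc) (auto intro!: continuous_intros p)
    qed (use k in auto)
  qed (use k gUm gVm in \<open>auto simp: g_def\<close>)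
  have T1: "fhom (over {l. \<phi> l \<le> 2/3} T) (over {l. \<phi> l \<le> 2/3} S) gU g"
  proof (rule fhomI[of _ "\<lambda>q. if p (snd q) \<le> 1/3 then gU (snd q) else k (fst q * clamp01 (3 * p (snd q) - 1), snd q)"])
    have r: "s * clamp01 t \<in> {0..1}" if "s \<in> {0..1}" for s t
      using that by (auto intro: mult_le_one)
    show "continuous_on ({0..1::real} \<times> over {l. \<phi> l \<le> 2/3} T)
      (\<lambda>q. if p (snd q) \<le> 1/3 then gU (snd q) else k (fst q * clamp01 (3 * p (snd q) - 1), snd q))"
    proof (rule continuous_on_If_le)
      show "continuous_on ({0..1::real} \<times> over {l. \<phi> l \<le> 2/3} T) (\<lambda>q. p (snd q))"
        by (rule ps) (auto simp: over_iff)
      show "continuous_on {x \<in> {0..1::real} \<times> over {l. \<phi> l \<le> 2/3} T. p (snd x) \<le> 1/3} (\<lambda>q. gU (snd q))"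
        by (rule gUc) (auto simp: over_iff intro!: continuous_intros)
      show "continuous_on {x \<in> {0..1::real} \<times> over {l. \<phi> l \<le> 2/3} T. 1/3 \<le> p (snd x)}
        (\<lambda>q. k (fst q * clamp01 (3 * p (snd q) - 1), snd q))"
        by (rule kc) (use r in \<open>auto simp: over_iff p_pair intro!: continuous_intros ps\<close>)
    qed (use k in \<open>auto simp: over_iff\<close>)
    fix t :: real and z assume tz: "t \<in> {0..1}" "z \<in> over {l. \<phi> l \<le> 2/3} T"
    then have *: "z \<in> T" "p z \<le> 2/3" by (auto simp: over_iff p_def)
    show "(if p (snd (t, z)) \<le> 1/3 then gU (snd (t, z))
          else k (fst (t, z) * clamp01 (3 * p (snd (t, z)) - 1), snd (t, z))) \<in> over {l. \<phi> l \<le> 2/3} S"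
      "fst (if p (snd (t, z)) \<le> 1/3 then gU (snd (t, z))
          else k (fst (t, z) * clamp01 (3 * p (snd (t, z)) - 1), snd (t, z))) = fst z"
      using * tz r[OF tz(1)] k(2) gUm[of z] by (auto simp: over_iff)
  qed (use k in \<open>auto simp: over_iff g_def p_pair\<close>)
  have "fhom (over {l. \<phi> l \<le> 2/3} T) (over {l. \<phi> l \<le> 2/3} T) (f \<circ> gU) (f \<circ> g)"
    by (rule fhom_comp_left[OF T1 fmap_over[OF f]])
  moreover have "fhom (over {l. \<phi> l \<le> 2/3} T) (over {l. \<phi> l \<le> 2/3} T) (f \<circ> gU) id"
    by (rule res[OF gU(2)]) auto
  ultimately have a: "fhom (over {l. \<phi> l \<le> 2/3} T) (over {l. \<phi> l \<le> 2/3} T) id (f \<circ> g)"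
    by (meson fhom_sym fhom_trans)
  have T2: "fhom (over {l. 1/3 \<le> \<phi> l} T) (over {l. 1/3 \<le> \<phi> l} S) g gV"
  proof (rule fhomI[of _ "\<lambda>q. if p (snd q) \<le> 2/3 then k (max (fst q) (clamp01 (3 * p (snd q) - 1)), snd q) else gV (snd q)"])
    show "continuous_on ({0..1::real} \<times> over {l. 1/3 \<le> \<phi> l} T)
      (\<lambda>q. if p (snd q) \<le> 2/3 then k (max (fst q) (clamp01 (3 * p (snd q) - 1)), snd q) else gV (snd q))"
    proof (rule continuous_on_If_le)
      show "continuous_on ({0..1::real} \<times> over {l. 1/3 \<le> \<phi> l} T) (\<lambda>q. p (snd q))"
        by (rule ps) (auto simp: over_iff)
      show "continuous_on {x \<in> {0..1::real} \<times> over {l. 1/3 \<le> \<phi> l} T. 2/3 \<le> p (snd x)} (\<lambda>q. gV (snd q))"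
        by (rule gVc) (auto simp: over_iff intro!: continuous_intros)
      show "continuous_on {x \<in> {0..1::real} \<times> over {l. 1/3 \<le> \<phi> l} T. p (snd x) \<le> 2/3}
        (\<lambda>q. k (max (fst q) (clamp01 (3 * p (snd q) - 1)), snd q))"
        by (rule kc) (auto simp: over_iff p_pair intro!: continuous_intros ps)
    qed (use k in \<open>auto simp: over_iff\<close>)
    fix t :: real and z assume tz: "t \<in> {0..1}" "z \<in> over {l. 1/3 \<le> \<phi> l} T"
    then have *: "z \<in> T" "1/3 \<le> p z" by (auto simp: over_iff p_def)
    show "(if p (snd (t, z)) \<le> 2/3 then k (max (fst (t, z)) (clamp01 (3 * p (snd (t, z)) - 1)), snd (t, z))
          else gV (snd (t, z))) \<in> over {l. 1/3 \<le> \<phi> l} S"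
      "fst (if p (snd (t, z)) \<le> 2/3 then k (max (fst (t, z)) (clamp01 (3 * p (snd (t, z)) - 1)), snd (t, z))
          else gV (snd (t, z))) = fst z"
      using * tz(1) k(2)[of "max t (clamp01 (3 * p z - 1))" z] gVm[of z] by (auto simp: over_iff p_def)
  qed (use k in \<open>auto simp: over_iff g_def p_pair\<close>)
  have "fhom (over {l. 1/3 \<le> \<phi> l} T) (over {l. 1/3 \<le> \<phi> l} T) (f \<circ> g) (f \<circ> gV)"
    by (rule fhom_comp_left[OF T2 fmap_over[OF f]])
  moreover have "fhom (over {l. 1/3 \<le> \<phi> l} T) (over {l. 1/3 \<le> \<phi> l} T) (f \<circ> gV) id"
    by (rule res[OF gV(3)]) auto
  ultimately have b: "fhom (over {l. 1/3 \<le> \<phi> l} T) (over {l. 1/3 \<le> \<phi> l} T) id (f \<circ> g)"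
    by (meson fhom_sym fhom_trans)
  obtain r where r: "fmap T T r" "fhom T T (f \<circ> g \<circ> r) id"
    using right_inverse_of_locally_id[OF fmap_comp[OF g f] \<phi> a b] by blast
  then show ?thesis
    using fmap_comp[OF r(1) g] by (auto simp: o_assoc)
qed

lemma right_inverse_finite_cover:
  fixes S :: "('a::metric_space \<times> 'b::topological_space) set"
    and T :: "('a \<times> 'c::topological_space) set"
  assumes "finite C" and f: "fmap S T f"
    and r: "\<And>c. c \<in> C \<Longrightarrow> fheq (over (ball c (r c)) S) (over (ball c (r c)) T) f"
  shows "\<exists>g. fmap (over (\<Union>c\<in>C. ball c (r c)) T) (over (\<Union>c\<in>C. ball c (r c)) S) g \<and>
     fhom (over (\<Union>c\<in>C. ball c (r c)) T) (over (\<Union>c\<in>C. ball c (r c)) T) (f \<circ> g) id"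
  using assms(1) r
proof (induction C rule: finite_induct)
  case empty
  show ?case
    by (intro exI[of _ "\<lambda>z. (fst z, undefined)"]) (auto simp: over_def fmap_def intro!: fhomI[of _ "\<lambda>q. snd q"])
next
  case (insert c C)
  define A where "A = (\<Union>c\<in>C. ball c (r c))"
  define B where "B = A \<union> ball c (r c)"
  obtain gU where gU: "fmap (over A T) (over A S) gU" "fhom (over A T) (over A T) (f \<circ> gU) id"
    unfolding A_def using insert.IH insert.prems by blast
  define \<tau> where "\<tau> c' l = max 0 (r c' - dist c' l)" for c' l
  have \<tau>0: "0 \<le> \<tau> c' l" and \<tau>: "0 < \<tau> c' l \<longleftrightarrow> l \<in> ball c' (r c')" for c' l
    by (auto simp: \<tau>_def)
  have s0: "0 \<le> (\<Sum>c'\<in>C. \<tau> c' l)" and s: "0 < (\<Sum>c'\<in>C. \<tau> c' l) \<longleftrightarrow> l \<in> A" for l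
  proof -
    show "0 \<le> (\<Sum>c'\<in>C. \<tau> c' l)" by (simp add: sum_nonneg \<tau>0)
    then have "0 < (\<Sum>c'\<in>C. \<tau> c' l) \<longleftrightarrow> (\<Sum>c'\<in>C. \<tau> c' l) \<noteq> 0" by linarith
    also have "\<dots> \<longleftrightarrow> (\<exists>c'\<in>C. \<tau> c' l \<noteq> 0)"
      using insert.hyps(1) by (simp add: sum_nonneg_eq_0_iff \<tau>0)
    also have "\<dots> \<longleftrightarrow> (\<exists>c'\<in>C. 0 < \<tau> c' l)" using \<tau>0 by (metis less_le)
    finally show "0 < (\<Sum>c'\<in>C. \<tau> c' l) \<longleftrightarrow> l \<in> A" by (simp add: \<tau> A_def)
  qed
  \<comment> \<open>The share of the new ball among the tent functions \<open>\<tau>\<close>: on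
    \<open>B\<close> it is below 1 exactly on the old union and positive exactly on the new
    ball.\<close>
  define \<phi> where "\<phi> l = \<tau> c l / ((\<Sum>c'\<in>C. \<tau> c' l) + \<tau> c l)" for l
  have pos: "0 < (\<Sum>c'\<in>C. \<tau> c' l) + \<tau> c l" if "l \<in> B" for l
    using that s[of l] \<tau>[of c l] s0[of l] \<tau>0[of c l] unfolding B_def by fastforce
  have lt1: "\<phi> l < 1 \<longleftrightarrow> l \<in> A" if "l \<in> B" for l
    using pos[OF that] s[of l] by (simp add: \<phi>_def)
  have gt0: "0 < \<phi> l \<longleftrightarrow> l \<in> ball c (r c)" if "l \<in> B" for l
    using pos[OF that] \<tau>[of c l] by (simp add: \<phi>_def zero_less_divide_iff)
  have cont: "continuous_on (over B T) (\<lambda>z. \<phi> (fst z))"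
    unfolding \<phi>_def \<tau>_def
    by (intro continuous_intros) (use pos in \<open>force simp: over_iff \<tau>_def\<close>)
  have o1: "over {l. \<phi> l < 1} (over B X) = over A X" for X :: "('a \<times> 'x) set"
    using lt1 by (auto simp: over_iff B_def)
  have o2: "over {l. 0 < \<phi> l} (over B X) = over (ball c (r c)) X" for X :: "('a \<times> 'x) set"
    using gt0 by (auto simp: over_iff B_def)
  have "\<exists>g. fmap (over B T) (over B S) g \<and> fhom (over B T) (over B T) (f \<circ> g) id"
    by (rule right_inverse_glue[OF fmap_over[OF f] cont, unfolded o1 o2, OF gU]) (use insert in auto)
  moreover have "B = (\<Union>c\<in>insert c C. ball c (r c))"
    by (auto simp: A_def B_def)
  ultimately show ?case by (simp only:)
qed

lemma over_self: "fst ` X \<subseteq> A \<Longrightarrow> over A X = X"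
  by (force simp: over_iff)

text \<open>Finitely many balls cover the base, which yields a right inverse \<open>g\<close> of
  \<open>f\<close>. Over each ball \<open>g\<close> is a right inverse of an equivalence, hence an
  equivalence, so the same argument gives \<open>g\<close> a right inverse \<open>h\<close>. Then
  \<open>f\<close> is homotopic to \<open>f \<circ> g \<circ> h\<close> and so to \<open>h\<close>,
  which makes \<open>g\<close> a two-sided inverse of \<open>f\<close>.\<close>

theorem fibre_homotopy_equivalence_local:
  fixes S :: "('a::metric_space \<times> 'b::topological_space) set"
    and T :: "('a \<times> 'c::topological_space) set"
  assumes L: "compact L" "fst ` S \<subseteq> L" "fst ` T \<subseteq> L" and f: "fmap S T f"
    and loc: "\<And>l. l \<in> L \<Longrightarrow> \<exists>r>0. fheq (over (ball l r) S) (over (ball l r) T) f"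
  shows "fheq S T f"
proof -
  obtain r where r: "\<And>l. l \<in> L \<Longrightarrow> 0 < r l \<and> fheq (over (ball l (r l)) S) (over (ball l (r l)) T) f"
    using loc by metis
  have "L \<subseteq> (\<Union>l\<in>L. ball l (r l))" using r by fastforce
  then obtain C where C: "C \<subseteq> L" "finite C" "L \<subseteq> (\<Union>c\<in>C. ball c (r c))"
    using compactE_image[OF L(1), of L "\<lambda>l. ball l (r l)"] by auto
  have oS: "over (\<Union>c\<in>C. ball c (r c)) S = S" and oT: "over (\<Union>c\<in>C. ball c (r c)) T = T"
    by (intro over_self order_trans[OF L(2) C(3)] order_trans[OF L(3) C(3)])+
  have "\<exists>g. fmap T S g \<and> fhom T T (f \<circ> g) id"
    using right_inverse_finite_cover[OF C(2) f, of r] r C(1) unfolding oS oT by blast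
  then obtain g where g: "fmap T S g" "fhom T T (f \<circ> g) id" by blast
  have "fheq (over (ball l (r l)) T) (over (ball l (r l)) S) g" if "l \<in> L" for l
    using fheq_inverse[OF conjunct2[OF r[OF that]] fmap_over[OF g(1)]] fhom_over[OF g(2)] by simp
  then have "\<exists>h. fmap S T h \<and> fhom S S (g \<circ> h) id"
    using right_inverse_finite_cover[OF C(2) g(1), of r] C(1) unfolding oS oT by blast
  then obtain h where h: "fmap S T h" "fhom S S (g \<circ> h) id" by blast
  have "fhom S T (f \<circ> (g \<circ> h)) (f \<circ> id)"
    by (rule fhom_comp_left[OF h(2) f])
  moreover have "fhom S T (f \<circ> g \<circ> h) (id \<circ> h)"
    by (rule fhom_comp_right[OF g(2) h(1)])
  ultimately have fh: "fhom S T f h"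
    by (simp add: o_assoc) (meson fhom_sym fhom_trans)
  have "fhom S S (g \<circ> f) id"
    by (rule fhom_trans[OF fhom_comp_left[OF fh g(1)] h(2)])
  then show ?thesis by (rule fheqI[OF f g(1) _ g(2)])
qed

subsection \<open>Sphere bundles\<close>

abbreviation vn :: "nat \<Rightarrow> rvec \<Rightarrow> real" where
  "vn N x \<equiv> L2_set x {..<N}"

definition nz :: "nat \<Rightarrow> rvec \<Rightarrow> rvec" where
  "nz N x = (\<lambda>i. x i / vn N x)"

lemma mvr_mvr: "mvr M N A (mvr N K B x) = mvr M K (\<lambda>i j. \<Sum>k<N. A i k * B k j) x"
proof
  fix i
  have "(\<Sum>j<N. A i j * (\<Sum>k<K. B j k * x k)) = (\<Sum>k<K. (\<Sum>j<N. A i j * B j k) * x k)"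
    by (simp add: sum_distrib_left sum_distrib_right mult.assoc) (rule sum.swap)
  then show "mvr M N A (mvr N K B x) i = mvr M K (\<lambda>i j. \<Sum>k<N. A i k * B k j) x i"
    by (simp add: mvr_def)
qed

lemma mvr_linear: "mvr M N A (\<lambda>i. a * x i + b * y i) = (\<lambda>i. a * mvr M N A x i + b * mvr M N A y i)"
  by (rule ext) (simp add: mvr_def sum.distrib sum_distrib_left algebra_simps)

lemma mvr_scale: "mvr M N A (\<lambda>i. x i / c) = (\<lambda>i. mvr M N A x i / c)"
  by (rule ext) (simp add: mvr_def sum_divide_distrib)

lemma mvr_diff_mat: "mvr M N (\<lambda>i j. A i j - B i j) x = (\<lambda>i. mvr M N A x i - mvr M N B x i)"
  by (rule ext) (simp add: mvr_def sum_subtractf algebra_simps)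

lemma vn_component: "i < N \<Longrightarrow> \<bar>x i\<bar> \<le> vn N x"
  using member_le_L2_set[of "{..<N}" i "\<lambda>i. \<bar>x i\<bar>"] by (simp add: L2_set_def)

lemma vn_mvr_le: "vn M (mvr M N A x) \<le> (\<Sum>i<M. \<Sum>j<N. \<bar>A i j\<bar>) * vn N x"
proof -
  have "vn M (mvr M N A x) \<le> (\<Sum>i<M. \<bar>mvr M N A x i\<bar>)"
    by (rule L2_set_le_sum_abs)
  also have "\<dots> \<le> (\<Sum>i<M. \<Sum>j<N. \<bar>A i j\<bar> * vn N x)"
  proof (rule sum_mono)
    fix i assume "i \<in> {..<M}"
    then have "\<bar>mvr M N A x i\<bar> \<le> (\<Sum>j<N. \<bar>A i j * x j\<bar>)"
      by (simp add: mvr_def sum_abs)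
    also have "\<dots> \<le> (\<Sum>j<N. \<bar>A i j\<bar> * vn N x)"
      by (rule sum_mono) (auto simp: abs_mult intro!: mult_left_mono vn_component)
    finally show "\<bar>mvr M N A x i\<bar> \<le> (\<Sum>j<N. \<bar>A i j\<bar> * vn N x)" .
  qed
  also have "\<dots> = (\<Sum>i<M. \<Sum>j<N. \<bar>A i j\<bar>) * vn N x"
    by (simp add: sum_distrib_right)
  finally show ?thesis .
qed

lemma vn_eq_1_iff: "vn N x = 1 \<longleftrightarrow> (\<Sum>i<N. (x i)\<^sup>2) = 1"
  by (simp add: L2_set_def)

lemma vn_scale: "vn N (\<lambda>i. x i / c) = vn N x / \<bar>c\<bar>"
  by (simp add: L2_set_def power_divide real_sqrt_divide flip: sum_divide_distrib)

lemma vn_minus: "vn N (\<lambda>i. x i - y i) = vn N (\<lambda>i. y i - x i)"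
  by (simp add: L2_set_def power2_commute)

lemma vn_triangle: "vn N (\<lambda>i. x i - z i) \<le> vn N (\<lambda>i. x i - y i) + vn N (\<lambda>i. y i - z i)"
  using L2_set_triangle_ineq[of "\<lambda>i. x i - y i" "\<lambda>i. y i - z i" "{..<N}"] by simp

lemma vn_diff_ge: "vn N x - vn N y \<le> vn N (\<lambda>i. x i - y i)"
  using L2_set_triangle_ineq[of "\<lambda>i. x i - y i" y "{..<N}"] by simp

lemma vn_nz: "vn N x \<noteq> 0 \<Longrightarrow> vn N (nz N x) = 1"
  by (simp add: nz_def vn_scale)

lemma nz_unit: "vn N x = 1 \<Longrightarrow> nz N x = x"
  by (simp add: nz_def)

lemma nz_divide: "c > 0 \<Longrightarrow> nz N (\<lambda>i. x i / c) = nz N x"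
  by (rule ext) (simp add: nz_def vn_scale)

text \<open>The norm of \<open>v\<close> is within 1/4 of 1, so normalising moves it by less than
  1/4 and the two errors add up. Two such moves in a row stay below 1, the range in which
  straight-line homotopies avoid the origin.\<close>

lemma nz_close:
  assumes "vn N x = 1" "vn N (\<lambda>i. v i - x i) < 1/4"
  shows "vn N v \<noteq> 0" "vn N (\<lambda>i. nz N v i - x i) < 1/2"
proof -
  have 1: "\<bar>vn N v - 1\<bar> < 1/4"
    using assms vn_diff_ge[of v N x] vn_diff_ge[of x N v] vn_minus[of x v N] by linarith
  then show nz: "vn N v \<noteq> 0" by auto
  have "nz N v i - v i = v i / vn N v * (1 - vn N v)" for i
    using nz by (simp add: nz_def field_simps)
  then have "vn N (\<lambda>i. nz N v i - v i) = vn N (\<lambda>i. (v i / vn N v) * (1 - vn N v))"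
    by simp
  also have "\<dots> = vn N (\<lambda>i. \<bar>1 - vn N v\<bar> * (v i / vn N v))"
    by (simp add: L2_set_def power_mult_distrib power_divide mult.commute)
  also have "\<dots> = \<bar>1 - vn N v\<bar> * vn N (\<lambda>i. v i / vn N v)"
    by (subst L2_set_right_distrib) auto
  also have "\<dots> = \<bar>1 - vn N v\<bar>"
    using vn_nz[OF nz] by (simp add: nz_def)
  finally have "vn N (\<lambda>i. nz N v i - v i) < 1/4" using 1 by linarith
  then show "vn N (\<lambda>i. nz N v i - x i) < 1/2"
    using vn_triangle[where N = N and x = "nz N v" and z = x and y = v] assms(2) by linarith
qed

lemma continuous_on_vn [continuous_intros]:
  assumes "continuous_on X u" shows "continuous_on X (\<lambda>x. vn N (u x))"
  unfolding L2_set_def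
  by (intro continuous_intros continuous_on_product_then_coordinatewise[OF assms])

lemma continuous_on_nz:
  assumes "continuous_on X u" "\<And>x. x \<in> X \<Longrightarrow> vn N (u x) \<noteq> 0"
  shows "continuous_on X (\<lambda>x. nz N (u x))"
  unfolding nz_def
  by (intro continuous_intros continuous_on_product_then_coordinatewise[OF assms(1)] assms) (use assms in auto)

lemma continuous_on_mvr:
  assumes "\<And>i j. i < M \<Longrightarrow> j < N \<Longrightarrow> continuous_on X (\<lambda>x. A x i j)" "continuous_on X u"
  shows "continuous_on X (\<lambda>x. mvr M N (A x) (u x))"
proof (rule continuous_on_coordinatewise_then_product)
  fix i
  show "continuous_on X (\<lambda>x. mvr M N (A x) (u x) i)"
    by (cases "i < M")
      (auto simp: mvr_def intro!: continuous_intros assms continuous_on_product_then_coordinatewise[OF assms(2)])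
qed

lemma fibre_iff:
  assumes "is_vbundle \<Lambda> (N, P)" "l \<in> \<Lambda>"
  shows "x \<in> fibre (N, P) l \<longleftrightarrow> mvr N N (P l) x = x"
proof -
  have "mvr N N (P l) (mvr N N (P l) y) = mvr N N (P l) y" for y
    unfolding mvr_mvr using assms by (auto simp: mvr_def is_vbundle_def intro!: ext sum.cong)
  then show ?thesis by (auto simp: fibre_def) (metis rangeI)
qed

lemma mem_sphere_bundle:
  assumes "is_vbundle \<Lambda> (N, P)"
  shows "z \<in> sphere_bundle \<Lambda> (N, P) \<longleftrightarrow> fst z \<in> \<Lambda> \<and> mvr N N (P (fst z)) (snd z) = snd z \<and> vn N (snd z) = 1"
  by (cases z) (auto simp: sphere_bundle_def fibre_iff[OF assms] vn_eq_1_iff)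

lemma vbundle_cont: "is_vbundle \<Lambda> (N, P) \<Longrightarrow> i < N \<Longrightarrow> j < N \<Longrightarrow> continuous_on \<Lambda> (\<lambda>l. P l i j)"
  by (simp add: is_vbundle_def)

lemma vbundle_idem: "is_vbundle \<Lambda> (N, P) \<Longrightarrow> l \<in> \<Lambda> \<Longrightarrow> mvr N N (P l) (mvr N N (P l) y) = mvr N N (P l) y"
  using fibre_iff[of \<Lambda> N P l "mvr N N (P l) y"] by (auto simp: fibre_def)

lemma vbundle_cont_compose:
  assumes "is_vbundle \<Lambda> (N, P)" "i < N" "j < N" "continuous_on X u" "u ` X \<subseteq> \<Lambda>"
  shows "continuous_on X (\<lambda>x. P (u x) i j)"
  by (rule continuous_on_compose2[OF vbundle_cont[OF assms(1-3)] assms(4,5)])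

text \<open>A segment from a unit vector to a point at distance less than 1 misses the origin, and
  it stays in the fibre by linearity, so it can be normalised back to the sphere.\<close>

lemma fhom_straight_line:
  assumes E: "is_vbundle \<Lambda> (N, P)"
    and a: "fmap Z (sphere_bundle \<Lambda> (N, P)) a" and b: "fmap Z (sphere_bundle \<Lambda> (N, P)) b"
    and ab: "\<And>z. z \<in> Z \<Longrightarrow> vn N (\<lambda>i. snd (a z) i - snd (b z) i) < 1"
  shows "fhom Z (sphere_bundle \<Lambda> (N, P)) a b"
proof -
  define u where "u q = (\<lambda>i. (1 - fst q) * snd (a (snd q)) i + fst q * snd (b (snd q)) i)" for q :: "real \<times> _"
  have sa: "mvr N N (P (fst z)) (snd (a z)) = snd (a z)" "vn N (snd (a z)) = 1" "fst z \<in> \<Lambda>" "fst (a z) = fst z" if "z \<in> Z" for z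
    using fmapD(2,3)[OF a that] by (simp_all add: mem_sphere_bundle[OF E])
  have sb: "mvr N N (P (fst z)) (snd (b z)) = snd (b z)" "vn N (snd (b z)) = 1" "fst (b z) = fst z" if "z \<in> Z" for z
    using fmapD(2,3)[OF b that] by (simp_all add: mem_sphere_bundle[OF E])
  have pos: "vn N (u (t, z)) \<noteq> 0" if "t \<in> {0..1}" "z \<in> Z" for t z
  proof -
    have "vn N (\<lambda>i. snd (a z) i - u (t, z) i) = vn N (\<lambda>i. t * (snd (a z) i - snd (b z) i))"
      by (simp add: u_def algebra_simps)
    also have "\<dots> = t * vn N (\<lambda>i. snd (a z) i - snd (b z) i)"
      using that by (subst L2_set_right_distrib) auto
    also have "\<dots> \<le> vn N (\<lambda>i. snd (a z) i - snd (b z) i)"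
      using that by (intro mult_left_le_one_le) auto
    also have "\<dots> < 1" by (rule ab[OF that(2)])
    finally show ?thesis using vn_diff_ge[of "snd (a z)" N "u (t, z)"] sa(2)[OF that(2)] by linarith
  qed
  have lin: "mvr N N (P (fst z)) (u (t, z)) = u (t, z)" if "z \<in> Z" for t z
    using sa(1)[OF that] sb(1)[OF that] by (simp add: u_def mvr_linear)
  have ca: "continuous_on ({0..1::real} \<times> Z) (\<lambda>q. snd (a (snd q)) i)" for i
    by (rule continuous_on_product_then_coordinatewise[OF continuous_on_snd
          [OF continuous_on_compose2[OF fmapD(1)[OF a] continuous_on_snd[OF continuous_on_id]]]]) auto
  have cb: "continuous_on ({0..1::real} \<times> Z) (\<lambda>q. snd (b (snd q)) i)" for i
    by (rule continuous_on_product_then_coordinatewise[OF continuous_on_snd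
          [OF continuous_on_compose2[OF fmapD(1)[OF b] continuous_on_snd[OF continuous_on_id]]]]) auto
  have cu: "continuous_on ({0..1} \<times> Z) u"
    unfolding u_def
    by (intro continuous_on_coordinatewise_then_product) (intro continuous_intros ca cb)
  show ?thesis
  proof (rule fhomI[of _ "\<lambda>q. (fst (snd q), nz N (u q))"])
    show "continuous_on ({0..1} \<times> Z) (\<lambda>q. (fst (snd q), nz N (u q)))"
      by (intro continuous_on_Pair continuous_on_nz cu continuous_intros) (use pos in auto)
    fix t :: real and z assume tz: "t \<in> {0..1}" "z \<in> Z"
    show "(fst (snd (t, z)), nz N (u (t, z))) \<in> sphere_bundle \<Lambda> (N, P)"
      using sa(3)[OF tz(2)] vn_nz[OF pos[OF tz]] lin[OF tz(2)]
      by (simp add: mem_sphere_bundle[OF E]) (simp add: nz_def mvr_scale)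
  qed (use sa sb in \<open>auto simp: u_def nz_unit prod_eq_iff\<close>)
qed

text \<open>Vectors are functions on all of \<open>nat\<close> with the product topology, so
  compactness of spheres rests on Tychonoff's theorem.\<close>

lemma compact_unit_cube: "compact {x :: nat \<Rightarrow> real. \<forall>i. \<bar>x i\<bar> \<le> 1}"
proof -
  have "compactin (product_topology (\<lambda>_. euclidean) UNIV) (PiE UNIV (\<lambda>_. {-1..1::real}))"
    by (simp add: compactin_PiE)
  moreover have "PiE UNIV (\<lambda>_. {-1..1::real}) = {x :: nat \<Rightarrow> real. \<forall>i. \<bar>x i\<bar> \<le> 1}"
    by (auto simp: PiE_UNIV_domain abs_le_iff Pi_iff minus_le_iff)
  ultimately show ?thesis by (metis compactin_euclidean_iff euclidean_product_topology)
qed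

text \<open>Being fixed by the idempotent and having norm 1 are closed conditions, and fixed vectors
  vanish from index \<open>N\<close> on, so the sphere bundle is closed in \<open>\<Lambda>\<close>
  times the cube.\<close>

lemma compact_sphere_bundle:
  fixes \<Lambda> :: "'a::t2_space set"
  assumes E: "is_vbundle \<Lambda> (N, P)" and "compact \<Lambda>"
  shows "compact (sphere_bundle \<Lambda> (N, P))"
proof -
  let ?C = "{x :: nat \<Rightarrow> real. \<forall>i. \<bar>x i\<bar> \<le> 1}"
  let ?K = "\<Lambda> \<times> ?C"
  have cK: "compact ?K" by (intro compact_Times assms compact_unit_cube)
  have c1: "continuous_on ?K (\<lambda>z. mvr N N (P (fst z)) (snd z) i - snd z i)" for i
    by (intro continuous_intros continuous_on_product_then_coordinatewise[OF continuous_on_mvr]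
        continuous_on_product_then_coordinatewise[OF continuous_on_snd[OF continuous_on_id]]
        vbundle_cont_compose[OF E]) auto
  have c2: "continuous_on ?K (\<lambda>z. vn N (snd z))"
    by (intro continuous_intros)
  have "sphere_bundle \<Lambda> (N, P) = (?K \<inter> (\<lambda>z. vn N (snd z)) -` {1})
      \<inter> (\<Inter>i. ?K \<inter> (\<lambda>z. mvr N N (P (fst z)) (snd z) i - snd z i) -` {0})"
  proof (intro set_eqI iffI)
    fix z assume "z \<in> sphere_bundle \<Lambda> (N, P)"
    then have z: "fst z \<in> \<Lambda>" "mvr N N (P (fst z)) (snd z) = snd z" "vn N (snd z) = 1"
      by (simp_all add: mem_sphere_bundle[OF E])
    have "\<bar>snd z i\<bar> \<le> 1" for i
    proof (cases "i < N")
      case True then show ?thesis using vn_component[of i N "snd z"] z by simp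
    next
      case False
      then have "mvr N N (P (fst z)) (snd z) i = 0" by (simp add: mvr_def)
      then show ?thesis using z by simp
    qed
    then show "z \<in> (?K \<inter> (\<lambda>z. vn N (snd z)) -` {1})
      \<inter> (\<Inter>i. ?K \<inter> (\<lambda>z. mvr N N (P (fst z)) (snd z) i - snd z i) -` {0})"
      using z by (cases z) auto
  next
    fix z assume z: "z \<in> (?K \<inter> (\<lambda>z. vn N (snd z)) -` {1})
      \<inter> (\<Inter>i. ?K \<inter> (\<lambda>z. mvr N N (P (fst z)) (snd z) i - snd z i) -` {0})"
    then have "mvr N N (P (fst z)) (snd z) i - snd z i = 0" for i by auto
    then have "mvr N N (P (fst z)) (snd z) = snd z" by (intro ext) simp
    then show "z \<in> sphere_bundle \<Lambda> (N, P)" using z by (auto simp: mem_sphere_bundle[OF E])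
  qed
  also have "compact \<dots>"
  proof (rule compact_Int_closed)
    show "compact (?K \<inter> (\<lambda>z. vn N (snd z)) -` {1})"
      using compact_Int_closed[OF cK continuous_closed_preimage[OF c2 compact_imp_closed[OF cK], of "{1}"]] by simp
    show "closed (\<Inter>i. ?K \<inter> (\<lambda>z. mvr N N (P (fst z)) (snd z) i - snd z i) -` {0})"
      by (intro closed_INT ballI continuous_closed_preimage c1 compact_imp_closed[OF cK]) simp
  qed
  finally show ?thesis .
qed

section \<open>Normalised projection between nearby bundles\<close>

definition proj_map :: "'a vbundle \<Rightarrow> 'a \<times> rvec \<Rightarrow> 'a \<times> rvec" where
  "proj_map E z = (fst z, nz (fst E) (mvr (fst E) (fst E) (snd E (fst z)) (snd z)))"

lemma is_vbundle_const: "is_vbundle \<Lambda> (N, P) \<Longrightarrow> l1 \<in> \<Lambda> \<Longrightarrow> is_vbundle \<Lambda> (N, \<lambda>_. P l1)"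
  by (auto simp: is_vbundle_def)

lemma proj_map_in_sphere_bundle:
  assumes E: "is_vbundle \<Lambda> (N, P)" and "fst z \<in> \<Lambda>" "vn N (mvr N N (P (fst z)) (snd z)) \<noteq> 0"
  shows "proj_map (N, P) z \<in> sphere_bundle \<Lambda> (N, P)"
  using assms vbundle_idem[OF E assms(2), of "snd z"] vn_nz[OF assms(3)]
  by (simp add: mem_sphere_bundle[OF E] proj_map_def) (simp add: nz_def mvr_scale)

lemma proj_map_fixed: 
  assumes E: "is_vbundle \<Lambda> (N, P)" and z: "z \<in> sphere_bundle \<Lambda> (N, P)"
  shows "proj_map (N, P) z = z"
  using z by (simp add: mem_sphere_bundle[OF E] proj_map_def nz_unit)

lemma continuous_on_proj_map:
  assumes E: "is_vbundle \<Lambda> (N, P)" and X: "fst ` X \<subseteq> \<Lambda>" "\<And>z. z \<in> X \<Longrightarrow> vn N (mvr N N (P (fst z)) (snd z)) \<noteq> 0"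
  shows "continuous_on X (proj_map (N, P))"
  unfolding proj_map_def fst_conv snd_conv
  by (intro continuous_on_Pair continuous_on_nz continuous_on_mvr vbundle_cont_compose[OF E] continuous_intros X)

text \<open>Idempotents this close move a unit vector by less than 1/4, so projecting and
  normalising is defined, and going there and back ends at distance less than 1 from the start. The
  second claim records that projecting back is the inverse, which \<open>fheq\<close> alone would
  hide.\<close>

lemma proj_map_fheq:
  assumes A: "is_vbundle V (N, P)" and B: "is_vbundle V (N, Q)"
    and close: "\<And>l. l \<in> V \<Longrightarrow> (\<Sum>i<N. \<Sum>j<N. \<bar>P l i j - Q l i j\<bar>) < 1/4"
  shows "fheq (sphere_bundle V (N, P)) (sphere_bundle V (N, Q)) (proj_map (N, Q))"
    and "fhom (sphere_bundle V (N, P)) (sphere_bundle V (N, P)) (proj_map (N, P) \<circ> proj_map (N, Q)) id"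
proof -
  have near: "vn N (\<lambda>i. mvr N N (Q (fst z)) (snd z) i - snd z i) < 1/4"
    if A: "is_vbundle V (N, P)" and close: "\<And>l. l \<in> V \<Longrightarrow> (\<Sum>i<N. \<Sum>j<N. \<bar>P l i j - Q l i j\<bar>) < 1/4"
      and z: "z \<in> sphere_bundle V (N, P)" for P Q z
  proof -
    have z: "fst z \<in> V" "mvr N N (P (fst z)) (snd z) = snd z" "vn N (snd z) = 1"
      using z by (simp_all add: mem_sphere_bundle[OF A])
    have "vn N (\<lambda>i. mvr N N (P (fst z)) (snd z) i - mvr N N (Q (fst z)) (snd z) i)
        \<le> (\<Sum>i<N. \<Sum>j<N. \<bar>P (fst z) i j - Q (fst z) i j\<bar>) * vn N (snd z)"
      using vn_mvr_le[of N N "\<lambda>i j. P (fst z) i j - Q (fst z) i j" "snd z"] by (simp add: mvr_diff_mat)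
    also have "\<dots> < 1/4" using close[OF z(1)] z(3) by simp
    finally show ?thesis using z(2) by (simp add: vn_minus)
  qed
  have half: "vn N (\<lambda>i. snd (proj_map (N, Q) z) i - snd z i) < 1/2" and nonz: "vn N (mvr N N (Q (fst z)) (snd z)) \<noteq> 0"
    if A: "is_vbundle V (N, P)" and close: "\<And>l. l \<in> V \<Longrightarrow> (\<Sum>i<N. \<Sum>j<N. \<bar>P l i j - Q l i j\<bar>) < 1/4"
      and z: "z \<in> sphere_bundle V (N, P)" for P Q z
    using nz_close[OF _ near[OF that]] z by (simp_all add: mem_sphere_bundle[OF A] proj_map_def)
  have fm: "fmap (sphere_bundle V (N, P)) (sphere_bundle V (N, Q)) (proj_map (N, Q))"
    if A: "is_vbundle V (N, P)" and B: "is_vbundle V (N, Q)"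
      and close: "\<And>l. l \<in> V \<Longrightarrow> (\<Sum>i<N. \<Sum>j<N. \<bar>P l i j - Q l i j\<bar>) < 1/4" for P Q
  proof (rule fmapI)
    show "continuous_on (sphere_bundle V (N, P)) (proj_map (N, Q))"
      by (rule continuous_on_proj_map[OF B]) (use nonz[OF A close] in \<open>auto simp: mem_sphere_bundle[OF A]\<close>)
    show "proj_map (N, Q) z \<in> sphere_bundle V (N, Q)" if "z \<in> sphere_bundle V (N, P)" for z
      by (rule proj_map_in_sphere_bundle[OF B]) (use that nonz[OF A close that] in \<open>auto simp: mem_sphere_bundle[OF A]\<close>)
  qed (simp add: proj_map_def)
  have hom: "fhom (sphere_bundle V (N, P)) (sphere_bundle V (N, P)) (proj_map (N, P) \<circ> proj_map (N, Q)) id"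
    if A: "is_vbundle V (N, P)" and B: "is_vbundle V (N, Q)"
      and close: "\<And>l. l \<in> V \<Longrightarrow> (\<Sum>i<N. \<Sum>j<N. \<bar>P l i j - Q l i j\<bar>) < 1/4"
      and close': "\<And>l. l \<in> V \<Longrightarrow> (\<Sum>i<N. \<Sum>j<N. \<bar>Q l i j - P l i j\<bar>) < 1/4" for P Q
  proof (rule fhom_straight_line[OF A fmap_comp[OF fm[OF A B close] fm[OF B A close']] fmap_id])
    fix z assume z: "z \<in> sphere_bundle V (N, P)"
    let ?y = "proj_map (N, Q) z"
    have y: "?y \<in> sphere_bundle V (N, Q)" using fmapD(2)[OF fm[OF A B close] z] .
    have "vn N (\<lambda>i. snd (proj_map (N, P) ?y) i - snd ?y i) < 1/2"
      by (rule half[where Q = P, OF B close' y])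
    moreover have "vn N (\<lambda>i. snd ?y i - snd z i) < 1/2"
      by (rule half[where Q = Q, OF A close z])
    ultimately show "vn N (\<lambda>i. snd ((proj_map (N, P) \<circ> proj_map (N, Q)) z) i - snd (id z) i) < 1"
      using vn_triangle[where N = N and x = "snd (proj_map (N, P) ?y)" and z = "snd z" and y = "snd ?y"] by simp
  qed
  have close': "(\<Sum>i<N. \<Sum>j<N. \<bar>Q l i j - P l i j\<bar>) < 1/4" if "l \<in> V" for l
    using close[OF that] by (simp add: abs_minus_commute)
  show "fheq (sphere_bundle V (N, P)) (sphere_bundle V (N, Q)) (proj_map (N, Q))"
    by (rule fheqI[OF fm[OF A B close] fm[OF B A close'] hom[OF A B close close'] hom[OF B A close' close]])
  show "fhom (sphere_bundle V (N, P)) (sphere_bundle V (N, P)) (proj_map (N, P) \<circ> proj_map (N, Q)) id"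
    by (rule hom[OF A B close close'])
qed

lemma over_sphere_bundle: "over A (sphere_bundle \<Lambda> E) = sphere_bundle (A \<inter> \<Lambda>) E"
  by (auto simp: over_def sphere_bundle_def)

lemma is_vbundle_subset: "is_vbundle \<Lambda> E \<Longrightarrow> V \<subseteq> \<Lambda> \<Longrightarrow> is_vbundle V E"
  unfolding is_vbundle_def by (cases E) (auto intro: continuous_on_subset)

lemma sphere_bundle_const: "sphere_bundle \<Lambda> (N, \<lambda>_. Q) = \<Lambda> \<times> {x \<in> range (mvr N N Q). (\<Sum>i<N. (x i)\<^sup>2) = 1}"
  by (auto simp: sphere_bundle_def fibre_def)

lemma fheq_cong: "fheq S T f \<Longrightarrow> (\<And>z. z \<in> S \<Longrightarrow> f z = f' z) \<Longrightarrow> fheq S T f'"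
  by (rule fheq_hom[OF _ fhom_eq[of S T f f']]) (simp_all add: fheq_def)

lemma fmap_const_family:
  fixes X :: "'b::topological_space set" and Y :: "'c::topological_space set"
  assumes f: "fmap ({l} \<times> X) ({l} \<times> Y) f"
  shows "fmap (A \<times> X) (A \<times> Y) (\<lambda>z. (fst z, snd (f (l, snd z))))"
proof (rule fmapI)
  show "continuous_on (A \<times> X) (\<lambda>z. (fst z, snd (f (l, snd z))))"
    by (intro continuous_intros continuous_on_compose2[OF fmapD(1)[OF f]]) auto
qed (use fmapD(2)[OF f] in fastforce)+

text \<open>The inverse and both homotopies are repeated over every base point. As \<open>A\<close>
  is arbitrary, this spreads an equivalence from one fibre to a neighbourhood, and also carries it
  from one base point to another.\<close>

lemma fheq_const_family:
  fixes X :: "'b::topological_space set" and Y :: "'c::topological_space set"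
  assumes "fheq ({l} \<times> X) ({l} \<times> Y) f"
  shows "fheq (A \<times> X) (A \<times> Y) (\<lambda>z. (fst z, snd (f (l, snd z))))"
proof -
  obtain g where g: "fmap ({l} \<times> X) ({l} \<times> Y) f" "fmap ({l} \<times> Y) ({l} \<times> X) g"
    "fhom ({l} \<times> X) ({l} \<times> X) (g \<circ> f) id" "fhom ({l} \<times> Y) ({l} \<times> Y) (f \<circ> g) id"
    using assms by (auto simp: fheq_def)
  have hom: "fhom (A \<times> X) (A \<times> X) ((\<lambda>z. (fst z, snd (g (l, snd z)))) \<circ> (\<lambda>z. (fst z, snd (f (l, snd z))))) id"
    if f: "fmap ({l} \<times> X) ({l} \<times> Y) f" and h: "fhom ({l} \<times> X) ({l} \<times> X) (g \<circ> f) id"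
    for X :: "'x::topological_space set" and Y :: "'y::topological_space set" and f g
  proof -
    obtain k where k: "continuous_on ({0..1} \<times> ({l} \<times> X)) k"
      "\<And>t x. t \<in> {0..1::real} \<Longrightarrow> x \<in> X \<Longrightarrow> k (t, (l, x)) \<in> {l} \<times> X"
      "\<And>x. x \<in> X \<Longrightarrow> k (0, (l, x)) = g (f (l, x))" "\<And>x. x \<in> X \<Longrightarrow> k (1, (l, x)) = (l, x)"
      using h by (elim fhomE) auto
    have fl: "(l, snd (f (l, x))) = f (l, x)" if "x \<in> X" for x
      using fmapD(3)[OF f, of "(l, x)"] that by (simp add: prod_eq_iff)
    show ?thesis
    proof (rule fhomI[of _ "\<lambda>q. (fst (snd q), snd (k (fst q, (l, snd (snd q)))))"])
      show "continuous_on ({0..1} \<times> A \<times> X) (\<lambda>q. (fst (snd q), snd (k (fst q, (l, snd (snd q))))))"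
        by (intro continuous_intros continuous_on_compose2[OF k(1)]) auto
      show "\<And>t z. t \<in> {0..1} \<Longrightarrow> z \<in> A \<times> X \<Longrightarrow> (fst (snd (t, z)), snd (k (fst (t, z), l, snd (snd (t, z))))) \<in> A \<times> X"
        using k(2) by fastforce
    qed (use k fl in auto)
  qed
  show ?thesis
    by (rule fheqI[OF fmap_const_family[OF g(1)] fmap_const_family[OF g(2)] hom[OF g(1,3)] hom[OF g(2,4)]])
qed

section \<open>Local constancy of fibrewise maps and propagation along the base\<close>

lemma vbundle_close:
  assumes E: "is_vbundle \<Lambda> (N, P)" and l1: "l1 \<in> (\<Lambda> :: 'a::metric_space set)"
  shows "\<exists>r>0. \<forall>l\<in>ball l1 r \<inter> \<Lambda>. (\<Sum>i<N. \<Sum>j<N. \<bar>P l i j - P l1 i j\<bar>) < 1/4"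
proof -
  have "continuous_on \<Lambda> (\<lambda>l. \<Sum>i<N. \<Sum>j<N. \<bar>P l i j - P l1 i j\<bar>)"
    by (intro continuous_intros vbundle_cont[OF E]) auto
  from this[unfolded continuous_on_iff, rule_format, OF l1, of "1/4"]
  obtain r where "r > 0" and h: "\<And>l. l \<in> \<Lambda> \<Longrightarrow> dist l l1 < r \<Longrightarrow>
      dist (\<Sum>i<N. \<Sum>j<N. \<bar>P l i j - P l1 i j\<bar>) (\<Sum>i<N. \<Sum>j<N. \<bar>P l1 i j - P l1 i j\<bar>) < 1/4"
    by auto
  have "(\<Sum>i<N. \<Sum>j<N. \<bar>P l i j - P l1 i j\<bar>) < 1/4" if "l \<in> ball l1 r \<inter> \<Lambda>" for l
    using h[of l] that abs_ge_self[of "\<Sum>i<N. \<Sum>j<N. \<bar>P l i j - P l1 i j\<bar>"]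
    by (simp add: dist_commute)
  with \<open>r > 0\<close> show ?thesis by blast
qed

text \<open>After projection to the fibres at \<open>l1\<close>, the map \<open>f\<close> and its
  restriction to that fibre, extended constantly, agree over \<open>l1\<close> itself. The points
  where they are at distance at least 1 form a compact set, whose image in the base is closed and
  misses \<open>l1\<close>; over a ball avoiding this image a straight-line homotopy exists.\<close>

lemma fibrewise_map_locally_constant:
  fixes \<Lambda> :: "'a::metric_space set"
  assumes "compact \<Lambda>" and E: "is_vbundle \<Lambda> (N, P)" and F: "is_vbundle \<Lambda> (M, Q)"
    and f: "fmap (sphere_bundle \<Lambda> (N, P)) (sphere_bundle \<Lambda> (M, Q)) f" and l1: "l1 \<in> \<Lambda>"
  defines "c \<equiv> (\<lambda>z. (fst z, snd (f (l1, snd z))))"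
  shows "\<exists>r>0. (\<forall>l\<in>ball l1 r \<inter> \<Lambda>. (\<Sum>i<N. \<Sum>j<N. \<bar>P l i j - P l1 i j\<bar>) < 1/4) \<and>
      (\<forall>l\<in>ball l1 r \<inter> \<Lambda>. (\<Sum>i<M. \<Sum>j<M. \<bar>Q l i j - Q l1 i j\<bar>) < 1/4) \<and>
      fhom (sphere_bundle (ball l1 r \<inter> \<Lambda>) (N, P)) (sphere_bundle (ball l1 r \<inter> \<Lambda>) (M, Q)) f
        (proj_map (M, Q) \<circ> c \<circ> proj_map (N, \<lambda>_. P l1))"
proof -
  obtain r1 where r1: "r1 > 0" "\<And>l. l \<in> ball l1 r1 \<inter> \<Lambda> \<Longrightarrow> (\<Sum>i<N. \<Sum>j<N. \<bar>P l i j - P l1 i j\<bar>) < 1/4"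
    using vbundle_close[OF E l1] by blast
  obtain r2 where r2: "r2 > 0" "\<And>l. l \<in> ball l1 r2 \<inter> \<Lambda> \<Longrightarrow> (\<Sum>i<M. \<Sum>j<M. \<bar>Q l i j - Q l1 i j\<bar>) < 1/4"
    using vbundle_close[OF F l1] by blast
  define r0 where "r0 = min r1 r2 / 2"
  have r0: "r0 > 0" "r0 < r1" "r0 < r2" using r1 r2 by (auto simp: r0_def)
  \<comment> \<open>A closed ball keeps the total space over \<open>W\<close> compact; halving the
    radius puts it inside both open balls.\<close>
  define W where "W = cball l1 r0 \<inter> \<Lambda>"
  let ?g = "proj_map (M, Q) \<circ> c \<circ> proj_map (N, \<lambda>_. P l1)"
  have W: "W \<subseteq> \<Lambda>" "compact W"
    using compact_Int_closed[OF \<open>compact \<Lambda>\<close>, of "cball l1 r0"] by (auto simp: W_def Int_commute)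
  have closeE: "(\<Sum>i<N. \<Sum>j<N. \<bar>P l i j - P l1 i j\<bar>) < 1/4" if "l \<in> W" for l
    using r1(2)[of l] that r0 by (auto simp: W_def)
  have closeF: "(\<Sum>i<M. \<Sum>j<M. \<bar>Q l1 i j - Q l i j\<bar>) < 1/4" if "l \<in> W" for l
    using r2(2)[of l] that r0 by (auto simp: W_def abs_minus_commute)
  note EW = is_vbundle_subset[OF E W(1)] and FW = is_vbundle_subset[OF F W(1)]
  have cE: "is_vbundle X (N, \<lambda>_. P l1)" for X :: "'a set"
    using is_vbundle_const[OF E l1] l1 by (auto simp: is_vbundle_def)
  have cF: "is_vbundle X (M, \<lambda>_. Q l1)" for X :: "'a set"
    using is_vbundle_const[OF F l1] l1 by (auto simp: is_vbundle_def)
  have fl1: "fmap (sphere_bundle {l1} (N, \<lambda>_. P l1)) (sphere_bundle {l1} (M, \<lambda>_. Q l1)) f"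
  proof -
    have "sphere_bundle {l1} (N, P) = sphere_bundle {l1} (N, \<lambda>_. P l1)"
      "sphere_bundle {l1} (M, Q) = sphere_bundle {l1} (M, \<lambda>_. Q l1)"
      by (auto simp: sphere_bundle_def fibre_def)
    then show ?thesis
      using fmap_over[OF f, of "{l1}"] l1 by (simp add: over_sphere_bundle)
  qed
  have cm: "fmap (sphere_bundle W (N, \<lambda>_. P l1)) (sphere_bundle W (M, \<lambda>_. Q l1)) c"
    using fmap_const_family[OF fl1[unfolded sphere_bundle_const]]
    unfolding c_def sphere_bundle_const .
  have gm: "fmap (sphere_bundle W (N, P)) (sphere_bundle W (M, Q)) ?g"
    using proj_map_fheq(1)[OF EW cE closeE] proj_map_fheq(1)[OF cF FW closeF] cm
    unfolding fheq_def o_assoc by (meson fmap_comp)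
  have fm: "fmap (sphere_bundle W (N, P)) (sphere_bundle W (M, Q)) f"
    using fmap_over[OF f, of W] W(1) by (simp add: over_sphere_bundle Int_absorb2)
  define D where "D z = vn M (\<lambda>i. snd (f z) i - snd (?g z) i)" for z
  have contD: "continuous_on (sphere_bundle W (N, P)) D"
    unfolding D_def
    by (intro continuous_intros continuous_on_coordinatewise_then_product
        continuous_on_product_then_coordinatewise[OF continuous_on_snd[OF fmapD(1)[OF fm]]]
        continuous_on_product_then_coordinatewise[OF continuous_on_snd[OF fmapD(1)[OF gm]]])
  define B where "B = sphere_bundle W (N, P) \<inter> D -` {1..}"
  have cpt: "compact (sphere_bundle W (N, P))" by (rule compact_sphere_bundle[OF EW W(2)])
  have "compact B"
    unfolding B_def
    using compact_Int_closed[OF cpt continuous_closed_preimage[OF contD compact_imp_closed[OF cpt], of "{1..}"]]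
    by simp
  then have "closed (fst ` B)"
    by (intro compact_imp_closed compact_continuous_image continuous_on_fst continuous_on_id)
  moreover have "l1 \<notin> fst ` B"
  proof
    assume "l1 \<in> fst ` B"
    then obtain x where x: "(l1, x) \<in> sphere_bundle W (N, P)" "1 \<le> D (l1, x)"
      by (auto simp: B_def)
    have "proj_map (N, \<lambda>_. P l1) (l1, x) = (l1, x)"
      using x(1) by (intro proj_map_fixed[OF cE, of _ W]) (auto simp: sphere_bundle_def fibre_def)
    moreover have "c (l1, x) = f (l1, x)"
      using fmapD(3)[OF fm x(1)] by (simp add: c_def prod_eq_iff)
    moreover have "proj_map (M, Q) (f (l1, x)) = f (l1, x)"
      by (rule proj_map_fixed[OF FW fmapD(2)[OF fm x(1)]])
    ultimately show False using x(2) by (simp add: D_def L2_set_def)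
  qed
  ultimately obtain r' where r': "r' > 0" "ball l1 r' \<inter> fst ` B = {}"
    by (meson disjoint_iff open_Compl ComplI ComplD open_contains_ball subsetD)
  define r where "r = min r0 r'"
  let ?V = "ball l1 r \<inter> \<Lambda>"
  have V: "?V \<subseteq> W" by (auto simp: r_def W_def)
  have VW: "V \<inter> W = V" if "V \<subseteq> W" for V using that by auto
  have "fhom (sphere_bundle ?V (N, P)) (sphere_bundle ?V (M, Q)) f ?g"
  proof (rule fhom_straight_line[OF is_vbundle_subset[OF FW V]])
    show "fmap (sphere_bundle ?V (N, P)) (sphere_bundle ?V (M, Q)) f"
      using fmap_over[OF fm, of ?V] unfolding over_sphere_bundle VW[OF V] .
    show "fmap (sphere_bundle ?V (N, P)) (sphere_bundle ?V (M, Q)) ?g"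
      using fmap_over[OF gm, of ?V] unfolding over_sphere_bundle VW[OF V] .
    fix z assume z: "z \<in> sphere_bundle ?V (N, P)"
    then have "z \<in> sphere_bundle W (N, P)" "fst z \<in> ball l1 r'"
      using V by (auto simp: sphere_bundle_def r_def)
    with r'(2) have "\<not> 1 \<le> D z" by (auto simp: B_def)
    then show "vn M (\<lambda>i. snd (f z) i - snd (?g z) i) < 1" by (simp add: D_def)
  qed
  moreover have "r > 0" using r0 r' by (simp add: r_def)
  ultimately show ?thesis
    using r1(2) r2(2) r0 by (intro exI[of _ r]) (auto simp: r_def)
qed

text \<open>Near \<open>l1\<close> the map is a constant family composed with projections that are
  equivalences. The first half gives openness of the set of fibres on which \<open>f\<close> is an
  equivalence and, being stated over a whole ball, the local input of Dold's theorem; the second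
  half gives closedness.\<close>

lemma fheq_fibre_local:
  fixes \<Lambda> :: "'a::metric_space set"
  assumes "compact \<Lambda>" and E: "is_vbundle \<Lambda> (N, P)" and F: "is_vbundle \<Lambda> (M, Q)"
    and f: "fmap (sphere_bundle \<Lambda> (N, P)) (sphere_bundle \<Lambda> (M, Q)) f" and l1: "l1 \<in> \<Lambda>"
  shows "\<exists>r>0. (fheq (sphere_bundle {l1} (N, P)) (sphere_bundle {l1} (M, Q)) f \<longrightarrow>
        fheq (sphere_bundle (ball l1 r \<inter> \<Lambda>) (N, P)) (sphere_bundle (ball l1 r \<inter> \<Lambda>) (M, Q)) f) \<and>
      (\<forall>l\<in>ball l1 r \<inter> \<Lambda>. fheq (sphere_bundle {l} (N, P)) (sphere_bundle {l} (M, Q)) f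
         \<longrightarrow> fheq (sphere_bundle {l1} (N, P)) (sphere_bundle {l1} (M, Q)) f)"
proof -
  define c where "c = (\<lambda>z. (fst z :: 'a, snd (f (l1, snd z))))"
  obtain r where r: "r > 0" "\<And>l. l \<in> ball l1 r \<inter> \<Lambda> \<Longrightarrow> (\<Sum>i<N. \<Sum>j<N. \<bar>P l i j - P l1 i j\<bar>) < 1/4"
     "\<And>l. l \<in> ball l1 r \<inter> \<Lambda> \<Longrightarrow> (\<Sum>i<M. \<Sum>j<M. \<bar>Q l i j - Q l1 i j\<bar>) < 1/4"
     "fhom (sphere_bundle (ball l1 r \<inter> \<Lambda>) (N, P)) (sphere_bundle (ball l1 r \<inter> \<Lambda>) (M, Q)) f
        (proj_map (M, Q) \<circ> c \<circ> proj_map (N, \<lambda>_. P l1))"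
    using fibrewise_map_locally_constant[OF assms(1) E F f l1] unfolding c_def by blast
  have cE: "is_vbundle X (N, \<lambda>_. P l1)" for X :: "'a set"
    using is_vbundle_const[OF E l1] l1 by (auto simp: is_vbundle_def)
  have cF: "is_vbundle X (M, \<lambda>_. Q l1)" for X :: "'a set"
    using is_vbundle_const[OF F l1] l1 by (auto simp: is_vbundle_def)
  have sub: "V \<subseteq> \<Lambda>" if "V \<subseteq> ball l1 r \<inter> \<Lambda>" for V using that by auto
  have EV: "is_vbundle V (N, P)" if "V \<subseteq> ball l1 r \<inter> \<Lambda>" for V
    by (rule is_vbundle_subset[OF E sub[OF that]])
  have FV: "is_vbundle V (M, Q)" if "V \<subseteq> ball l1 r \<inter> \<Lambda>" for V
    by (rule is_vbundle_subset[OF F sub[OF that]])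
  have cl: "(\<Sum>i<N. \<Sum>j<N. \<bar>P l i j - P l1 i j\<bar>) < 1/4" "(\<Sum>i<N. \<Sum>j<N. \<bar>P l1 i j - P l i j\<bar>) < 1/4"
    "(\<Sum>i<M. \<Sum>j<M. \<bar>Q l i j - Q l1 i j\<bar>) < 1/4" "(\<Sum>i<M. \<Sum>j<M. \<bar>Q l1 i j - Q l i j\<bar>) < 1/4"
    if "V \<subseteq> ball l1 r \<inter> \<Lambda>" "l \<in> V" for V l
    using r(2)[of l] r(3)[of l] subsetD[OF that] by (simp_all only: abs_minus_commute)
  have homV: "fhom (sphere_bundle V (N, P)) (sphere_bundle V (M, Q)) f
        (proj_map (M, Q) \<circ> c \<circ> proj_map (N, \<lambda>_. P l1))" if "V \<subseteq> ball l1 r \<inter> \<Lambda>" for V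
    using fhom_over[OF r(4), of V] that by (simp add: over_sphere_bundle Int_absorb2)
  define X where "X = {x \<in> range (mvr N N (P l1)). (\<Sum>i<N. (x i)\<^sup>2) = 1}"
  define Y where "Y = {x \<in> range (mvr M M (Q l1)). (\<Sum>i<M. (x i)\<^sup>2) = 1}"
  have sE: "sphere_bundle V (N, \<lambda>_. P l1) = V \<times> X" for V by (simp add: sphere_bundle_const X_def)
  have sF: "sphere_bundle V (M, \<lambda>_. Q l1) = V \<times> Y" for V by (simp add: sphere_bundle_const Y_def)
  have sE1: "sphere_bundle {l1} (N, P) = {l1} \<times> X" and sF1: "sphere_bundle {l1} (M, Q) = {l1} \<times> Y"
    by (auto simp: sphere_bundle_def fibre_def X_def Y_def)
  have f1: "fmap ({l1} \<times> X) ({l1} \<times> Y) f"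
    using fmap_over[OF f, of "{l1}"] l1 by (simp add: over_sphere_bundle sE1 sF1)
  have c: "fmap (V \<times> X) (V \<times> Y) c" for V
    unfolding c_def by (rule fmap_const_family[OF f1])
  have 1: "fheq (sphere_bundle V (N, P)) (sphere_bundle V (M, Q)) f"
    if h: "fheq (sphere_bundle {l1} (N, P)) (sphere_bundle {l1} (M, Q)) f" and V: "V \<subseteq> ball l1 r \<inter> \<Lambda>" for V
  proof -
    have "fheq (V \<times> X) (V \<times> Y) c"
      unfolding c_def by (rule fheq_const_family[OF h[unfolded sE1 sF1]])
    then have "fheq (sphere_bundle V (N, P)) (sphere_bundle V (M, Q)) (proj_map (M, Q) \<circ> c \<circ> proj_map (N, \<lambda>_. P l1))"
      using fheq_comp[OF proj_map_fheq(1)[OF EV[OF V] cE cl(1)[OF V]] fheq_comp[OF _ proj_map_fheq(1)[OF cF FV[OF V] cl(4)[OF V]]]]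
      unfolding sE sF o_assoc by blast
    then show ?thesis by (rule fheq_hom[OF _ fhom_sym[OF homV[OF V]]])
  qed
  \<comment> \<open>Composing with projections on both sides cancels those around \<open>c\<close>,
    so \<open>c\<close> is an equivalence over \<open>l\<close>; moved to the base point
    \<open>l1\<close>, the constant family is \<open>f\<close> itself.\<close>
  have 2: "fheq (sphere_bundle {l1} (N, P)) (sphere_bundle {l1} (M, Q)) f"
    if l: "l \<in> ball l1 r \<inter> \<Lambda>" and h: "fheq (sphere_bundle {l} (N, P)) (sphere_bundle {l} (M, Q)) f" for l
  proof -
    let ?V = "{l}"
    have V: "?V \<subseteq> ball l1 r \<inter> \<Lambda>" using l by auto
    define pE where "pE = proj_map (N, P)"
    define pF where "pF = proj_map (M, \<lambda>_::'a. Q l1)"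
    define qE where "qE = proj_map (N, \<lambda>_::'a. P l1)"
    define qF where "qF = proj_map (M, Q)"
    have pE: "fheq (?V \<times> X) (sphere_bundle ?V (N, P)) pE"
      using proj_map_fheq(1)[OF cE EV[OF V] cl(2)[OF V]] unfolding sE pE_def .
    have pF: "fheq (sphere_bundle ?V (M, Q)) (?V \<times> Y) pF"
      using proj_map_fheq(1)[OF FV[OF V] cF cl(3)[OF V]] unfolding sF pF_def .
    have qF: "fheq (?V \<times> Y) (sphere_bundle ?V (M, Q)) qF"
      using proj_map_fheq(1)[OF cF FV[OF V] cl(4)[OF V]] unfolding sF qF_def .
    have qE: "fheq (sphere_bundle ?V (N, P)) (?V \<times> X) qE"
      using proj_map_fheq(1)[OF EV[OF V] cE cl(1)[OF V]] unfolding sE qE_def .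
    have hE: "fhom (?V \<times> X) (?V \<times> X) (qE \<circ> pE) id"
      using proj_map_fheq(2)[OF cE EV[OF V] cl(2)[OF V]] unfolding sE pE_def qE_def .
    have hF: "fhom (?V \<times> Y) (?V \<times> Y) (pF \<circ> qF) id"
      using proj_map_fheq(2)[OF cF FV[OF V] cl(4)[OF V]] unfolding sF pF_def qF_def .
    have "fheq (sphere_bundle ?V (N, P)) (sphere_bundle ?V (M, Q)) (qF \<circ> c \<circ> qE)"
      using fheq_hom[OF h homV[OF V]] by (simp add: qF_def qE_def)
    then have *: "fheq (?V \<times> X) (?V \<times> Y) (pF \<circ> (qF \<circ> c \<circ> qE) \<circ> pE)"
      by (rule fheq_comp[OF pE fheq_comp[OF _ pF]])
    have pEm: "fmap (?V \<times> X) (sphere_bundle ?V (N, P)) pE" and qEm: "fmap (sphere_bundle ?V (N, P)) (?V \<times> X) qE"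
      using pE qE by (auto simp: fheq_def)
    have "fhom (?V \<times> X) (?V \<times> Y) ((pF \<circ> qF) \<circ> (c \<circ> qE \<circ> pE)) (id \<circ> (c \<circ> qE \<circ> pE))"
      by (rule fhom_comp_right[OF hF]) (intro fmap_comp[OF pEm fmap_comp[OF qEm c]])
    moreover have "fhom (?V \<times> X) (?V \<times> Y) (c \<circ> (qE \<circ> pE)) (c \<circ> id)"
      by (rule fhom_comp_left[OF hE c])
    ultimately have "fhom (?V \<times> X) (?V \<times> Y) (pF \<circ> (qF \<circ> c \<circ> qE) \<circ> pE) c"
      by (simp add: o_assoc) (rule fhom_trans)
    then have "fheq (?V \<times> X) (?V \<times> Y) c"
      by (rule fheq_hom[OF *])
    then have "fheq ({l1} \<times> X) ({l1} \<times> Y) (\<lambda>z. (fst z, snd (c (l, snd z))))"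
      by (rule fheq_const_family)
    then show ?thesis
      unfolding sE1 sF1
    proof (rule fheq_cong)
      fix z assume "z \<in> {l1} \<times> X"
      then show "(fst z, snd (c (l, snd z))) = f z"
        using fmapD(3)[OF f1, of z] by (auto simp: c_def prod_eq_iff)
    qed
  qed
  show ?thesis
  proof (intro exI[of _ r] conjI impI ballI r(1))
    show "fheq (sphere_bundle (ball l1 r \<inter> \<Lambda>) (N, P)) (sphere_bundle (ball l1 r \<inter> \<Lambda>) (M, Q)) f"
      if "fheq (sphere_bundle {l1} (N, P)) (sphere_bundle {l1} (M, Q)) f"
      by (rule 1[OF that order_refl])
  qed (rule 2)
qed

theorem fibre_homotopy_equiv_of_fibre:
  fixes \<Lambda> :: "'a::metric_space set"
  assumes cpt: "compact \<Lambda>" and conn: "connected \<Lambda>"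
    and E: "is_vbundle \<Lambda> E" and F: "is_vbundle \<Lambda> F"
    and f: "fmap (sphere_bundle \<Lambda> E) (sphere_bundle \<Lambda> F) f"
    and l0: "l0 \<in> \<Lambda>" "fheq (sphere_bundle {l0} E) (sphere_bundle {l0} F) f"
  shows "fibre_homotopy_equiv \<Lambda> E F"
proof -
  obtain N P where NP: "E = (N, P)" by (cases E)
  obtain M Q where MQ: "F = (M, Q)" by (cases F)
  note local = fheq_fibre_local[OF cpt E[unfolded NP] F[unfolded MQ] f[unfolded NP MQ], folded NP MQ]
  have all: "fheq (sphere_bundle {l} E) (sphere_bundle {l} F) f" if l: "l \<in> \<Lambda>" for l
  proof (rule connected_induction_simple[OF conn, where P = "\<lambda>l. fheq (sphere_bundle {l} E) (sphere_bundle {l} F) f"])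
    fix l1 assume l1: "l1 \<in> \<Lambda>"
    obtain r where r: "r > 0" "fheq (sphere_bundle {l1} E) (sphere_bundle {l1} F) f \<Longrightarrow>
        fheq (sphere_bundle (ball l1 r \<inter> \<Lambda>) E) (sphere_bundle (ball l1 r \<inter> \<Lambda>) F) f"
      "\<And>l. l \<in> ball l1 r \<inter> \<Lambda> \<Longrightarrow> fheq (sphere_bundle {l} E) (sphere_bundle {l} F) f
         \<Longrightarrow> fheq (sphere_bundle {l1} E) (sphere_bundle {l1} F) f"
      using local[OF l1] by blast
    have *: "fheq (sphere_bundle {y} E) (sphere_bundle {y} F) f"
      if "x \<in> ball l1 r \<inter> \<Lambda>" "y \<in> ball l1 r \<inter> \<Lambda>" "fheq (sphere_bundle {x} E) (sphere_bundle {x} F) f" for x y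
      using fheq_over[OF r(2)[OF r(3)[OF that(1,3)]], of "{y}"] that(2)
      by (simp add: over_sphere_bundle)
    show "\<exists>T. openin (top_of_set \<Lambda>) T \<and> l1 \<in> T \<and>
      (\<forall>x\<in>T. \<forall>y\<in>T. fheq (sphere_bundle {x} E) (sphere_bundle {x} F) f \<longrightarrow> fheq (sphere_bundle {y} E) (sphere_bundle {y} F) f)"
    proof (intro exI[of _ "ball l1 r \<inter> \<Lambda>"] conjI ballI impI)
      show "openin (top_of_set \<Lambda>) (ball l1 r \<inter> \<Lambda>)"
        by (simp add: Int_commute openin_open_Int)
    qed (use r(1) l1 in simp, rule *)
  qed (use l0 l in auto)
  have "fheq (sphere_bundle \<Lambda> E) (sphere_bundle \<Lambda> F) f"
  proof (rule fibre_homotopy_equivalence_local[OF cpt _ _ f])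
    fix l assume l: "l \<in> \<Lambda>"
    then show "\<exists>r>0. fheq (over (ball l r) (sphere_bundle \<Lambda> E)) (over (ball l r) (sphere_bundle \<Lambda> F)) f"
      using local[OF l] all[OF l] unfolding over_sphere_bundle by blast
  qed (auto simp: sphere_bundle_def)
  then obtain g where "fmap (sphere_bundle \<Lambda> E) (sphere_bundle \<Lambda> F) f"
    "fmap (sphere_bundle \<Lambda> F) (sphere_bundle \<Lambda> E) g"
    "fhom (sphere_bundle \<Lambda> E) (sphere_bundle \<Lambda> E) (g \<circ> f) id"
    "fhom (sphere_bundle \<Lambda> F) (sphere_bundle \<Lambda> F) (f \<circ> g) id"
    unfolding fheq_def by blast
  then show ?thesis
    unfolding fibre_homotopy_equiv_def Let_def fmap_def fhom_def by blast
qed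

text \<open>The hypothesis gives a bijection of fibres, and its inverse has to be realised by a
  matrix as well: column \<open>j\<close> of \<open>B\<close> is the preimage of the projected
  \<open>j\<close>-th unit vector. On spheres the two normalised maps are strictly inverse, because
  the second normalisation absorbs the scaling of the first.\<close>

lemma fheq_linear:
  assumes E: "is_vbundle {l} (N, P)" and F: "is_vbundle {l} (M, Q)"
    and A: "bij_betw (mvr M N A) (fibre (N, P) l) (fibre (M, Q) l)"
  shows "fheq (sphere_bundle {l} (N, P)) (sphere_bundle {l} (M, Q)) (\<lambda>z. (fst z, nz M (mvr M N A (snd z))))"
proof -
  define w where "w j = inv_into (fibre (N, P) l) (mvr M N A) (mvr M M (Q l) (\<lambda>i. if i = j then 1 else 0))" for j
  define B where "B i j = w j i" for i j
  have w: "w j \<in> fibre (N, P) l" "mvr M N A (w j) = mvr M M (Q l) (\<lambda>i. if i = j then 1 else 0)" for j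
  proof -
    have "mvr M M (Q l) (\<lambda>i. if i = j then 1 else 0) \<in> mvr M N A ` fibre (N, P) l"
      using A by (auto simp: bij_betw_def fibre_def)
    then show "w j \<in> fibre (N, P) l" "mvr M N A (w j) = mvr M M (Q l) (\<lambda>i. if i = j then 1 else 0)"
      unfolding w_def by (rule inv_into_into, rule f_inv_into_f)
  qed
  have fE: "x \<in> fibre (N, P) l \<longleftrightarrow> mvr N N (P l) x = x" for x by (rule fibre_iff[OF E]) simp
  have fF: "y \<in> fibre (M, Q) l \<longleftrightarrow> mvr M M (Q l) y = y" for y by (rule fibre_iff[OF F]) simp
  have Bfib: "mvr N M B y \<in> fibre (N, P) l" for y
  proof -
    have "mvr N N (P l) (mvr N M B y) = mvr N M B y"
    proof (rule ext)
      fix i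
      have "(\<Sum>k<N. P l i k * B k j) = B i j" if "i < N" for j
        using w(1)[of j, unfolded fE, THEN fun_cong, of i] that by (simp add: mvr_def B_def)
      then show "mvr N N (P l) (mvr N M B y) i = mvr N M B y i"
        unfolding mvr_mvr by (simp add: mvr_def)
    qed
    then show ?thesis by (simp add: fE)
  qed
  have AB: "mvr M N A (mvr N M B y) = y" if "y \<in> fibre (M, Q) l" for y
  proof (rule ext)
    fix i
    have "(\<Sum>k<N. A i k * B k j) = Q l i j" if "i < M" "j < M" for j
      using w(2)[of j, THEN fun_cong, of i] that by (simp add: mvr_def B_def if_distrib cong: if_cong)
    then have "mvr M N A (mvr N M B y) i = mvr M M (Q l) y i"
      unfolding mvr_mvr by (simp add: mvr_def)
    then show "mvr M N A (mvr N M B y) i = y i" using that by (simp add: fF)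
  qed
  have Afib: "mvr M N A x \<in> fibre (M, Q) l" if "x \<in> fibre (N, P) l" for x
    using A that by (auto simp: bij_betw_def)
  have BA: "mvr N M B (mvr M N A x) = x" if "x \<in> fibre (N, P) l" for x
    by (rule inj_onD[OF bij_betw_imp_inj_on[OF A] AB[OF Afib[OF that]] Bfib that])
  have main: "fmap (sphere_bundle {l} (N, P)) (sphere_bundle {l} (M, Q)) (\<lambda>z. (fst z, nz M (mvr M N A (snd z))))
     \<and> (\<forall>z\<in>sphere_bundle {l} (N, P). nz N (mvr N M B (nz M (mvr M N A (snd z)))) = snd z)"
    if E: "is_vbundle {l} (N, P)" and F: "is_vbundle {l} (M, Q)"
      and A: "\<And>x. x \<in> fibre (N, P) l \<Longrightarrow> mvr M N A x \<in> fibre (M, Q) l"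
      and BA: "\<And>x. x \<in> fibre (N, P) l \<Longrightarrow> mvr N M B (mvr M N A x) = x" for N M P Q A B
  proof -
    have fF: "y \<in> fibre (M, Q) l \<longleftrightarrow> mvr M M (Q l) y = y" for y by (rule fibre_iff[OF F]) simp
    have nonz: "vn M (mvr M N A x) > 0" if "x \<in> fibre (N, P) l" "vn N x = 1" for x
    proof -
      have "vn M (mvr M N A x) \<noteq> 0"
        using vn_mvr_le[of N M B "mvr M N A x"] BA[OF that(1)] that(2) by auto
      then show ?thesis using L2_set_nonneg[of "mvr M N A x" "{..<M}"] by linarith
    qed
    have 1: "fmap (sphere_bundle {l} (N, P)) (sphere_bundle {l} (M, Q)) (\<lambda>z. (fst z, nz M (mvr M N A (snd z))))"
    proof (rule fmapI)
      show "continuous_on (sphere_bundle {l} (N, P)) (\<lambda>z. (fst z, nz M (mvr M N A (snd z))))"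
        by (intro continuous_intros continuous_on_nz continuous_on_mvr)
          (use nonz in \<open>force simp: sphere_bundle_def vn_eq_1_iff\<close>)
      show "(fst z, nz M (mvr M N A (snd z))) \<in> sphere_bundle {l} (M, Q)" if "z \<in> sphere_bundle {l} (N, P)" for z
      proof -
        have z: "fst z = l" "snd z \<in> fibre (N, P) l" "vn N (snd z) = 1"
          using that by (auto simp: sphere_bundle_def vn_eq_1_iff)
        have "mvr M M (Q l) (nz M (mvr M N A (snd z))) = nz M (mvr M N A (snd z))"
          using A[OF z(2)] by (simp add: fF nz_def mvr_scale)
        then show ?thesis
          using vn_nz[of "mvr M N A (snd z)" M] nonz[OF z(2,3)] z(1) by (simp add: mem_sphere_bundle[OF F])
      qed
    qed simp
    have "nz N (mvr N M B (nz M (mvr M N A (snd z)))) = snd z" if "z \<in> sphere_bundle {l} (N, P)" for z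
    proof -
      have z: "snd z \<in> fibre (N, P) l" "vn N (snd z) = 1"
        using that by (auto simp: sphere_bundle_def vn_eq_1_iff)
      have "mvr N M B (nz M (mvr M N A (snd z))) = (\<lambda>i. snd z i / vn M (mvr M N A (snd z)))"
        using BA[OF z(1)] by (simp add: nz_def mvr_scale)
      then show ?thesis using nz_divide[OF nonz[OF z]] nz_unit[OF z(2)] by simp
    qed
    with 1 show ?thesis by blast
  qed
  note m1 = main[OF E F Afib BA] and m2 = main[OF F E Bfib AB]
  show ?thesis
  proof (rule fheqI)
    show f: "fmap (sphere_bundle {l} (N, P)) (sphere_bundle {l} (M, Q)) (\<lambda>z. (fst z, nz M (mvr M N A (snd z))))"
      using m1 by simp
    show g: "fmap (sphere_bundle {l} (M, Q)) (sphere_bundle {l} (N, P)) (\<lambda>z. (fst z, nz N (mvr N M B (snd z))))"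
      using m2 by simp
    show "fhom (sphere_bundle {l} (N, P)) (sphere_bundle {l} (N, P))
        ((\<lambda>z. (fst z, nz N (mvr N M B (snd z)))) \<circ> (\<lambda>z. (fst z, nz M (mvr M N A (snd z))))) id"
      by (rule fhom_sym[OF fhom_eq[OF fmap_id]]) (use m1 in \<open>simp add: prod_eq_iff\<close>)
    show "fhom (sphere_bundle {l} (M, Q)) (sphere_bundle {l} (M, Q))
        ((\<lambda>z. (fst z, nz M (mvr M N A (snd z)))) \<circ> (\<lambda>z. (fst z, nz N (mvr N M B (snd z))))) id"
      by (rule fhom_sym[OF fhom_eq[OF fmap_id]]) (use m2 in \<open>simp add: prod_eq_iff\<close>)
  qed
qed

subsection \<open>Exponential dichotomies\<close>

lemma norm_matrix_vector_mult_le: "norm (A *v x) \<le> norm A * norm x"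
  for A :: "real^'n^'m"
proof -
  have "norm (A *v x) = L2_set (\<lambda>i. norm ((A *v x) $ i)) UNIV"
    by (simp add: norm_vec_def)
  also have "\<dots> \<le> L2_set (\<lambda>i. norm (A $ i) * norm x) UNIV"
    by (rule L2_set_mono) (simp_all add: matrix_vector_mul_component Cauchy_Schwarz_ineq2)
  also have "\<dots> = norm A * norm x"
    by (simp add: norm_vec_def L2_set_left_distrib)
  finally show ?thesis .
qed

lemma matrix_vector_mult_sum: "A *v (\<Sum>i\<in>S. f i) = (\<Sum>i\<in>S. A *v f i)"
  for A :: "real^'n^'m"
  by (simp add: linear_sum[OF matrix_vector_mul_linear])

section \<open>Evolution operators and two-sided dichotomy estimates\<close>

definition int_interval :: "int set \<Rightarrow> bool" where
  "int_interval I \<longleftrightarrow> (\<forall>a\<in>I. \<forall>b\<in>I. {a..b} \<subseteq> I)"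

lemma int_interval_simps [simp]: "int_interval {k..}" "int_interval {..k}" "int_interval UNIV"
  by (auto simp: int_interval_def)

lemma Phi_refl [simp]: "Phi B n n = mat 1"
  by (simp add: Phi_def)

lemma Phi_Suc: "n \<le> k \<Longrightarrow> Phi B (k + 1) n = B k ** Phi B k n"
proof -
  assume "n \<le> k"
  then have "nat (k + 1 - n) = Suc (nat (k - n))" by simp
  then show ?thesis using \<open>n \<le> k\<close> by (simp add: Phi_def)
qed

lemma Phi_Suc_vec: "n \<le> k \<Longrightarrow> Phi B (k + 1) n *v x = B k *v (Phi B k n *v x)"
  by (simp add: Phi_Suc matrix_vector_mul_assoc)

lemma norm_Phi_le:
  assumes "\<And>k v. n \<le> k \<Longrightarrow> k < n + int m \<Longrightarrow> norm (B k *v v) \<le> c * norm v" "0 \<le> c"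
  shows "norm (Phi B (n + int m) n *v v) \<le> c ^ m * norm v"
  using assms(1)
proof (induction m)
  case (Suc m)
  have "norm (Phi B (n + int (Suc m)) n *v v) = norm (B (n + int m) *v (Phi B (n + int m) n *v v))"
    using Phi_Suc_vec[of n "n + int m" B v] by (simp add: algebra_simps)
  also have "\<dots> \<le> c * norm (Phi B (n + int m) n *v v)"
    by (rule Suc.prems) auto
  also have "\<dots> \<le> c * (c ^ m * norm v)"
    using Suc by (intro mult_left_mono assms(2)) auto
  finally show ?case by (simp add: mult.assoc)
qed simp

lemma ED_with_subset:
  assumes "ED_with B I P K \<alpha>" "J \<subseteq> I" shows "ED_with B J P K \<alpha>"
proof -
  have J: "n \<in> I" if "n \<in> J" for n using assms(2) that by blast
  obtain C where "\<forall>n\<in>I. norm (P n) \<le> C"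
    using assms(1) by (auto simp: ED_with_def regular_proj_def invariant_proj_def)
  then have "\<exists>C. \<forall>n\<in>J. norm (P n) \<le> C" using J by blast
  with assms(1) show ?thesis
    unfolding ED_with_def regular_proj_def invariant_proj_def projector_on_def by (simp add: J)
qed

locale dichotomy =
  fixes B :: "int \<Rightarrow> real^'n^'n" and I :: "int set" and P :: "int \<Rightarrow> real^'n^'n" and K \<alpha> :: real
  assumes ED: "ED_with B I P K \<alpha>" and I: "int_interval I"
begin

lemma const: "1 \<le> K" "0 < K" "0 < \<alpha>" "\<alpha> < 1"
  using ED by (auto simp: ED_with_def)

lemma proj: "n \<in> I \<Longrightarrow> P n *v (P n *v v) = P n *v v"
  using ED by (auto simp: ED_with_def regular_proj_def invariant_proj_def projector_on_def matrix_vector_mul_assoc)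

lemma inv: "n \<in> I \<Longrightarrow> n + 1 \<in> I \<Longrightarrow> P (n + 1) *v (B n *v v) = B n *v (P n *v v)"
  using ED by (auto simp: ED_with_def regular_proj_def invariant_proj_def matrix_vector_mul_assoc)

lemma bij: "n \<in> I \<Longrightarrow> n + 1 \<in> I \<Longrightarrow> bij_betw (\<lambda>x. B n *v x) {x. P n *v x = 0} {x. P (n + 1) *v x = 0}"
  using ED by (auto simp: ED_with_def regular_proj_def)

lemma proj_bounded: "\<exists>C\<ge>0. \<forall>n\<in>I. \<forall>v. norm (P n *v v) \<le> C * norm v \<and> norm (v - P n *v v) \<le> C * norm v"
proof -
  obtain C where C: "\<And>n. n \<in> I \<Longrightarrow> norm (P n) \<le> C"
    using ED by (auto simp: ED_with_def regular_proj_def invariant_proj_def)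
  have 1: "norm (P n *v v) \<le> \<bar>C\<bar> * norm v" if "n \<in> I" for n v
  proof -
    have "norm (P n) \<le> \<bar>C\<bar>" using C[OF that] by linarith
    then show ?thesis
      by (rule order_trans[OF norm_matrix_vector_mult_le mult_right_mono]) simp
  qed
  have "norm (v - P n *v v) \<le> norm v + \<bar>C\<bar> * norm v" if "n \<in> I" for n v
    using norm_triangle_ineq4[of v "P n *v v"] 1[OF that, of v] by linarith
  then show ?thesis
    by (intro exI[of _ "1 + \<bar>C\<bar>"]) (auto simp: distrib_right intro: order_trans[OF 1])
qed

lemma between: "a \<in> I \<Longrightarrow> b \<in> I \<Longrightarrow> a \<le> n \<Longrightarrow> n \<le> b \<Longrightarrow> n \<in> I"
  using I unfolding int_interval_def by (meson atLeastAtMost_iff subsetD)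

lemma inv_Phi: "n \<in> I \<Longrightarrow> n + int m \<in> I \<Longrightarrow> P (n + int m) *v (Phi B (n + int m) n *v v) = Phi B (n + int m) n *v (P n *v v)"
proof (induction m)
  case (Suc m)
  have m: "n + int m \<in> I" "n + int m + 1 \<in> I"
    using Suc.prems between[of n "n + int (Suc m)" "n + int m"] by (auto simp: algebra_simps)
  have "Phi B (n + int (Suc m)) n *v w = B (n + int m) *v (Phi B (n + int m) n *v w)" for w
    using Phi_Suc_vec[of n "n + int m" B w] by (simp add: algebra_simps)
  then show ?case
    using inv[OF m] Suc.IH[OF Suc.prems(1) m(1)] by (simp add: algebra_simps)
qed simp

lemma rates:
  assumes "n \<in> I" "n + int m \<in> I"
  shows "norm (Phi B (n + int m) n *v (P n *v v)) \<le> K * \<alpha> ^ m * norm (P n *v v)"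
    and "norm (Phi B (n + int m) n *v (v - P n *v v)) \<ge> (1 / K) * (1 / \<alpha>) ^ m * norm (v - P n *v v)"
proof -
  have "\<forall>k\<in>I. \<forall>n\<in>I. \<forall>x. n \<le> k \<longrightarrow>
        norm (Phi B k n *v (P n *v x)) \<le> K * \<alpha> ^ nat (k - n) * norm (P n *v x) \<and>
        norm (Phi B k n *v (x - P n *v x)) \<ge> (1 / K) * (1 / \<alpha>) ^ nat (k - n) * norm (x - P n *v x)"
    using ED by (simp add: ED_with_def)
  from this[rule_format, OF assms(2,1), of v] show
    "norm (Phi B (n + int m) n *v (P n *v v)) \<le> K * \<alpha> ^ m * norm (P n *v v)"
    "norm (Phi B (n + int m) n *v (v - P n *v v)) \<ge> (1 / K) * (1 / \<alpha>) ^ m * norm (v - P n *v v)"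
    by simp_all
qed

lemma stable: "n \<in> I \<Longrightarrow> n + int m \<in> I \<Longrightarrow> P n *v v = v \<Longrightarrow> norm (Phi B (n + int m) n *v v) \<le> K * \<alpha> ^ m * norm v"
  using rates(1)[of n m v] by simp

lemma unstable: "n \<in> I \<Longrightarrow> n + int m \<in> I \<Longrightarrow> P n *v v = 0 \<Longrightarrow> norm v \<le> K * \<alpha> ^ m * norm (Phi B (n + int m) n *v v)"
  using rates(2)[of n m v] const by (simp add: field_simps power_divide)

text \<open>Regularity iterated: the coefficients may be singular, and the kernels of the projectors
  are where going back in time is possible.\<close>

lemma surj_Phi: "n \<in> I \<Longrightarrow> n + int m \<in> I \<Longrightarrow> P (n + int m) *v y = 0 \<Longrightarrow> \<exists>v. P n *v v = 0 \<and> Phi B (n + int m) n *v v = y"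
proof (induction m arbitrary: y)
  case (Suc m)
  have m: "n + int m \<in> I" "n + int m + 1 \<in> I"
    using Suc.prems between[of n "n + int (Suc m)" "n + int m"] by (auto simp: algebra_simps)
  have "y \<in> {x. P (n + int m + 1) *v x = 0}" using Suc.prems by (simp add: algebra_simps)
  then obtain y' where y': "P (n + int m) *v y' = 0" "y = B (n + int m) *v y'"
    using bij[OF m] by (auto simp: bij_betw_def)
  obtain v where "P n *v v = 0" "Phi B (n + int m) n *v v = y'"
    using Suc.IH[OF Suc.prems(1) m(1) y'(1)] by blast
  then show ?case
    using y' Phi_Suc_vec[of n "n + int m" B v] by (auto simp: algebra_simps)
qed simp

text \<open>Variation of constants in both directions: the range part of \<open>x n\<close> is
  propagated forward from \<open>a\<close>, the kernel part is pulled back from \<open>b\<close>,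
  and the errors accumulate to two geometric series, each bounded by
  \<open>K * C * \<eta> / (1 - \<alpha>)\<close>. The boundary terms see only the range part at
  \<open>a\<close> and the kernel part at \<open>b\<close>, so a boundary condition that kills one
  of them leaves a one-sided bound.\<close>

lemma estimate:
  assumes ab: "a \<in> I" "b \<in> I" "a \<le> n" "n \<le> b" and C: "0 \<le> C" "0 \<le> \<eta>"
    and bound: "\<And>k v. a \<le> k \<Longrightarrow> k \<le> b \<Longrightarrow> norm (P k *v v) \<le> C * norm v \<and> norm (v - P k *v v) \<le> C * norm v"
    and x: "\<And>k. a \<le> k \<Longrightarrow> k < b \<Longrightarrow> norm (x (k + 1) - B k *v x k) \<le> \<eta>"
  shows "norm (x n) \<le> K * \<alpha> ^ nat (n - a) * norm (P a *v x a) + K * \<alpha> ^ nat (b - n) * norm (x b - P b *v x b)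
     + 2 * K * C * \<eta> / (1 - \<alpha>)"
proof -
  have geo: "(\<Sum>j<m. \<alpha> ^ j) \<le> 1 / (1 - \<alpha>)" for m
    using const by (simp add: sum_gp_strict divide_right_mono)
  define h where "h k = x (k + 1) - B k *v x k" for k
  have xs: "x (k + 1) = B k *v x k + h k" for k by (simp add: h_def)
  have hb: "norm (P (k + 1) *v h k) \<le> C * \<eta>" "norm (h k - P (k + 1) *v h k) \<le> C * \<eta>" if "a \<le> k" "k < b" for k
    using bound[of "k + 1" "h k"] x[OF that] mult_left_mono[of "norm (h k)" \<eta> C] C that
    unfolding h_def by linarith+
  have ina: "k \<in> I" if "a \<le> k" "k \<le> b" for k by (rule between[OF ab(1,2) that])
  have Pform: "P (a + int m) *v x (a + int m) = Phi B (a + int m) a *v (P a *v x a)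
      + (\<Sum>j<m. Phi B (a + int m) (a + int j + 1) *v (P (a + int j + 1) *v h (a + int j)))" if "a + int m \<le> b" for m
    using that
  proof (induction m)
    case (Suc m)
    have m: "a + int m \<in> I" "a + int m + 1 \<in> I" using Suc.prems by (auto intro!: ina)
    have s: "a + int (Suc m) = a + int m + 1" by simp
    have e: "B (a + int m) *v (Phi B (a + int m) (a + int j + 1) *v w) = Phi B (a + int m + 1) (a + int j + 1) *v w"
      if "j < m" for j w
      using that Phi_Suc_vec[of "a + int j + 1" "a + int m" B w] by simp
    have "P (a + int m + 1) *v x (a + int m + 1) = B (a + int m) *v (P (a + int m) *v x (a + int m)) + P (a + int m + 1) *v h (a + int m)"
      using inv[OF m] by (simp add: xs matrix_vector_right_distrib)
    also have "B (a + int m) *v (P (a + int m) *v x (a + int m)) = Phi B (a + int m + 1) a *v (P a *v x a) +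
        (\<Sum>j<m. Phi B (a + int m + 1) (a + int j + 1) *v (P (a + int j + 1) *v h (a + int j)))"
      using Suc e by (simp add: matrix_vector_right_distrib matrix_vector_mult_sum Phi_Suc_vec)
    finally show ?case unfolding s by simp
  qed simp
  have Pest: "norm (P n *v x n) \<le> K * \<alpha> ^ nat (n - a) * norm (P a *v x a) + K * C * \<eta> / (1 - \<alpha>)"
  proof -
    define m where "m = nat (n - a)"
    have n: "n = a + int m" using ab by (simp add: m_def)
    have "norm (\<Sum>j<m. Phi B n (a + int j + 1) *v (P (a + int j + 1) *v h (a + int j)))
        \<le> (\<Sum>j<m. K * C * \<eta> * \<alpha> ^ (m - Suc j))"
    proof (rule sum_norm_le)
      fix j assume "j \<in> {..<m}"
      then have j: "j < m" by simp
      have n': "n = a + int j + 1 + int (m - Suc j)" using j n by simp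
      have "norm (Phi B n (a + int j + 1) *v (P (a + int j + 1) *v h (a + int j)))
          \<le> K * \<alpha> ^ (m - Suc j) * norm (P (a + int j + 1) *v h (a + int j))"
        unfolding n' by (rule stable) (use j n ab in \<open>auto intro!: ina proj\<close>)
      also have "\<dots> \<le> K * \<alpha> ^ (m - Suc j) * (C * \<eta>)"
        using const j n ab by (intro mult_left_mono hb) auto
      finally show "norm (Phi B n (a + int j + 1) *v (P (a + int j + 1) *v h (a + int j))) \<le> K * C * \<eta> * \<alpha> ^ (m - Suc j)"
        by (simp add: mult_ac)
    qed
    also have "\<dots> = K * C * \<eta> * (\<Sum>j<m. \<alpha> ^ j)"
      unfolding sum_distrib_left[symmetric] by (subst sum.nat_diff_reindex) simp
    also have "\<dots> \<le> K * C * \<eta> * (1 / (1 - \<alpha>))"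
      using const C by (intro mult_left_mono geo) auto
    finally have 1: "norm (\<Sum>j<m. Phi B n (a + int j + 1) *v (P (a + int j + 1) *v h (a + int j))) \<le> K * C * \<eta> / (1 - \<alpha>)"
      by simp
    have 2: "norm (Phi B n a *v (P a *v x a)) \<le> K * \<alpha> ^ m * norm (P a *v x a)"
      unfolding n by (rule stable) (use n ab in \<open>auto intro!: ina proj\<close>)
    show ?thesis
      using Pform[of m] n ab 1 2 norm_triangle_ineq[of "Phi B n a *v (P a *v x a)" "\<Sum>j<m. Phi B n (a + int j + 1) *v (P (a + int j + 1) *v h (a + int j))"]
      unfolding m_def[symmetric] by simp
  qed
  define q where "q k = x k - P k *v x k" for k
  have Pq: "P k *v q k = 0" if "a \<le> k" "k \<le> b" for k
    using proj[OF ina[OF that]] by (simp add: q_def matrix_vector_mult_diff_distrib)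
  \<comment> \<open>No inverse of \<open>Phi\<close> can be applied to \<open>q (n + int m)\<close>,
    so a preimage \<open>w\<close> in the kernel at time \<open>n\<close> is carried along. Each
    step adds a preimage \<open>z\<close> of the new error, and \<open>unstable\<close> makes
    \<open>z\<close> exponentially short.\<close>
  have Qform: "\<exists>w. P n *v w = 0 \<and> Phi B (n + int m) n *v w = q (n + int m) \<and>
      norm (q n - w) \<le> (\<Sum>j<m. K * C * \<eta> * \<alpha> ^ j)" if "n + int m \<le> b" for m
    using that
  proof (induction m)
    case 0
    show ?case using Pq[of n] ab by (intro exI[of _ "q n"]) simp
  next
    case (Suc m)
    then obtain w where w: "P n *v w = 0" "Phi B (n + int m) n *v w = q (n + int m)"
      "norm (q n - w) \<le> (\<Sum>j<m. K * C * \<eta> * \<alpha> ^ j)" by auto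
    let ?k = "n + int m"
    have s: "n + int (Suc m) = ?k + 1" by simp
    have k: "a \<le> ?k" "?k < b" "?k \<in> I" "?k + 1 \<in> I" "n \<in> I" using Suc.prems ab by (auto intro!: ina)
    let ?y = "h ?k - P (?k + 1) *v h ?k"
    have y: "P (?k + 1) *v ?y = 0" using proj[OF k(4)] by (simp add: matrix_vector_mult_diff_distrib)
    obtain z where z: "P n *v z = 0" "Phi B (?k + 1) n *v z = ?y"
      using surj_Phi[of n "Suc m" ?y] k y unfolding s by auto
    have "norm z \<le> K * \<alpha> ^ Suc m * norm ?y"
      using unstable[of n "Suc m" z] k z unfolding s by simp
    also have "\<dots> \<le> K * \<alpha> ^ Suc m * (C * \<eta>)"
      using const by (intro mult_left_mono hb k) auto
    also have "\<dots> \<le> K * \<alpha> ^ m * (C * \<eta>)"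
      using const C by (intro mult_right_mono mult_left_mono power_decreasing) auto
    finally have nz: "norm z \<le> K * C * \<eta> * \<alpha> ^ m" by (simp add: mult_ac)
    have "q (?k + 1) = B ?k *v q ?k + ?y"
      using inv[OF k(3,4), of "x ?k"]
      by (simp add: q_def xs matrix_vector_right_distrib matrix_vector_mult_diff_distrib)
    then have "Phi B (?k + 1) n *v (w + z) = q (?k + 1)"
      using w z by (simp add: matrix_vector_right_distrib Phi_Suc_vec)
    moreover have "norm (q n - (w + z)) \<le> (\<Sum>j<Suc m. K * C * \<eta> * \<alpha> ^ j)"
      using w(3) nz norm_triangle_ineq4[of "q n - w" z] by (simp add: algebra_simps)
    ultimately show ?case
      unfolding s using w z by (intro exI[of _ "w + z"]) (simp add: matrix_vector_right_distrib)
  qed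
  have Qest: "norm (q n) \<le> K * \<alpha> ^ nat (b - n) * norm (q b) + K * C * \<eta> / (1 - \<alpha>)"
  proof -
    define m where "m = nat (b - n)"
    have b: "n + int m = b" using ab by (simp add: m_def)
    obtain w where w: "P n *v w = 0" "Phi B b n *v w = q b" "norm (q n - w) \<le> (\<Sum>j<m. K * C * \<eta> * \<alpha> ^ j)"
      using Qform[of m] b by auto
    have "norm w \<le> K * \<alpha> ^ m * norm (q b)"
      using unstable[of n m w] w b ab ina[of n] by auto
    moreover have "(\<Sum>j<m. K * C * \<eta> * \<alpha> ^ j) \<le> K * C * \<eta> * (1 / (1 - \<alpha>))"
      unfolding sum_distrib_left[symmetric] using const C by (intro mult_left_mono geo) auto
    ultimately show ?thesis
      using w(3) norm_triangle_ineq[of "q n - w" w] by (simp add: m_def)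
  qed
  have "norm (x n) \<le> norm (P n *v x n) + norm (q n)"
    using norm_triangle_ineq[of "P n *v x n" "q n"] by (simp add: q_def)
  also have "\<dots> \<le> (K * \<alpha> ^ nat (n - a) * norm (P a *v x a) + K * C * \<eta> / (1 - \<alpha>))
      + (K * \<alpha> ^ nat (b - n) * norm (q b) + K * C * \<eta> / (1 - \<alpha>))"
    by (rule add_mono[OF Pest Qest])
  also have "\<dots> = K * \<alpha> ^ nat (n - a) * norm (P a *v x a) + K * \<alpha> ^ nat (b - n) * norm (x b - P b *v x b)
      + 2 * K * C * \<eta> / (1 - \<alpha>)"
    by (simp add: q_def add_divide_distrib)
  finally show ?thesis .
qed

text \<open>The projector bound inside the definition of a dichotomy may vary with a parameter; this
  one depends on \<open>c\<close> and \<open>m\<close> alone. Over \<open>m\<close> steps the kernel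
  part grows at least threefold and the range part shrinks at least to a third, while the image of
  \<open>v\<close> has norm at most \<open>c ^ m * norm v\<close>, so a long kernel part and a long
  range part cannot nearly cancel. Looking \<open>m\<close> steps ahead is why
  \<open>n + int m\<close> must lie in \<open>I\<close>.\<close>

lemma projector_bound:
  assumes n: "n \<in> I" "n + int m \<in> I" and m: "K * \<alpha> ^ m \<le> 1/3" and c: "0 \<le> c"
    and B: "\<And>k v. k \<in> I \<Longrightarrow> norm (B k *v v) \<le> c * norm v"
  shows "norm (P n *v v) \<le> (c ^ m + 2) * norm v" "norm (v - P n *v v) \<le> (c ^ m + 2) * norm v"
proof -
  let ?F = "Phi B (n + int m) n" and ?p = "P n *v v" and ?q = "v - P n *v v"
  have "norm ?q \<le> K * \<alpha> ^ m * norm (?F *v ?q)"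
    by (rule unstable[OF n]) (simp add: matrix_vector_mult_diff_distrib proj n)
  also have "\<dots> \<le> 1/3 * norm (?F *v ?q)"
    by (intro mult_right_mono m) auto
  finally have 1: "3 * norm ?q \<le> norm (?F *v ?q)" by simp
  have "norm (?F *v ?p) \<le> K * \<alpha> ^ m * norm ?p"
    by (rule stable[OF n]) (simp add: proj n)
  also have "\<dots> \<le> 1/3 * norm ?p" by (intro mult_right_mono m) auto
  finally have 2: "norm (?F *v ?p) \<le> 1/3 * norm ?p" .
  have 3: "norm ?p \<le> norm v + norm ?q" using norm_triangle_ineq4[of v ?q] by simp
  have 4: "norm (?F *v v) \<le> c ^ m * norm v"
    by (rule norm_Phi_le) (use B c between[OF n] in auto)
  have 5: "norm (?F *v ?q) \<le> norm (?F *v v) + norm (?F *v ?p)"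
    using norm_triangle_ineq4[of "?F *v v" "?F *v ?p"] by (simp add: matrix_vector_mult_diff_distrib)
  have "0 \<le> c ^ m * norm v" using c by simp
  with 1 2 3 4 5 norm_ge_zero[of v] norm_ge_zero[of ?q]
  show "norm ?p \<le> (c ^ m + 2) * norm v" "norm ?q \<le> (c ^ m + 2) * norm v"
    unfolding distrib_right by linarith+
qed

lemma small_power: assumes "0 < e" shows "\<exists>m. K * \<alpha> ^ m \<le> e"
proof -
  have "0 < e / K" using assms const(2) by simp
  then obtain m where m: "\<alpha> ^ m < e / K"
    using real_arch_pow_inv[OF _ const(4)] by blast
  have "K * \<alpha> ^ m \<le> K * (e / K)"
    using m const(2) by (intro mult_left_mono) auto
  then show ?thesis using const(2) by (intro exI[of _ m]) simp
qed

end

section \<open>Ranges and kernels determined by bounded orbits on half-lines\<close>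

lemma le_small_powers_imp_0:
  assumes "0 < \<alpha>" "\<alpha> < (1::real)" "\<And>m::nat. norm v \<le> c * \<alpha> ^ m" shows "v = 0"
proof -
  have "(\<lambda>m. c * \<alpha> ^ m) \<longlonglongrightarrow> c * 0"
    by (intro tendsto_mult_left LIMSEQ_power_zero) (use assms in auto)
  then have "norm v \<le> c * 0"
    by (rule LIMSEQ_le_const) (use assms in auto)
  then show ?thesis by simp
qed

text \<open>A vector in the range of the first projector has a bounded forward orbit. For the second
  dichotomy, the kernel part of a vector with bounded forward orbit is at most a constant times
  \<open>\<alpha>' ^ m\<close> for every \<open>m\<close>, hence zero.\<close>

lemma ED_range_unique:
  assumes "ED_with B {k..} P K \<alpha>" "ED_with B {k..} P' K' \<alpha>'" "P k *v v = v"
  shows "P' k *v v = v"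
proof -
  interpret d: dichotomy B "{k..}" P K \<alpha> by unfold_locales (use assms in auto)
  interpret d': dichotomy B "{k..}" P' K' \<alpha>' by unfold_locales (use assms in auto)
  obtain C where C: "C \<ge> 0" "\<And>n v. n \<ge> k \<Longrightarrow> norm (v - P' n *v v) \<le> C * norm v"
    using d'.proj_bounded by auto
  define q where "q = v - P' k *v v"
  have "norm q \<le> (K' * (C * (K * norm v))) * \<alpha>' ^ m" for m
  proof -
    let ?F = "Phi B (k + int m) k"
    have "norm q \<le> K' * \<alpha>' ^ m * norm (?F *v q)"
      by (rule d'.unstable) (simp_all add: q_def matrix_vector_mult_diff_distrib d'.proj)
    also have "?F *v q = ?F *v v - P' (k + int m) *v (?F *v v)"
      using d'.inv_Phi[of k m v] by (simp add: q_def matrix_vector_mult_diff_distrib)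
    also have "K' * \<alpha>' ^ m * norm \<dots> \<le> K' * \<alpha>' ^ m * (C * norm (?F *v v))"
      using C d'.const by (intro mult_left_mono) auto
    also have "\<dots> \<le> K' * \<alpha>' ^ m * (C * (K * norm v))"
    proof (intro mult_left_mono)
      have "norm (?F *v v) \<le> K * \<alpha> ^ m * norm v" by (rule d.stable) (use assms(3) in auto)
      also have "\<dots> \<le> K * 1 * norm v"
        using d.const by (intro mult_right_mono mult_left_mono power_le_one) auto
      finally show "norm (?F *v v) \<le> K * norm v" by simp
    qed (use C d'.const in auto)
    finally show ?thesis by (simp add: mult_ac)
  qed
  then have "q = 0" by (rule le_small_powers_imp_0[OF d'.const(3,4)])
  then show ?thesis by (simp add: q_def)
qed

text \<open>The same with time reversed: a kernel vector has a bounded backward orbit, and its range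
  part for the second dichotomy arrives from \<open>m\<close> steps back damped by
  \<open>\<alpha>' ^ m\<close>.\<close>

lemma ED_kernel_unique:
  assumes "ED_with B {..k} P K \<alpha>" "ED_with B {..k} P' K' \<alpha>'" "P k *v v = 0"
  shows "P' k *v v = 0"
proof -
  interpret d: dichotomy B "{..k}" P K \<alpha> by unfold_locales (use assms in auto)
  interpret d': dichotomy B "{..k}" P' K' \<alpha>' by unfold_locales (use assms in auto)
  obtain C where C: "C \<ge> 0" "\<And>n v. n \<le> k \<Longrightarrow> norm (P' n *v v) \<le> C * norm v"
    using d'.proj_bounded by auto
  have "norm (P' k *v v) \<le> (K' * (C * (K * norm v))) * \<alpha>' ^ m" for m
  proof -
    let ?n = "k - int m"
    have k: "?n + int m = k" by simp
    obtain w where w: "P ?n *v w = 0" "Phi B k ?n *v w = v"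
      using d.surj_Phi[of ?n m v] assms(3) by auto
    have "P' k *v v = Phi B k ?n *v (P' ?n *v w)"
      using d'.inv_Phi[of ?n m w] w by simp
    also have "norm \<dots> \<le> K' * \<alpha>' ^ m * norm (P' ?n *v w)"
      using d'.stable[of ?n m "P' ?n *v w"] by (simp add: d'.proj)
    also have "\<dots> \<le> K' * \<alpha>' ^ m * (C * norm w)"
      using C d'.const by (intro mult_left_mono) auto
    also have "\<dots> \<le> K' * \<alpha>' ^ m * (C * (K * norm v))"
    proof (intro mult_left_mono)
      have "norm w \<le> K * \<alpha> ^ m * norm v" using d.unstable[of ?n m w] w by simp
      also have "\<dots> \<le> K * 1 * norm v"
        using d.const by (intro mult_right_mono mult_left_mono power_le_one) auto
      finally show "norm w \<le> K * norm v" by simp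
    qed (use C d'.const in auto)
    finally show ?thesis by (simp add: mult_ac)
  qed
  then show ?thesis by (rule le_small_powers_imp_0[OF d'.const(3,4)])
qed

subsection \<open>Vector bundles given by projections\<close>

definition vcat :: "nat \<Rightarrow> rvec \<Rightarrow> rvec \<Rightarrow> rvec" where
  "vcat N x y = (\<lambda>i. if i < N then x i else y (i - N))"

definition vshift :: "nat \<Rightarrow> rvec \<Rightarrow> rvec" where
  "vshift N x = (\<lambda>i. x (N + i))"

definition mblock :: "nat \<Rightarrow> nat \<Rightarrow> rmat \<Rightarrow> rmat \<Rightarrow> rmat" where
  "mblock M N A B = (\<lambda>i j. if i < M \<and> j < N then A i j else if M \<le> i \<and> N \<le> j then B (i - M) (j - N) else 0)"

definition id_rmat :: rmat where
  "id_rmat = (\<lambda>i j. if i = j then 1 else 0)"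

lemma sum_lessThan_add: "(\<Sum>j<N + (M::nat). f j) = (\<Sum>j<N. f j) + (\<Sum>j<M. f (N + j) :: real)"
  by (induction M) simp_all

lemma vshift_vcat [simp]: "vshift N (vcat N x y) = y"
  by (auto simp: vshift_def vcat_def)

lemma mvr_vcat [simp]: "mvr M N A (vcat N x y) = mvr M N A x"
  by (auto simp: mvr_def vcat_def intro!: ext sum.cong)

lemma mvr_support: "M \<le> i \<Longrightarrow> mvr M N A x i = 0"
  by (simp add: mvr_def)

lemma mvr_id: "(\<And>i. N \<le> i \<Longrightarrow> x i = 0) \<Longrightarrow> mvr N N id_rmat x = x"
  by (auto simp: mvr_def id_rmat_def if_distrib[of "\<lambda>a. a * _"] cong: if_cong)

lemma mvr_mblock:
  "mvr (M1 + M2) (N1 + N2) (mblock M1 N1 A B) x = vcat M1 (mvr M1 N1 A x) (mvr M2 N2 B (vshift N1 x))"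
proof
  fix i
  consider "i < M1" | "M1 \<le> i" "i < M1 + M2" | "M1 + M2 \<le> i" by linarith
  then show "mvr (M1 + M2) (N1 + N2) (mblock M1 N1 A B) x i = vcat M1 (mvr M1 N1 A x) (mvr M2 N2 B (vshift N1 x)) i"
    by cases (auto simp: mvr_def vcat_def vshift_def sum_lessThan_add mblock_def)
qed

lemma fibre_support: "x \<in> fibre E l \<Longrightarrow> fst E \<le> i \<Longrightarrow> x i = 0"
  by (cases E) (auto simp: fibre_def mvr_def)

lemma dsum_eq: "fst (dsum E F) = fst E + fst F"
  "i < fst E + fst F \<Longrightarrow> j < fst E + fst F \<Longrightarrow> snd (dsum E F) l i j = mblock (fst E) (fst E) (snd E l) (snd F l) i j"
  by (auto simp: dsum_def mblock_def split: prod.splits)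

lemma mvr_cong: "(\<And>i j. i < M \<Longrightarrow> j < N \<Longrightarrow> A i j = B i j) \<Longrightarrow> mvr M N A x = mvr M N B x"
  by (auto simp: mvr_def intro!: ext sum.cong)

lemma fibre_eq: "fibre E l = range (mvr (fst E) (fst E) (snd E l))"
  by (cases E) (simp add: fibre_def)

lemma mvr_dsum:
  "mvr (fst (dsum E F)) (fst (dsum E F)) (snd (dsum E F) l) x =
    vcat (fst E) (mvr (fst E) (fst E) (snd E l) x) (mvr (fst F) (fst F) (snd F l) (vshift (fst E) x))"
  unfolding mvr_mblock[symmetric] dsum_eq(1) by (rule mvr_cong) (rule dsum_eq(2))

lemma fibre_dsum: "x \<in> fibre (dsum E F) l \<longleftrightarrow> (\<exists>u\<in>fibre E l. \<exists>v\<in>fibre F l. x = vcat (fst E) u v)"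
proof
  assume "x \<in> fibre (dsum E F) l"
  then show "\<exists>u\<in>fibre E l. \<exists>v\<in>fibre F l. x = vcat (fst E) u v"
    unfolding fibre_eq mvr_dsum by blast
next
  assume "\<exists>u\<in>fibre E l. \<exists>v\<in>fibre F l. x = vcat (fst E) u v"
  then obtain u v where "x = vcat (fst E) (mvr (fst E) (fst E) (snd E l) u) (mvr (fst F) (fst F) (snd F l) v)"
    by (auto simp: fibre_eq)
  then have "x = mvr (fst (dsum E F)) (fst (dsum E F)) (snd (dsum E F) l) (vcat (fst E) u v)"
    unfolding mvr_dsum by simp
  then show "x \<in> fibre (dsum E F) l" unfolding fibre_eq by blast
qed

lemma fibre_dsum_image: "fibre (dsum E F) l = (\<lambda>(u, v). vcat (fst E) u v) ` (fibre E l \<times> fibre F l)"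
  unfolding set_eq_iff fibre_dsum by auto

lemma vcat_in_fibre: "u \<in> fibre E l \<Longrightarrow> v \<in> fibre F l \<Longrightarrow> N = fst E \<Longrightarrow> vcat N u v \<in> fibre (dsum E F) l"
  unfolding fibre_dsum by blast

lemma fibre_dsumE:
  assumes "x \<in> fibre (dsum E F) l"
  obtains u v where "u \<in> fibre E l" "v \<in> fibre F l" "x = vcat (fst E) u v"
  using assms unfolding fibre_dsum by blast

section \<open>Calculus of bundle isomorphisms, direct sums and ranks\<close>

lemma bundle_iso_iff: "bundle_iso \<Lambda> E F \<longleftrightarrow>
     (\<exists>A B. (\<forall>i<fst F. \<forall>j<fst E. continuous_on \<Lambda> (\<lambda>l. A l i j)) \<and>
            (\<forall>i<fst E. \<forall>j<fst F. continuous_on \<Lambda> (\<lambda>l. B l i j)) \<and>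
            (\<forall>l\<in>\<Lambda>. (\<forall>x\<in>fibre E l. mvr (fst F) (fst E) (A l) x \<in> fibre F l \<and> mvr (fst E) (fst F) (B l) (mvr (fst F) (fst E) (A l) x) = x) \<and>
                     (\<forall>y\<in>fibre F l. mvr (fst E) (fst F) (B l) y \<in> fibre E l \<and> mvr (fst F) (fst E) (A l) (mvr (fst E) (fst F) (B l) y) = y)))"
  by (cases E; cases F) (simp add: bundle_iso_def)

lemma bundle_isoI:
  assumes "\<And>i j. i < fst F \<Longrightarrow> j < fst E \<Longrightarrow> continuous_on \<Lambda> (\<lambda>l. A l i j)"
    and "\<And>i j. i < fst E \<Longrightarrow> j < fst F \<Longrightarrow> continuous_on \<Lambda> (\<lambda>l. B l i j)"
    and "\<And>l x. l \<in> \<Lambda> \<Longrightarrow> x \<in> fibre E l \<Longrightarrow> mvr (fst F) (fst E) (A l) x \<in> fibre F l"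
    and "\<And>l x. l \<in> \<Lambda> \<Longrightarrow> x \<in> fibre E l \<Longrightarrow> mvr (fst E) (fst F) (B l) (mvr (fst F) (fst E) (A l) x) = x"
    and "\<And>l y. l \<in> \<Lambda> \<Longrightarrow> y \<in> fibre F l \<Longrightarrow> mvr (fst E) (fst F) (B l) y \<in> fibre E l"
    and "\<And>l y. l \<in> \<Lambda> \<Longrightarrow> y \<in> fibre F l \<Longrightarrow> mvr (fst F) (fst E) (A l) (mvr (fst E) (fst F) (B l) y) = y"
  shows "bundle_iso \<Lambda> E F"
  unfolding bundle_iso_iff using assms by blast

lemma bundle_isoE:
  assumes "bundle_iso \<Lambda> E F"
  obtains A B where "\<And>i j. i < fst F \<Longrightarrow> j < fst E \<Longrightarrow> continuous_on \<Lambda> (\<lambda>l. A l i j)"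
    and "\<And>i j. i < fst E \<Longrightarrow> j < fst F \<Longrightarrow> continuous_on \<Lambda> (\<lambda>l. B l i j)"
    and "\<And>l x. l \<in> \<Lambda> \<Longrightarrow> x \<in> fibre E l \<Longrightarrow> mvr (fst F) (fst E) (A l) x \<in> fibre F l"
    and "\<And>l x. l \<in> \<Lambda> \<Longrightarrow> x \<in> fibre E l \<Longrightarrow> mvr (fst E) (fst F) (B l) (mvr (fst F) (fst E) (A l) x) = x"
    and "\<And>l y. l \<in> \<Lambda> \<Longrightarrow> y \<in> fibre F l \<Longrightarrow> mvr (fst E) (fst F) (B l) y \<in> fibre E l"
    and "\<And>l y. l \<in> \<Lambda> \<Longrightarrow> y \<in> fibre F l \<Longrightarrow> mvr (fst F) (fst E) (A l) (mvr (fst E) (fst F) (B l) y) = y"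
proof -
  from assms[unfolded bundle_iso_iff] obtain A B where
    "\<forall>i<fst F. \<forall>j<fst E. continuous_on \<Lambda> (\<lambda>l. A l i j)" "\<forall>i<fst E. \<forall>j<fst F. continuous_on \<Lambda> (\<lambda>l. B l i j)"
    "\<forall>l\<in>\<Lambda>. (\<forall>x\<in>fibre E l. mvr (fst F) (fst E) (A l) x \<in> fibre F l \<and> mvr (fst E) (fst F) (B l) (mvr (fst F) (fst E) (A l) x) = x) \<and>
         (\<forall>y\<in>fibre F l. mvr (fst E) (fst F) (B l) y \<in> fibre E l \<and> mvr (fst F) (fst E) (A l) (mvr (fst E) (fst F) (B l) y) = y)"
    by (elim exE conjE)
  then show ?thesis by (intro that[of A B]) simp_all
qed

lemma mvr_id_fibre: "x \<in> fibre E l \<Longrightarrow> mvr (fst E) (fst E) id_rmat x = x"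
  by (rule mvr_id) (rule fibre_support)

lemma bundle_iso_refl: "bundle_iso \<Lambda> E E"
  by (rule bundle_isoI[where A = "\<lambda>_. id_rmat" and B = "\<lambda>_. id_rmat"]) (simp_all add: mvr_id_fibre)

lemma bundle_iso_sym: "bundle_iso \<Lambda> E F \<Longrightarrow> bundle_iso \<Lambda> F E"
  by (erule bundle_isoE, rule bundle_isoI) assumption+

lemma bundle_iso_trans [trans]:
  assumes "bundle_iso \<Lambda> E F" "bundle_iso \<Lambda> F G" shows "bundle_iso \<Lambda> E G"
proof -
  obtain A B where 1: "\<And>i j. i < fst F \<Longrightarrow> j < fst E \<Longrightarrow> continuous_on \<Lambda> (\<lambda>l. A l i j)"
    "\<And>i j. i < fst E \<Longrightarrow> j < fst F \<Longrightarrow> continuous_on \<Lambda> (\<lambda>l. B l i j)"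
    "\<And>l x. l \<in> \<Lambda> \<Longrightarrow> x \<in> fibre E l \<Longrightarrow> mvr (fst F) (fst E) (A l) x \<in> fibre F l"
    "\<And>l x. l \<in> \<Lambda> \<Longrightarrow> x \<in> fibre E l \<Longrightarrow> mvr (fst E) (fst F) (B l) (mvr (fst F) (fst E) (A l) x) = x"
    "\<And>l y. l \<in> \<Lambda> \<Longrightarrow> y \<in> fibre F l \<Longrightarrow> mvr (fst E) (fst F) (B l) y \<in> fibre E l"
    "\<And>l y. l \<in> \<Lambda> \<Longrightarrow> y \<in> fibre F l \<Longrightarrow> mvr (fst F) (fst E) (A l) (mvr (fst E) (fst F) (B l) y) = y"
    using assms(1) by (rule bundle_isoE) blast
  obtain C D where 2: "\<And>i j. i < fst G \<Longrightarrow> j < fst F \<Longrightarrow> continuous_on \<Lambda> (\<lambda>l. C l i j)"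
    "\<And>i j. i < fst F \<Longrightarrow> j < fst G \<Longrightarrow> continuous_on \<Lambda> (\<lambda>l. D l i j)"
    "\<And>l x. l \<in> \<Lambda> \<Longrightarrow> x \<in> fibre F l \<Longrightarrow> mvr (fst G) (fst F) (C l) x \<in> fibre G l"
    "\<And>l x. l \<in> \<Lambda> \<Longrightarrow> x \<in> fibre F l \<Longrightarrow> mvr (fst F) (fst G) (D l) (mvr (fst G) (fst F) (C l) x) = x"
    "\<And>l y. l \<in> \<Lambda> \<Longrightarrow> y \<in> fibre G l \<Longrightarrow> mvr (fst F) (fst G) (D l) y \<in> fibre F l"
    "\<And>l y. l \<in> \<Lambda> \<Longrightarrow> y \<in> fibre G l \<Longrightarrow> mvr (fst G) (fst F) (C l) (mvr (fst F) (fst G) (D l) y) = y"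
    using assms(2) by (rule bundle_isoE) blast
  show ?thesis
  proof (rule bundle_isoI[where A = "\<lambda>l i j. \<Sum>k<fst F. C l i k * A l k j" and B = "\<lambda>l i j. \<Sum>k<fst F. B l i k * D l k j"])
    show "continuous_on \<Lambda> (\<lambda>l. \<Sum>k<fst F. C l i k * A l k j)" if "i < fst G" "j < fst E" for i j
      using that 1(1) 2(1) by (intro continuous_intros) auto
    show "continuous_on \<Lambda> (\<lambda>l. \<Sum>k<fst F. B l i k * D l k j)" if "i < fst E" "j < fst G" for i j
      using that 1(2) 2(2) by (intro continuous_intros) auto
  qed (simp_all add: mvr_mvr[symmetric] 1(3-6) 2(3-6))
qed

lemma bundle_iso_dsum:
  assumes "bundle_iso \<Lambda> E E'" "bundle_iso \<Lambda> F F'" shows "bundle_iso \<Lambda> (dsum E F) (dsum E' F')"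
proof -
  obtain A B where 1: "\<And>i j. i < fst E' \<Longrightarrow> j < fst E \<Longrightarrow> continuous_on \<Lambda> (\<lambda>l. A l i j)"
    "\<And>i j. i < fst E \<Longrightarrow> j < fst E' \<Longrightarrow> continuous_on \<Lambda> (\<lambda>l. B l i j)"
    "\<And>l x. l \<in> \<Lambda> \<Longrightarrow> x \<in> fibre E l \<Longrightarrow> mvr (fst E') (fst E) (A l) x \<in> fibre E' l"
    "\<And>l x. l \<in> \<Lambda> \<Longrightarrow> x \<in> fibre E l \<Longrightarrow> mvr (fst E) (fst E') (B l) (mvr (fst E') (fst E) (A l) x) = x"
    "\<And>l y. l \<in> \<Lambda> \<Longrightarrow> y \<in> fibre E' l \<Longrightarrow> mvr (fst E) (fst E') (B l) y \<in> fibre E l"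
    "\<And>l y. l \<in> \<Lambda> \<Longrightarrow> y \<in> fibre E' l \<Longrightarrow> mvr (fst E') (fst E) (A l) (mvr (fst E) (fst E') (B l) y) = y"
    using assms(1) by (rule bundle_isoE) blast
  obtain C D where 2: "\<And>i j. i < fst F' \<Longrightarrow> j < fst F \<Longrightarrow> continuous_on \<Lambda> (\<lambda>l. C l i j)"
    "\<And>i j. i < fst F \<Longrightarrow> j < fst F' \<Longrightarrow> continuous_on \<Lambda> (\<lambda>l. D l i j)"
    "\<And>l x. l \<in> \<Lambda> \<Longrightarrow> x \<in> fibre F l \<Longrightarrow> mvr (fst F') (fst F) (C l) x \<in> fibre F' l"
    "\<And>l x. l \<in> \<Lambda> \<Longrightarrow> x \<in> fibre F l \<Longrightarrow> mvr (fst F) (fst F') (D l) (mvr (fst F') (fst F) (C l) x) = x"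
    "\<And>l y. l \<in> \<Lambda> \<Longrightarrow> y \<in> fibre F' l \<Longrightarrow> mvr (fst F) (fst F') (D l) y \<in> fibre F l"
    "\<And>l y. l \<in> \<Lambda> \<Longrightarrow> y \<in> fibre F' l \<Longrightarrow> mvr (fst F') (fst F) (C l) (mvr (fst F) (fst F') (D l) y) = y"
    using assms(2) by (rule bundle_isoE) blast
  have cont: "continuous_on \<Lambda> (\<lambda>l. mblock M N (A l) (B l) i j)"
    if "\<And>i j. i < M \<Longrightarrow> j < N \<Longrightarrow> continuous_on \<Lambda> (\<lambda>l. A l i j)" "i < M + M'" "j < N + N'"
      "\<And>i j. i < M' \<Longrightarrow> j < N' \<Longrightarrow> continuous_on \<Lambda> (\<lambda>l. B l i j)" for M N M' N' A B i j
  proof -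
    have "i - M < M'" if "M \<le> i" using that \<open>i < M + M'\<close> by linarith
    moreover have "j - N < N'" if "N \<le> j" using that \<open>j < N + N'\<close> by linarith
    ultimately show ?thesis
      using that(1)[of i j] that(4)[of "i - M" "j - N"]
      by (cases "i < M"; cases "j < N") (simp_all add: mblock_def)
  qed
  show ?thesis
    by (rule bundle_isoI[where A = "\<lambda>l. mblock (fst E') (fst E) (A l) (C l)" and B = "\<lambda>l. mblock (fst E) (fst E') (B l) (D l)"])
      (auto elim!: fibre_dsumE simp: dsum_eq(1) mvr_mblock 1 2
        intro!: vcat_in_fibre intro: cont[OF 1(1) _ _ 2(1)] cont[OF 1(2) _ _ 2(2)])
qed

text \<open>\<open>S\<close> is the permutation matrix exchanging the two coordinate blocks; with
  the sizes exchanged it is its own inverse.\<close>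

lemma bundle_iso_dsum_commute: "bundle_iso \<Lambda> (dsum E F) (dsum F E)"
proof -
  define S where "S N M = (\<lambda>i j. if i < M then if j = N + i then 1 else 0 else if j = i - M then 1 else 0 :: real)" for N M :: nat
  have S: "mvr (M + N) (N + M) (S N M) (vcat N u v) = vcat M v u"
    if "\<And>i. N \<le> i \<Longrightarrow> u i = 0" for N M u v
  proof
    fix i
    consider "i < M" | "M \<le> i" "i < M + N" | "M + N \<le> i" by linarith
    then show "mvr (M + N) (N + M) (S N M) (vcat N u v) i = vcat M v u i"
    proof cases
      case 1
      then have "(\<Sum>j<N + M. S N M i j * vcat N u v j) = (\<Sum>j<N + M. if j = N + i then vcat N u v j else 0)"
        by (intro sum.cong) (auto simp: S_def)
      with 1 show ?thesis by (simp add: mvr_def vcat_def)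
    next
      case 2
      then have "(\<Sum>j<N + M. S N M i j * vcat N u v j) = (\<Sum>j<N + M. if j = i - M then vcat N u v j else 0)"
        by (intro sum.cong) (auto simp: S_def)
      moreover have "i - M < N" using 2 by linarith
      ultimately show ?thesis using 2 by (simp add: mvr_def vcat_def)
    next
      case 3
      then show ?thesis using that[of "i - M"] by (simp add: mvr_def vcat_def)
    qed
  qed
  have S': "mvr (fst F + fst E) (fst E + fst F) (S (fst E) (fst F)) (vcat (fst E) u v) = vcat (fst F) v u"
    if "u \<in> fibre E l" for E F :: "'a vbundle" and u v l
    by (rule S) (rule fibre_support[OF that])
  show ?thesis
    by (rule bundle_isoI[where A = "\<lambda>_. S (fst E) (fst F)" and B = "\<lambda>_. S (fst F) (fst E)"])
      (auto elim!: fibre_dsumE simp: dsum_eq(1) S' intro!: vcat_in_fibre)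
qed

text \<open>In the matrix encoding both sides are the same block diagonal family, so regrouping is
  an equality and can be done by rewriting.\<close>

lemma dsum_assoc: "dsum (dsum E F) G = dsum E (dsum F G)"
  by (cases E; cases F; cases G) (auto simp: dsum_def add.assoc intro!: ext)

lemma dsum_triv: "dsum (triv a) (triv b) = triv (a + b)"
  by (auto simp: dsum_def triv_def intro!: ext)

lemma is_vbundle_triv: "is_vbundle \<Lambda> (triv r)"
  by (auto simp: is_vbundle_def triv_def if_distrib[of "\<lambda>a. a * _"] cong: if_cong)

lemma is_vbundleI:
  assumes "\<And>i j. i < N \<Longrightarrow> j < N \<Longrightarrow> continuous_on \<Lambda> (\<lambda>l. P l i j)"
    and "\<And>l i j. l \<in> \<Lambda> \<Longrightarrow> N \<le> i \<or> N \<le> j \<Longrightarrow> P l i j = 0"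
    and "\<And>l i j. l \<in> \<Lambda> \<Longrightarrow> i < N \<Longrightarrow> j < N \<Longrightarrow> (\<Sum>k<N. P l i k * P l k j) = P l i j"
  shows "is_vbundle \<Lambda> (N, P)"
  using assms by (auto simp: is_vbundle_def)

lemma is_vbundle_dsum:
  assumes "is_vbundle \<Lambda> E" "is_vbundle \<Lambda> F" shows "is_vbundle \<Lambda> (dsum E F)"
proof -
  obtain N P where E: "E = (N, P)" by (cases E)
  obtain M Q where F: "F = (M, Q)" by (cases F)
  have p: "\<And>i j. i < N \<Longrightarrow> j < N \<Longrightarrow> continuous_on \<Lambda> (\<lambda>l. P l i j)"
    "\<And>l i j. l \<in> \<Lambda> \<Longrightarrow> i < N \<Longrightarrow> j < N \<Longrightarrow> (\<Sum>k<N. P l i k * P l k j) = P l i j"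
    using assms(1) by (auto simp: E is_vbundle_def)
  have q: "\<And>i j. i < M \<Longrightarrow> j < M \<Longrightarrow> continuous_on \<Lambda> (\<lambda>l. Q l i j)"
    "\<And>l i j. l \<in> \<Lambda> \<Longrightarrow> i < M \<Longrightarrow> j < M \<Longrightarrow> (\<Sum>k<M. Q l i k * Q l k j) = Q l i j"
    using assms(2) by (auto simp: F is_vbundle_def)
  show ?thesis
    unfolding E F dsum_def prod.case
  proof (rule is_vbundleI)
    fix i j assume ij: "i < N + M" "j < N + M"
    have "i - N < M" if "N \<le> i" using that ij by linarith
    moreover have "j - N < M" if "N \<le> j" using that ij by linarith
    ultimately show "continuous_on \<Lambda> (\<lambda>l. if i < N \<and> j < N then P l i j
        else if N \<le> i \<and> i < N + M \<and> N \<le> j \<and> j < N + M then Q l (i - N) (j - N) else 0)"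
      using p(1)[of i j] q(1)[of "i - N" "j - N"] ij by (cases "i < N"; cases "j < N") simp_all
  next
    fix l i j assume l: "l \<in> \<Lambda>" and ij: "i < N + M" "j < N + M"
    show "(\<Sum>k<N + M. (if i < N \<and> k < N then P l i k else if N \<le> i \<and> i < N + M \<and> N \<le> k \<and> k < N + M then Q l (i - N) (k - N) else 0) *
            (if k < N \<and> j < N then P l k j else if N \<le> k \<and> k < N + M \<and> N \<le> j \<and> j < N + M then Q l (k - N) (j - N) else 0)) =
        (if i < N \<and> j < N then P l i j else if N \<le> i \<and> i < N + M \<and> N \<le> j \<and> j < N + M then Q l (i - N) (j - N) else 0)"
    proof -
      have "i - N < M" if "N \<le> i" using that ij by linarith
      moreover have "j - N < M" if "N \<le> j" using that ij by linarith
      ultimately show ?thesis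
        unfolding sum_lessThan_add
        using p(2)[OF l, of i j] q(2)[OF l, of "i - N" "j - N"] ij
        by (cases "i < N"; cases "j < N") (simp_all)
    qed
  qed auto
qed

lemma fibre_triv: "fibre (triv r) l = {x. \<forall>i\<ge>r. x i = 0}"
proof -
  have "mvr r r (\<lambda>i j. if i < r \<and> i = j then 1 else 0) x = (\<lambda>i. if i < r then x i else 0)" for x
    by (auto simp: mvr_def if_distrib[of "\<lambda>a. a * _"] cong: if_cong)
  moreover have "x = (\<lambda>i. if i < r then x i else 0)" if "\<forall>i\<ge>r. x i = 0" for x :: rvec
    using that by auto
  ultimately show ?thesis by (auto simp: fibre_def triv_def image_iff)
qed

lemma same_rank_iff: "same_rank \<Lambda> E F \<longleftrightarrow>
    (\<forall>l\<in>\<Lambda>. \<exists>A. bij_betw (mvr (fst F) (fst E) A) (fibre E l) (fibre F l))"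
  by (cases E; cases F) (simp add: same_rank_def)

lemma bundle_iso_same_rank: "bundle_iso \<Lambda> E F \<Longrightarrow> same_rank \<Lambda> E F"
  unfolding same_rank_iff
proof (erule bundle_isoE, intro ballI exI)
  fix A B l
  assume "l \<in> \<Lambda>" "\<And>l x. l \<in> \<Lambda> \<Longrightarrow> x \<in> fibre E l \<Longrightarrow> mvr (fst F) (fst E) (A l) x \<in> fibre F l"
    "\<And>l x. l \<in> \<Lambda> \<Longrightarrow> x \<in> fibre E l \<Longrightarrow> mvr (fst E) (fst F) (B l) (mvr (fst F) (fst E) (A l) x) = x"
    "\<And>l y. l \<in> \<Lambda> \<Longrightarrow> y \<in> fibre F l \<Longrightarrow> mvr (fst E) (fst F) (B l) y \<in> fibre E l"
    "\<And>l y. l \<in> \<Lambda> \<Longrightarrow> y \<in> fibre F l \<Longrightarrow> mvr (fst F) (fst E) (A l) (mvr (fst E) (fst F) (B l) y) = y"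
  then show "bij_betw (mvr (fst F) (fst E) (A l)) (fibre E l) (fibre F l)"
    by (intro bij_betw_byWitness[where f' = "mvr (fst E) (fst F) (B l)"]) auto
qed

lemma same_rank_dsum:
  assumes "same_rank \<Lambda> E E'" "same_rank \<Lambda> F F'" shows "same_rank \<Lambda> (dsum E F) (dsum E' F')"
  unfolding same_rank_iff
proof
  fix l assume l: "l \<in> \<Lambda>"
  obtain A where A: "bij_betw (mvr (fst E') (fst E) A) (fibre E l) (fibre E' l)"
    using assms(1) l unfolding same_rank_iff by blast
  obtain B where B: "bij_betw (mvr (fst F') (fst F) B) (fibre F l) (fibre F' l)"
    using assms(2) l unfolding same_rank_iff by blast
  have inj_vcat: "u = u' \<and> v = v'" if "vcat N u v = vcat N u' v'" "\<And>i. N \<le> i \<Longrightarrow> u i = 0" "\<And>i. N \<le> i \<Longrightarrow> u' i = 0"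
    for N u v u' v'
  proof
    show "v = v'" using arg_cong[OF that(1), of "vshift N"] by simp
    show "u = u'"
    proof
      fix i show "u i = u' i"
        using fun_cong[OF that(1), of i] that(2,3)[of i] by (cases "i < N") (auto simp: vcat_def)
    qed
  qed
  have "bij_betw (mvr (fst (dsum E' F')) (fst (dsum E F)) (mblock (fst E') (fst E) A B)) (fibre (dsum E F) l) (fibre (dsum E' F') l)"
    unfolding bij_betw_def
  proof
    show "inj_on (mvr (fst (dsum E' F')) (fst (dsum E F)) (mblock (fst E') (fst E) A B)) (fibre (dsum E F) l)"
    proof (rule inj_onI)
      fix x y assume x: "x \<in> fibre (dsum E F) l" and y: "y \<in> fibre (dsum E F) l"
        and xy: "mvr (fst (dsum E' F')) (fst (dsum E F)) (mblock (fst E') (fst E) A B) x =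
           mvr (fst (dsum E' F')) (fst (dsum E F)) (mblock (fst E') (fst E) A B) y"
      obtain u v where u: "u \<in> fibre E l" "v \<in> fibre F l" "x = vcat (fst E) u v" using x by (auto simp: fibre_dsum)
      obtain u' v' where u': "u' \<in> fibre E l" "v' \<in> fibre F l" "y = vcat (fst E) u' v'" using y by (auto simp: fibre_dsum)
      have "mvr (fst E') (fst E) A u = mvr (fst E') (fst E) A u' \<and> mvr (fst F') (fst F) B v = mvr (fst F') (fst F) B v'"
        by (rule inj_vcat[of "fst E'"]) (use xy u u' in \<open>simp_all add: dsum_eq(1) mvr_mblock mvr_support\<close>)
      then have "u = u'" "v = v'"
        using inj_onD[OF bij_betw_imp_inj_on[OF A] _ u(1) u'(1)] inj_onD[OF bij_betw_imp_inj_on[OF B] _ u(2) u'(2)] by auto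
      then show "x = y" using u u' by simp
    qed
    have "mvr (fst (dsum E' F')) (fst (dsum E F)) (mblock (fst E') (fst E) A B) (vcat (fst E) u v)
       = vcat (fst E') (mvr (fst E') (fst E) A u) (mvr (fst F') (fst F) B v)" for u v
      by (simp add: dsum_eq(1) mvr_mblock)
    moreover have "fibre E' l = mvr (fst E') (fst E) A ` fibre E l" "fibre F' l = mvr (fst F') (fst F) B ` fibre F l"
      using A B by (auto simp: bij_betw_def)
    ultimately show "mvr (fst (dsum E' F')) (fst (dsum E F)) (mblock (fst E') (fst E) A B) ` fibre (dsum E F) l = fibre (dsum E' F') l"
      by (simp add: fibre_dsum_image image_image, auto simp: image_iff, blast+)
  qed
  then show "\<exists>A. bij_betw (mvr (fst (dsum E' F')) (fst (dsum E F)) A) (fibre (dsum E F) l) (fibre (dsum E' F') l)" by blast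
qed

section \<open>Projection bundles of square real matrices\<close>

lemma idx_enum_bij: "bij_betw (idx_enum :: nat \<Rightarrow> 'd::finite) {..<CARD('d)} UNIV"
proof -
  have "\<exists>g. bij_betw g {..<CARD('d)} (UNIV :: 'd set)"
    using ex_bij_betw_nat_finite[of "UNIV :: 'd set"] by (auto simp: atLeast0LessThan)
  then show ?thesis unfolding idx_enum_def by (rule someI_ex)
qed

lemma sum_idx_enum: "(\<Sum>j<CARD('d). f (idx_enum j :: 'd::finite)) = (\<Sum>c\<in>UNIV. f c)"
  by (rule sum.reindex_bij_betw[OF idx_enum_bij])

lemma idx_enum_surj: "\<exists>i<CARD('d). idx_enum i = (c :: 'd::finite)"
  using bij_betw_imp_surj_on[OF idx_enum_bij[where 'd = 'd]] by (metis UNIV_I imageE lessThan_iff)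

text \<open>The maps \<open>rv\<close>, \<open>unrv\<close> and \<open>mtx\<close> translate between \<open>real^'d\<close> and the index range \<open>{..<CARD('d)}\<close> of the bundle encoding.\<close>

definition rv :: "real^'d \<Rightarrow> rvec" where
  "rv v = (\<lambda>i. if i < CARD('d) then v $ idx_enum i else 0)"

definition unrv :: "rvec \<Rightarrow> real^'d" where
  "unrv x = (\<chi> c. x (inv_into {..<CARD('d)} idx_enum c))"

definition mtx :: "real^'d^'d \<Rightarrow> rmat" where
  "mtx A = (\<lambda>i j. if i < CARD('d) \<and> j < CARD('d) then A $ idx_enum i $ idx_enum j else 0)"

definition mat_bundle :: "('a \<Rightarrow> real^'d^'d) \<Rightarrow> 'a vbundle" where
  "mat_bundle P = (CARD('d), \<lambda>l. mtx (P l))"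

lemma IM_bundle_eq: "IM_bundle P \<kappa> = mat_bundle (\<lambda>l. P l \<kappa>)"
  by (simp add: IM_bundle_def mat_bundle_def mtx_def)

lemma fst_mat_bundle [simp]: "fst (mat_bundle (P :: 'a \<Rightarrow> real^'d^'d)) = CARD('d)"
  by (simp add: mat_bundle_def)

lemma unrv_rv [simp]: "unrv (rv v) = (v :: real^'d)"
proof -
  have "inv_into {..<CARD('d)} idx_enum c < CARD('d)" "idx_enum (inv_into {..<CARD('d)} idx_enum c) = c" for c :: 'd
    using bij_betw_imp_surj_on[OF idx_enum_bij[where 'd = 'd]] inv_into_into[of c idx_enum "{..<CARD('d)}"]
      f_inv_into_f[of c idx_enum "{..<CARD('d)}"] by auto
  then show ?thesis by (simp add: unrv_def rv_def vec_eq_iff)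
qed

lemma rv_inj [simp]: "rv v = rv w \<longleftrightarrow> v = w"
  by (metis unrv_rv)

lemma rv_unrv: "rv (unrv x :: real^'d) = x" if "\<And>i. CARD('d) \<le> i \<Longrightarrow> x i = 0"
proof
  fix i
  have "inv_into {..<CARD('d)} (idx_enum :: nat \<Rightarrow> 'd) (idx_enum i) = i" if "i < CARD('d)"
    using that by (intro inv_into_f_f bij_betw_imp_inj_on[OF idx_enum_bij]) auto
  then show "rv (unrv x :: real^'d) i = x i"
    using that[of i] by (auto simp: rv_def unrv_def)
qed

lemma unrv_component: "i < CARD('d) \<Longrightarrow> (unrv x :: real^'d) $ idx_enum i = x i"
  using inv_into_f_f[OF bij_betw_imp_inj_on[OF idx_enum_bij[where 'd = 'd]], of i] by (simp add: unrv_def)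

lemma mvr_mtx: "mvr CARD('d) CARD('d) (mtx A) x = rv (A *v (unrv x :: real^'d))"
proof
  fix i
  have "(\<Sum>j<CARD('d). A $ idx_enum i $ idx_enum j * x j) =
      (\<Sum>j<CARD('d). A $ idx_enum i $ idx_enum j * (unrv x :: real^'d) $ idx_enum j)"
    by (intro sum.cong refl) (simp add: unrv_component)
  also have "\<dots> = (A *v unrv x) $ idx_enum i"
    using sum_idx_enum[of "\<lambda>c. A $ idx_enum i $ c * unrv x $ c"] by (simp add: matrix_vector_mult_def)
  finally show "mvr CARD('d) CARD('d) (mtx A) x i = rv (A *v unrv x) i"
    by (auto simp: mvr_def mtx_def rv_def)
qed

lemma fibre_mat_bundle: "fibre (mat_bundle P) l = rv ` range (\<lambda>v :: real^'d. P l *v v)"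
proof -
  have "range (mvr CARD('d) CARD('d) (mtx (P l))) = rv ` range (\<lambda>v :: real^'d. P l *v v)"
    unfolding mvr_mtx image_image by (metis (no_types, lifting) image_cong range_composition surjI unrv_rv)
  then show ?thesis by (simp add: fibre_def mat_bundle_def)
qed

lemma fibre_mat_bundle_iff:
  assumes "P l ** P l = P l"
  shows "x \<in> fibre (mat_bundle P) l \<longleftrightarrow> (\<exists>v :: real^'d. x = rv v \<and> P l *v v = v)"
  unfolding fibre_mat_bundle using assms by (auto simp: matrix_vector_mul_assoc image_iff) (metis)

lemma continuous_on_mtx:
  assumes "continuous_on \<Lambda> P" shows "continuous_on \<Lambda> (\<lambda>l. mtx (P l :: real^'d^'d) i j)"
  by (cases "i < CARD('d) \<and> j < CARD('d)")
    (auto simp: mtx_def intro!: continuous_on_component assms)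

lemma is_vbundle_mat_bundle:
  fixes P :: "'a::topological_space \<Rightarrow> real^'d^'d"
  assumes "continuous_on \<Lambda> P" and idem: "\<And>l. l \<in> \<Lambda> \<Longrightarrow> P l ** P l = P l"
  shows "is_vbundle \<Lambda> (mat_bundle P)"
  unfolding mat_bundle_def
proof (rule is_vbundleI)
  show "continuous_on \<Lambda> (\<lambda>l. mtx (P l) i j)" for i j by (rule continuous_on_mtx[OF assms(1)])
  fix l i j assume l: "l \<in> \<Lambda>" and ij: "i < CARD('d)" "j < CARD('d)"
  have "(\<Sum>k<CARD('d). mtx (P l) i k * mtx (P l) k j) = (\<Sum>k<CARD('d). P l $ idx_enum i $ idx_enum k * P l $ idx_enum k $ idx_enum j)"
    using ij by (intro sum.cong) (auto simp: mtx_def)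
  also have "\<dots> = (P l ** P l) $ idx_enum i $ idx_enum j"
    using sum_idx_enum[of "\<lambda>c. P l $ idx_enum i $ c * P l $ c $ idx_enum j"] by (simp add: matrix_matrix_mult_def)
  finally show "(\<Sum>k<CARD('d). mtx (P l) i k * mtx (P l) k j) = mtx (P l) i j"
    using ij idem[OF l] by (simp add: mtx_def)
qed (auto simp: mtx_def)

text \<open>\<open>A\<close> adds the two components and \<open>B\<close> stacks \<open>P\<close> on
  top of \<open>1 - P\<close>, which splits a vector into its range and kernel parts.\<close>

lemma bundle_iso_range_kernel:
  fixes P :: "'a::topological_space \<Rightarrow> real^'d^'d"
  assumes "continuous_on \<Lambda> P" and idem: "\<And>l. l \<in> \<Lambda> \<Longrightarrow> P l ** P l = P l"
  shows "bundle_iso \<Lambda> (dsum (mat_bundle P) (mat_bundle (\<lambda>l. mat 1 - P l))) (triv CARD('d))"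
proof -
  let ?d = "CARD('d)"
  define A :: rmat where "A i j = (if j = i \<or> j = ?d + i then 1 else 0)" for i j
  define B where "B l i j = (if i < ?d then mtx (P l) i j else mtx (mat 1 - P l) (i - ?d) j)" for l i j
  have f: "x \<in> fibre (mat_bundle P) l \<Longrightarrow> \<exists>v :: real^'d. x = rv v \<and> P l *v v = v" if "l \<in> \<Lambda>" for x l
    by (simp add: fibre_mat_bundle_iff idem[OF that])
  have idem': "(mat 1 - P l) ** (mat 1 - P l) = mat 1 - P l" if "l \<in> \<Lambda>" for l
    using idem[OF that] by (simp add: matrix_eq matrix_vector_mul_assoc[symmetric] matrix_vector_mult_diff_rdistrib
        matrix_vector_mult_diff_distrib)
  have g: "x \<in> fibre (mat_bundle (\<lambda>l. mat 1 - P l)) l \<Longrightarrow> \<exists>v :: real^'d. x = rv v \<and> P l *v v = 0" if "l \<in> \<Lambda>" for x l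
    unfolding fibre_mat_bundle_iff[of "\<lambda>l. mat 1 - P l", OF idem'[OF that]]
    by (simp add: matrix_vector_mult_diff_rdistrib)
  have A: "mvr ?d (?d + ?d) A (vcat ?d (rv u) (rv v)) = rv (u + v)" for u v :: "real^'d"
  proof
    fix i
    show "mvr ?d (?d + ?d) A (vcat ?d (rv u) (rv v)) i = rv (u + v) i"
      unfolding mvr_def sum_lessThan_add
      by (auto simp: A_def vcat_def rv_def if_distrib[of "\<lambda>a. a * _"] cong: if_cong)
  qed
  have B: "mvr (?d + ?d) ?d (B l) x = vcat ?d (rv (P l *v unrv x)) (rv ((mat 1 - P l) *v unrv x))" for x l
  proof
    fix i
    have "i - ?d < ?d" if "?d \<le> i" "i < ?d + ?d" using that by linarith
    then show "mvr (?d + ?d) ?d (B l) x i = vcat ?d (rv (P l *v unrv x)) (rv ((mat 1 - P l) *v unrv x)) i"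
      unfolding mvr_mtx[symmetric] by (auto simp: mvr_def B_def vcat_def)
  qed
  show ?thesis
  proof (rule bundle_isoI[where A = "\<lambda>_. A" and B = B])
    show "continuous_on \<Lambda> (\<lambda>l. B l i j)" for i j
      unfolding B_def by (cases "i < ?d") (auto intro!: continuous_on_mtx continuous_intros assms(1))
  next
    fix l x assume l: "l \<in> \<Lambda>" and "x \<in> fibre (dsum (mat_bundle P) (mat_bundle (\<lambda>l. mat 1 - P l))) l"
    then obtain u v where x: "x = vcat ?d (rv u) (rv v)" and uv: "P l *v u = u" "P l *v v = 0"
      by (elim fibre_dsumE) (use f[OF l] g[OF l] in force)
    show "mvr (fst (triv ?d)) (fst (dsum (mat_bundle P) (mat_bundle (\<lambda>l. mat 1 - P l)))) A x \<in> fibre (triv ?d) l"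
      by (auto simp: dsum_eq(1) triv_def fibre_triv[unfolded triv_def] mvr_support)
    show "mvr (fst (dsum (mat_bundle P) (mat_bundle (\<lambda>l. mat 1 - P l)))) (fst (triv ?d)) (B l)
        (mvr (fst (triv ?d)) (fst (dsum (mat_bundle P) (mat_bundle (\<lambda>l. mat 1 - P l)))) A x) = x"
      using uv by (simp add: dsum_eq(1) triv_def x A B matrix_vector_right_distrib matrix_vector_mult_diff_rdistrib)
  next
    fix l y assume l: "l \<in> \<Lambda>" and y: "y \<in> fibre (triv ?d) l"
    show "mvr (fst (dsum (mat_bundle P) (mat_bundle (\<lambda>l. mat 1 - P l)))) (fst (triv ?d)) (B l) y
        \<in> fibre (dsum (mat_bundle P) (mat_bundle (\<lambda>l. mat 1 - P l))) l"
      by (simp add: dsum_eq(1) triv_def B) (rule vcat_in_fibre; simp add: fibre_mat_bundle)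
    have "rv (unrv y :: real^'d) = y" using y by (intro rv_unrv) (simp add: fibre_triv)
    then show "mvr (fst (triv ?d)) (fst (dsum (mat_bundle P) (mat_bundle (\<lambda>l. mat 1 - P l)))) A
       (mvr (fst (dsum (mat_bundle P) (mat_bundle (\<lambda>l. mat 1 - P l)))) (fst (triv ?d)) (B l) y) = y"
      by (simp add: dsum_eq(1) triv_def A B matrix_vector_mult_diff_rdistrib)
  qed auto
qed

section \<open>Continuity of inverses and isomorphisms from fibrewise bijections\<close>

lemma continuous_on_det:
  fixes A :: "'a::topological_space \<Rightarrow> real^'d^'d"
  assumes "\<And>i j. continuous_on \<Lambda> (\<lambda>l. A l $ i $ j)" shows "continuous_on \<Lambda> (\<lambda>l. det (A l))"
  unfolding det_def by (intro continuous_intros assms)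

lemma matrix_inv_eq:
  assumes "invertible (A :: real^'d^'d)"
  shows "matrix_inv A ** A = mat 1" "A ** matrix_inv A = mat 1"
proof -
  have "A ** matrix_inv A = mat 1 \<and> matrix_inv A ** A = mat 1"
    unfolding matrix_inv_def using assms unfolding invertible_def by (rule someI_ex)
  then show "matrix_inv A ** A = mat 1" "A ** matrix_inv A = mat 1" by auto
qed

text \<open>Cramer's rule writes each entry of the inverse as a quotient of determinants, which are
  polynomials in the entries.\<close>

lemma continuous_on_matrix_inv:
  fixes A :: "'a::topological_space \<Rightarrow> real^'d^'d"
  assumes A: "continuous_on \<Lambda> A" and inv: "\<And>l. l \<in> \<Lambda> \<Longrightarrow> invertible (A l)"
  shows "continuous_on \<Lambda> (\<lambda>l. matrix_inv (A l))"
proof -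
  have comp: "continuous_on \<Lambda> (\<lambda>l. A l $ i $ j)" for i j
    by (intro continuous_on_component A)
  have det: "det (A l) \<noteq> 0" if "l \<in> \<Lambda>" for l using inv[OF that] by (simp add: invertible_det_nz)
  have eq: "matrix_inv (A l) $ k $ m = det (\<chi> i j. if j = k then axis m 1 $ i else A l $ i $ j) / det (A l)"
    if "l \<in> \<Lambda>" for l k m
  proof -
    have "A l *v (matrix_inv (A l) *v axis m 1) = axis m 1"
      using matrix_inv_eq(2)[OF inv[OF that]] by (simp add: matrix_vector_mul_assoc)
    then have "matrix_inv (A l) *v axis m 1 = (\<chi> k. det (\<chi> i j. if j = k then axis m 1 $ i else A l $ i $ j) / det (A l))"
      using cramer[OF det[OF that]] by blast
    moreover have "(matrix_inv (A l) *v axis m 1) $ k = matrix_inv (A l) $ k $ m"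
      by (simp add: matrix_vector_mult_basis column_def)
    ultimately show ?thesis by simp
  qed
  have cram: "continuous_on \<Lambda> (\<lambda>l. det (\<chi> i j. if j = k then axis m 1 $ i else A l $ i $ j) / det (A l))" for k m
  proof (rule continuous_on_divide[OF continuous_on_det continuous_on_det[OF comp]])
    show "continuous_on \<Lambda> (\<lambda>l. (\<chi> i j. if j = k then axis m 1 $ i else A l $ i $ j) $ i $ j)" for i j
      by (cases "j = k") (auto intro!: continuous_intros comp)
  qed (use det in auto)
  have "continuous_on \<Lambda> (\<lambda>l. matrix_inv (A l) $ k $ m)" for k m
    by (rule continuous_on_eq[OF cram[of k m]]) (simp add: eq)
  then have "continuous_on \<Lambda> (\<lambda>l. \<chi> k m. matrix_inv (A l) $ k $ m)"
    by (intro continuous_on_vec_lambda)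
  then show ?thesis by simp
qed

lemma continuous_on_matrix_mult:
  fixes A B :: "'a::topological_space \<Rightarrow> real^'d^'d"
  assumes "continuous_on \<Lambda> A" "continuous_on \<Lambda> B" shows "continuous_on \<Lambda> (\<lambda>l. A l ** B l)"
  unfolding matrix_matrix_mult_def
  by (intro continuous_on_vec_lambda continuous_intros continuous_on_component assms)

lemma continuous_on_transpose:
  fixes A :: "'a::topological_space \<Rightarrow> real^'d^'d"
  assumes "continuous_on \<Lambda> A" shows "continuous_on \<Lambda> (\<lambda>l. transpose (A l))"
  unfolding transpose_def
  by (intro continuous_on_vec_lambda continuous_intros continuous_on_component assms)

text \<open>The Gram matrix (T P)^T (T P) + (1 - P)^T (1 - P) is invertible, and its inverse
  composed with (T P)^T inverts T on the range of P; this makes the inverse continuous in the parameter.\<close>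

lemma bundle_iso_of_bij:
  fixes P Q T :: "'a::topological_space \<Rightarrow> real^'d^'d"
  assumes cont: "continuous_on \<Lambda> P" "continuous_on \<Lambda> T"
    and idem: "\<And>l. l \<in> \<Lambda> \<Longrightarrow> P l ** P l = P l" "\<And>l. l \<in> \<Lambda> \<Longrightarrow> Q l ** Q l = Q l"
    and bij: "\<And>l. l \<in> \<Lambda> \<Longrightarrow> bij_betw (\<lambda>x. T l *v x) {x. P l *v x = x} {x. Q l *v x = x}"
  shows "bundle_iso \<Lambda> (mat_bundle P) (mat_bundle Q)"
proof -
  let ?d = "CARD('d)"
  define M where "M l = transpose (T l ** P l) ** (T l ** P l) + transpose (mat 1 - P l) ** (mat 1 - P l)" for l
  define S where "S l = matrix_inv (M l) ** transpose (T l ** P l)" for l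
  have PP: "P l *v (P l *v x) = P l *v x" if "l \<in> \<Lambda>" for l x
    using idem(1)[OF that] by (simp add: matrix_vector_mul_assoc)
  have Mx: "M l *v x = transpose (T l ** P l) *v (T l *v (P l *v x)) + transpose (mat 1 - P l) *v (x - P l *v x)" for l x
    unfolding M_def matrix_vector_mult_add_rdistrib matrix_vector_mul_assoc[symmetric]
      matrix_vector_mult_diff_rdistrib matrix_vector_mul_lid by (rule refl)
  have invM: "invertible (M l)" if l: "l \<in> \<Lambda>" for l
  proof -
    have "x = 0" if x: "M l *v x = 0" for x
    proof -
      have sq: "x \<bullet> (transpose A *v y) = (A *v x) \<bullet> y" for A :: "real^'d^'d" and y
        by (simp add: inner_commute[of x] dot_lmul_matrix) (simp add: inner_commute)
      \<comment> \<open>The quadratic form of \<open>M l\<close> is a sum of two squares: if it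
        vanishes at \<open>x\<close>, then \<open>x\<close> lies in the range of \<open>P l\<close>
        and is mapped to 0 by \<open>T l\<close>, which is injective there.\<close>
      have "(norm (T l *v (P l *v x)))\<^sup>2 + (norm (x - P l *v x))\<^sup>2 = x \<bullet> (M l *v x)"
        unfolding Mx inner_add_right sq matrix_vector_mul_assoc[symmetric] matrix_vector_mult_diff_rdistrib
        by (simp add: power2_norm_eq_inner)
      also have "\<dots> = 0" using x by simp
      finally have "norm (T l *v (P l *v x)) = 0 \<and> norm (x - P l *v x) = 0"
        unfolding sum_power2_eq_zero_iff .
      then have *: "T l *v (P l *v x) = 0" "P l *v x = x"
        unfolding norm_eq_zero right_minus_eq by auto
      from *(1) have "T l *v x = T l *v 0" unfolding *(2) by simp
      moreover have "x \<in> {x. P l *v x = x}" "0 \<in> {x. P l *v x = x}" using *(2) by simp_all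
      ultimately show "x = 0" by (rule inj_onD[OF bij_betw_imp_inj_on[OF bij[OF l]]])
    qed
    then have "\<exists>B. B ** M l = mat 1"
      using matrix_left_invertible_ker[of "M l"] by blast
    then show ?thesis by (simp add: invertible_left_inverse)
  qed
  have ST: "S l *v (T l *v x) = x" if l: "l \<in> \<Lambda>" and x: "P l *v x = x" for l x
  proof -
    have "transpose (T l ** P l) *v (T l *v x) = M l *v x" unfolding Mx x by simp
    then have "S l *v (T l *v x) = matrix_inv (M l) *v (M l *v x)"
      unfolding S_def matrix_vector_mul_assoc[symmetric] by simp
    also have "\<dots> = x" using matrix_inv_eq(1)[OF invM[OF l]] by (simp add: matrix_vector_mul_assoc)
    finally show ?thesis .
  qed
  have contS: "continuous_on \<Lambda> S"
    unfolding S_def M_def[abs_def]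
    by (intro continuous_on_matrix_mult continuous_on_matrix_inv continuous_on_add continuous_on_transpose
        continuous_intros cont) (use invM in \<open>simp add: M_def\<close>)
  have TQ: "Q l *v (T l *v x) = T l *v x" if "l \<in> \<Lambda>" "P l *v x = x" for l x
    using bij[OF that(1)] that(2) by (auto simp: bij_betw_def)
  have ex: "\<exists>x. P l *v x = x \<and> y = T l *v x" if "l \<in> \<Lambda>" "Q l *v y = y" for l y
    using bij[OF that(1)] that(2) by (auto simp: bij_betw_def image_iff set_eq_iff)
  note fP = fibre_mat_bundle_iff[of P, OF idem(1)] and fQ = fibre_mat_bundle_iff[of Q, OF idem(2)]
  show ?thesis
  proof (rule bundle_isoI[where A = "\<lambda>l. mtx (T l)" and B = "\<lambda>l. mtx (S l)"])
    fix l y assume l: "l \<in> \<Lambda>" and "y \<in> fibre (mat_bundle Q) l"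
    then obtain v where v: "y = rv v" "Q l *v v = v" by (auto simp: fQ)
    obtain x where x: "P l *v x = x" "v = T l *v x" using ex[OF l v(2)] by blast
    have Sv: "S l *v v = x" using ST[OF l x(1)] x(2) by simp
    show "mvr (fst (mat_bundle P)) (fst (mat_bundle Q)) (mtx (S l)) y \<in> fibre (mat_bundle P) l"
      using x Sv v by (auto simp: fP[OF l] mvr_mtx)
    show "mvr (fst (mat_bundle Q)) (fst (mat_bundle P)) (mtx (T l)) (mvr (fst (mat_bundle P)) (fst (mat_bundle Q)) (mtx (S l)) y) = y"
      using x Sv v by (simp add: mvr_mtx)
  next
    fix l x assume l: "l \<in> \<Lambda>" and "x \<in> fibre (mat_bundle P) l"
    then obtain v where v: "x = rv v" "P l *v v = v" by (auto simp: fP)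
    show "mvr (fst (mat_bundle Q)) (fst (mat_bundle P)) (mtx (T l)) x \<in> fibre (mat_bundle Q) l"
      using TQ[OF l v(2)] v by (auto simp: fQ[OF l] mvr_mtx)
    show "mvr (fst (mat_bundle P)) (fst (mat_bundle Q)) (mtx (S l)) (mvr (fst (mat_bundle Q)) (fst (mat_bundle P)) (mtx (T l)) x) = x"
      using ST[OF l v(2)] v by (simp add: mvr_mtx)
  qed (auto intro!: continuous_on_mtx contS cont)
qed

section \<open>Ranks of idempotent families\<close>

lemma subspace_range_matrix: "subspace (range (\<lambda>x. A *v x))" for A :: "real^'d^'d"
  by (rule linear_subspace_image[OF matrix_vector_mul_linear subspace_UNIV])

text \<open>The bijection has to be given by a matrix: the rows of \<open>A\<close> are an
  orthonormal basis of the range, so applying \<open>A\<close> takes coordinates and the inverse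
  forms linear combinations.\<close>

lemma same_rank_mat_bundle:
  fixes P :: "'a::topological_space \<Rightarrow> real^'d^'d"
  assumes "\<And>l. l \<in> \<Lambda> \<Longrightarrow> rank (P l) = r"
  shows "same_rank \<Lambda> (mat_bundle P) (triv r)"
  unfolding same_rank_iff
proof
  let ?d = "CARD('d)"
  fix l assume l: "l \<in> \<Lambda>"
  let ?V = "range (\<lambda>x. P l *v x)"
  obtain B where B: "B \<subseteq> ?V" "pairwise orthogonal B" "\<And>x. x \<in> B \<Longrightarrow> norm x = 1" "independent B" "card B = dim ?V" "span B = ?V"
    using orthonormal_basis_subspace[OF subspace_range_matrix] by blast
  have "finite B" using B(4) by (rule finiteI_independent)
  then obtain b where "bij_betw b {0..<card B} B" using ex_bij_betw_nat_finite by blast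
  then have b: "bij_betw b {..<r} B"
    using B(5) assms[OF l] by (simp add: rank_dim_range atLeast0LessThan)
  have bb: "b i \<bullet> b j = (if i = j then 1 else 0)" if "i < r" "j < r" for i j
  proof (cases "i = j")
    case True
    then show ?thesis using B(3)[of "b j"] b that by (auto simp: bij_betw_def norm_eq_1)
  next
    case False
    then have "b i \<noteq> b j" using b that by (auto simp: bij_betw_def inj_on_def)
    then show ?thesis using B(2) b that False by (auto simp: pairwise_def orthogonal_def bij_betw_def)
  qed
  define A where "A i j = (b i $ idx_enum j :: real)" for i j
  have A: "mvr r ?d A (rv v) = (\<lambda>i. if i < r then b i \<bullet> v else 0)" for v
  proof
    fix i
    have "(\<Sum>j<?d. A i j * rv v j) = (\<Sum>j<?d. b i $ idx_enum j * v $ idx_enum j)"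
      by (intro sum.cong) (auto simp: A_def rv_def)
    also have "\<dots> = b i \<bullet> v"
      using sum_idx_enum[of "\<lambda>c. b i $ c * v $ c"] by (simp add: inner_vec_def)
    finally show "mvr r ?d A (rv v) i = (if i < r then b i \<bullet> v else 0)" by (simp add: mvr_def)
  qed
  have orth: "b i \<bullet> (\<Sum>j<r. y j *\<^sub>R b j) = y i" if "i < r" for y i
  proof -
    have "b i \<bullet> (\<Sum>j<r. y j *\<^sub>R b j) = (\<Sum>j<r. if i = j then y j else 0)"
      unfolding inner_sum_right using that by (intro sum.cong) (auto simp: bb)
    then show ?thesis using that by simp
  qed
  have inB: "b j \<in> span B" if "j < r" for j using b that by (auto simp: bij_betw_def intro: span_base)
  have expand: "v = (\<Sum>j<r. (b j \<bullet> v) *\<^sub>R b j)" if v: "v \<in> ?V" for v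
  proof -
    have "v - (\<Sum>j<r. (b j \<bullet> v) *\<^sub>R b j) \<in> span B"
      using v B(6) inB by (intro span_diff span_sum span_scale) auto
    moreover have "orthogonal (v - (\<Sum>j<r. (b j \<bullet> v) *\<^sub>R b j)) w" if "w \<in> B" for w
    proof -
      have "w \<in> b ` {..<r}" using b that by (simp add: bij_betw_def)
      then obtain i where i: "i < r" "w = b i" by auto
      show ?thesis using orth[OF i(1), of "\<lambda>j. b j \<bullet> v"] i
        by (simp add: orthogonal_def inner_diff_left inner_commute inner_diff_right)
    qed
    ultimately have "orthogonal (v - (\<Sum>j<r. (b j \<bullet> v) *\<^sub>R b j)) (v - (\<Sum>j<r. (b j \<bullet> v) *\<^sub>R b j))"
      using orthogonal_to_span by blast
    then show ?thesis by (simp add: orthogonal_self)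
  qed
  have "bij_betw (mvr r ?d A) (rv ` ?V) {x. \<forall>i\<ge>r. x i = 0}"
  proof (rule bij_betw_byWitness[where f' = "\<lambda>y. rv (\<Sum>j<r. y j *\<^sub>R b j)"])
    show "\<forall>a\<in>rv ` ?V. rv (\<Sum>j<r. mvr r ?d A a j *\<^sub>R b j) = a"
      using expand by (auto simp: A)
    show "\<forall>a'\<in>{x. \<forall>i\<ge>r. x i = 0}. mvr r ?d A (rv (\<Sum>j<r. a' j *\<^sub>R b j)) = a'"
      by (auto simp: A orth intro!: ext)
    show "mvr r ?d A ` rv ` ?V \<subseteq> {x. \<forall>i\<ge>r. x i = 0}" by (auto simp: mvr_support)
    show "(\<lambda>y. rv (\<Sum>j<r. y j *\<^sub>R b j)) ` {x. \<forall>i\<ge>r. x i = 0} \<subseteq> rv ` ?V"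
    proof -
      have "(\<Sum>j<r. y j *\<^sub>R b j) \<in> ?V" for y
        unfolding B(6)[symmetric] using inB by (intro span_sum span_scale) auto
      then show ?thesis by blast
    qed
  qed
  then show "\<exists>A. bij_betw (mvr (fst (triv r)) (fst (mat_bundle P)) A) (fibre (mat_bundle P) l) (fibre (triv r) l)"
    by (intro exI[of _ A]) (simp add: fibre_mat_bundle fibre_triv[unfolded triv_def] triv_def)
qed

lemma rank_eq_dim_fixed:
  fixes P :: "real^'d^'d" assumes "P ** P = P" shows "rank P = dim {x. P *v x = x}"
proof -
  have "range (\<lambda>x. P *v x) = {x. P *v x = x}"
    using assms by (auto simp: matrix_vector_mul_assoc image_iff) metis
  then show ?thesis by (simp add: rank_dim_range)
qed

text \<open>If \<open>Q\<close> identifies two vectors in the range of \<open>P\<close>, their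
  difference is fixed by \<open>P - Q\<close>, which has norm below 1; so \<open>Q\<close> is
  injective on that range.\<close>

lemma rank_close_le:
  fixes P Q :: "real^'d^'d"
  assumes "P ** P = P" "norm (P - Q) < 1"
  shows "rank P \<le> rank Q"
proof -
  let ?V = "range (\<lambda>x. P *v x)"
  have "inj_on (\<lambda>x. Q *v x) ?V"
  proof (rule inj_onI)
    fix x y assume "x \<in> ?V" "y \<in> ?V" and xy: "Q *v x = Q *v y"
    then have P: "P *v (x - y) = x - y"
      using assms(1) by (auto simp: matrix_vector_mult_diff_distrib matrix_vector_mul_assoc)
    have "norm (x - y) = norm ((P - Q) *v (x - y))"
      using P xy by (simp add: matrix_vector_mult_diff_rdistrib matrix_vector_mult_diff_distrib)
    also have "\<dots> \<le> norm (P - Q) * norm (x - y)" by (rule norm_matrix_vector_mult_le)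
    finally show "x = y" using assms(2) mult_less_cancel_right2[of "norm (P - Q)" "norm (x - y)"]
      by (cases "x = y") auto
  qed
  then have "dim ((\<lambda>x. Q *v x) ` ?V) = dim ?V"
    by (intro dim_image_eq matrix_vector_mul_linear) (simp add: subspace_range_matrix span_eq_iff[THEN iffD2])
  moreover have "dim ((\<lambda>x. Q *v x) ` ?V) \<le> dim (range (\<lambda>x. Q *v x))"
    by (rule dim_subset) auto
  ultimately show ?thesis by (simp add: rank_dim_range)
qed

lemma rank_constant:
  fixes P :: "'a::metric_space \<Rightarrow> real^'d^'d"
  assumes conn: "connected \<Lambda>" and cont: "continuous_on \<Lambda> P"
    and idem: "\<And>l. l \<in> \<Lambda> \<Longrightarrow> P l ** P l = P l" and ll: "l \<in> \<Lambda>" "l' \<in> \<Lambda>"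
  shows "rank (P l) = rank (P l')"
proof (rule connected_induction_simple[OF conn, where P = "\<lambda>x. rank (P l) = rank (P x)"])
  fix a assume a: "a \<in> \<Lambda>"
  from cont[unfolded continuous_on_iff, rule_format, OF a, of 1] obtain e where
    e: "e > 0" "\<And>x. x \<in> \<Lambda> \<Longrightarrow> dist x a < e \<Longrightarrow> dist (P x) (P a) < 1" by auto
  have "rank (P x) = rank (P a)" if "x \<in> ball a e \<inter> \<Lambda>" for x
    using rank_close_le[OF idem, of x "P a"] rank_close_le[OF idem[OF a], of "P x"] e(2)[of x] that
    by (auto simp: dist_norm norm_minus_commute dist_commute intro!: antisym)
  then have *: "rank (P x) = rank (P y)" if "x \<in> ball a e \<inter> \<Lambda>" "y \<in> ball a e \<inter> \<Lambda>" for x y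
    using that by metis
  show "\<exists>T. openin (top_of_set \<Lambda>) T \<and> a \<in> T \<and> (\<forall>x\<in>T. \<forall>y\<in>T. rank (P l) = rank (P x) \<longrightarrow> rank (P l) = rank (P y))"
  proof (intro exI[of _ "ball a e \<inter> \<Lambda>"] conjI ballI impI)
    show "openin (top_of_set \<Lambda>) (ball a e \<inter> \<Lambda>)" by (simp add: Int_commute openin_open_Int)
    show "a \<in> ball a e \<inter> \<Lambda>" using a e(1) by simp
    fix x y assume "x \<in> ball a e \<inter> \<Lambda>" "y \<in> ball a e \<inter> \<Lambda>" "rank (P l) = rank (P x)"
    then show "rank (P l) = rank (P y)" using *[of x y] by simp
  qed
qed (rule ll(1), rule ll(2), rule refl)

section \<open>From a fibre homotopy equivalence to equality in J\<close>

lemma dsum_triv_0: "dsum (mat_bundle R) (triv 0) = mat_bundle R"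
  by (auto simp: dsum_def triv_def mat_bundle_def mtx_def intro!: ext)

lemma fibre_homotopy_equiv_sym: "fibre_homotopy_equiv \<Lambda> E F \<Longrightarrow> fibre_homotopy_equiv \<Lambda> F E"
  unfolding fibre_homotopy_equiv_def Let_def by blast

lemma idem_complement: "P ** P = P \<Longrightarrow> (mat 1 - P) ** (mat 1 - P) = mat 1 - P" for P :: "real^'d^'d"
  by (simp add: matrix_eq matrix_vector_mul_assoc[symmetric] matrix_vector_mult_diff_rdistrib
      matrix_vector_mult_diff_distrib)

text \<open>In \<open>KO\<close>, \<open>[im P] - [im R] = - [ker P] - [im R] + [\<Theta>]\<close>, and \<open>[ker P] = [ker P']\<close>, \<open>[im R] = [im R']\<close>.\<close>

lemma J_eq_if_fibre_homotopy_equiv: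
  fixes P P' R R' :: "'a::topological_space \<Rightarrow> real^'d^'d"
  assumes cont: "continuous_on \<Lambda> P" "continuous_on \<Lambda> P'" "continuous_on \<Lambda> R" "continuous_on \<Lambda> R'"
    and idem: "\<And>l. l \<in> \<Lambda> \<Longrightarrow> P l ** P l = P l" "\<And>l. l \<in> \<Lambda> \<Longrightarrow> P' l ** P' l = P' l"
      "\<And>l. l \<in> \<Lambda> \<Longrightarrow> R l ** R l = R l" "\<And>l. l \<in> \<Lambda> \<Longrightarrow> R' l ** R' l = R' l"
    and KP: "bundle_iso \<Lambda> (mat_bundle (\<lambda>l. mat 1 - P l)) (mat_bundle (\<lambda>l. mat 1 - P' l))"
    and KR: "bundle_iso \<Lambda> (mat_bundle (\<lambda>l. mat 1 - R' l)) (mat_bundle (\<lambda>l. mat 1 - R l))"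
    and rank: "\<And>l. l \<in> \<Lambda> \<Longrightarrow> rank (P l) = r" "\<And>l. l \<in> \<Lambda> \<Longrightarrow> rank (R l) = r"
      "\<And>l. l \<in> \<Lambda> \<Longrightarrow> rank (mat 1 - P' l) = r'" "\<And>l. l \<in> \<Lambda> \<Longrightarrow> rank (R' l) = r" "r' + r = CARD('d)"
    and fhe: "fibre_homotopy_equiv \<Lambda> (triv (k + CARD('d)))
       (dsum (dsum (triv k) (mat_bundle (\<lambda>l. mat 1 - P' l))) (mat_bundle R'))"
  shows "J_eq \<Lambda> (mat_bundle P) (mat_bundle R)"
proof -
  let ?d = "CARD('d)"
  let ?K = "\<lambda>P :: 'a \<Rightarrow> real^'d^'d. mat_bundle (\<lambda>l. mat 1 - P l)"
  let ?E = "triv (k + ?d) :: 'a vbundle" and ?F = "dsum (dsum (triv k) (?K P')) (mat_bundle R')"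
  have vbF: "is_vbundle \<Lambda> ?F"
    by (intro is_vbundle_dsum is_vbundle_triv is_vbundle_mat_bundle continuous_intros cont idem idem_complement)
  have rkF: "same_rank \<Lambda> ?F ?E"
  proof -
    have "same_rank \<Lambda> ?F (dsum (dsum (triv k) (triv r')) (triv r))"
      by (intro same_rank_dsum same_rank_mat_bundle rank bundle_iso_same_rank[OF bundle_iso_refl])
    moreover have "k + r' + r = k + ?d" using rank(5) by simp
    ultimately show ?thesis by (simp only: dsum_triv)
  qed
  have "dsum ?F (triv 0) = ?F" "dsum ?E (triv 0) = ?E"
    by (simp_all add: dsum_assoc dsum_triv_0 dsum_triv)
  then have "stably_fhe \<Lambda> ?F ?E"
    unfolding stably_fhe_def using fibre_homotopy_equiv_sym[OF fhe] by (intro exI[of _ 0]) simp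
  \<comment> \<open>The trivial bundle comes first in the pair while \<open>rkF\<close> compares
    ranks in the other direction, hence the inverse of a generator.\<close>
  then have ker: "(?E, ?F) \<in> J_kernel_reps \<Lambda>"
    using J_kernel_reps.inv[OF vbF is_vbundle_triv rkF] by blast
  note rk = bundle_iso_range_kernel
  have sum1: "bundle_iso \<Lambda> (dsum (mat_bundle R') (?K R)) (triv ?d)"
    by (rule bundle_iso_trans[OF bundle_iso_dsum[OF bundle_iso_refl bundle_iso_sym[OF KR]] rk[OF cont(4) idem(4)]])
  \<comment> \<open>Adding the kernel of \<open>R\<close> makes both sides of the required
    isomorphism trivial. On this side it completes \<open>R'\<close>, through the isomorphism of the
    kernels of \<open>R\<close> and \<open>R'\<close>, while the kernel of \<open>P'\<close>
    contained in \<open>?F\<close> completes \<open>P\<close>; on the other side it completes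
    \<open>R\<close>.\<close>
  have L: "bundle_iso \<Lambda> (dsum (dsum (dsum (mat_bundle P) (triv r)) ?F) (?K R)) (triv (?d + (?d + (r + k))))"
  proof -
    have "bundle_iso \<Lambda> (dsum (?K P') (dsum (mat_bundle R') (?K R))) (dsum (?K P) (triv ?d))"
      by (rule bundle_iso_dsum[OF bundle_iso_sym[OF KP] sum1])
    then have "bundle_iso \<Lambda> (dsum (triv (r + k)) (dsum (?K P') (dsum (mat_bundle R') (?K R)))) (dsum (triv (r + k)) (dsum (?K P) (triv ?d)))"
      by (rule bundle_iso_dsum[OF bundle_iso_refl])
    also have "bundle_iso \<Lambda> \<dots> (dsum (dsum (?K P) (triv ?d)) (triv (r + k)))"
      by (rule bundle_iso_dsum_commute)
    finally have "bundle_iso \<Lambda> (dsum (mat_bundle P) (dsum (triv (r + k)) (dsum (?K P') (dsum (mat_bundle R') (?K R)))))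
        (dsum (mat_bundle P) (dsum (dsum (?K P) (triv ?d)) (triv (r + k))))"
      by (rule bundle_iso_dsum[OF bundle_iso_refl])
    also have "dsum (mat_bundle P) (dsum (dsum (?K P) (triv ?d)) (triv (r + k)))
        = dsum (dsum (mat_bundle P) (?K P)) (triv (?d + (r + k)))"
      by (simp only: dsum_assoc dsum_triv)
    also have "bundle_iso \<Lambda> \<dots> (dsum (triv ?d) (triv (?d + (r + k))))"
      by (rule bundle_iso_dsum[OF rk[OF cont(1) idem(1)] bundle_iso_refl])
    finally show ?thesis by (simp only: dsum_assoc dsum_triv[symmetric])
  qed
  have R: "bundle_iso \<Lambda> (dsum (dsum ?E (dsum (mat_bundle R) (triv r))) (?K R)) (triv ((k + ?d) + (?d + r)))"
  proof -
    have "bundle_iso \<Lambda> (dsum (mat_bundle R) (dsum (triv r) (?K R))) (dsum (mat_bundle R) (dsum (?K R) (triv r)))"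
      by (rule bundle_iso_dsum[OF bundle_iso_refl bundle_iso_dsum_commute])
    also have "\<dots> = dsum (dsum (mat_bundle R) (?K R)) (triv r)" by (simp add: dsum_assoc)
    also have "bundle_iso \<Lambda> \<dots> (dsum (triv ?d) (triv r))"
      by (rule bundle_iso_dsum[OF rk[OF cont(3) idem(3)] bundle_iso_refl])
    finally have "bundle_iso \<Lambda> (dsum ?E (dsum (mat_bundle R) (dsum (triv r) (?K R)))) (dsum ?E (dsum (triv ?d) (triv r)))"
      by (rule bundle_iso_dsum[OF bundle_iso_refl])
    then show ?thesis by (simp only: dsum_assoc dsum_triv)
  qed
  have "(k + ?d) + (?d + r) = ?d + (?d + (r + k))" by simp
  with L R have "bundle_iso \<Lambda> (dsum (dsum (dsum (mat_bundle P) (triv r)) ?F) (?K R))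
      (dsum (dsum ?E (dsum (mat_bundle R) (triv r))) (?K R))"
    using bundle_iso_trans[OF L bundle_iso_sym] by simp
  then have "ko_eq \<Lambda> (dsum (mat_bundle P) (triv r), dsum (mat_bundle R) (triv r)) (?E, ?F)"
    unfolding ko_eq_def prod.case
    by (intro exI[of _ "?K R"] conjI is_vbundle_mat_bundle continuous_intros cont idem idem_complement)
  then show ?thesis
    unfolding J_eq_def using ker same_rank_mat_bundle[of \<Lambda> P, OF rank(1)] same_rank_mat_bundle[of \<Lambda> R, OF rank(2)] by blast
qed

subsection \<open>Truncated boundary value problems\<close>

text \<open>Take a finite subcover and the least of its radii. One number \<open>d\<close> plays
  both the radius of the neighbourhood and the quality of the estimate, so \<open>Q\<close> must
  survive shrinking it.\<close>

lemma compact_uniform: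
  fixes \<Lambda> :: "'a::metric_space set"
  assumes "compact \<Lambda>" and ex: "\<And>p. p \<in> \<Lambda> \<Longrightarrow> \<exists>d>0. \<forall>q\<in>\<Lambda>. dist q p < d \<longrightarrow> Q q d"
    and mono: "\<And>q d d'. Q q d \<Longrightarrow> 0 < d' \<Longrightarrow> d' \<le> d \<Longrightarrow> Q q d'"
  shows "\<exists>d>0::real. \<forall>q\<in>\<Lambda>. Q q d"
proof -
  obtain d where d: "\<And>p. p \<in> \<Lambda> \<Longrightarrow> d p > 0" "\<And>p q. p \<in> \<Lambda> \<Longrightarrow> q \<in> \<Lambda> \<Longrightarrow> dist q p < d p \<Longrightarrow> Q q (d p)"
    using ex by metis
  have "\<Lambda> \<subseteq> (\<Union>p\<in>\<Lambda>. ball p (d p))" using d(1) by fastforce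
  then obtain D where D: "D \<subseteq> \<Lambda>" "finite D" "\<Lambda> \<subseteq> (\<Union>p\<in>D. ball p (d p))"
    using compactE_image[OF assms(1), of \<Lambda> "\<lambda>p. ball p (d p)"] by auto
  define e where "e = Min (insert 1 (d ` D))"
  have e0: "e > 0" using D d(1) by (auto simp: e_def)
  have "Q q e" if q: "q \<in> \<Lambda>" for q
  proof -
    obtain p where p: "p \<in> D" "dist q p < d p" using D(3) q by (auto simp: dist_commute)
    then have "Q q (d p)" using d(2) D(1) q by blast
    moreover have "e \<le> d p" unfolding e_def using D(2) p by (intro Min_le) auto
    ultimately show ?thesis using mono e0 by blast
  qed
  with e0 show ?thesis by blast
qed

context dichotomy
begin

text \<open>On the window of radius \<open>T\<close> each of the three terms of
  \<open>estimate\<close> is at most a quarter of \<open>S\<close>: the two boundary terms by the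
  choice of \<open>T\<close>, the error term by the smallness of \<open>\<epsilon>\<close>.\<close>

lemma contraction_step:
  assumes I2: "n - int T \<in> I" "n + int T \<in> I" and C: "0 \<le> C" "0 \<le> S" "0 \<le> \<epsilon>"
    and bound: "\<And>k v. n - int T \<le> k \<Longrightarrow> k \<le> n + int T \<Longrightarrow> norm (P k *v v) \<le> C * norm v \<and> norm (v - P k *v v) \<le> C * norm v"
    and small: "2 * K * C * \<epsilon> / (1 - \<alpha>) \<le> 1/4" "K * \<alpha> ^ T \<le> 1 / (4 * (C + 1))"
    and \<phi>: "\<And>k. n - int T \<le> k \<Longrightarrow> k \<le> n + int T \<Longrightarrow> norm (\<phi> k) \<le> S"
      "\<And>k. n - int T \<le> k \<Longrightarrow> k \<le> n + int T \<Longrightarrow> norm (\<phi> (k + 1) - B k *v \<phi> k) \<le> \<epsilon> * norm (\<phi> k)"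
  shows "norm (\<phi> n) \<le> 3/4 * S"
proof -
  let ?a = "n - int T" and ?b = "n + int T"
  have nn: "nat (n - ?a) = T" "nat (?b - n) = T" by simp_all
  have 1: "norm (\<phi> n) \<le> K * \<alpha> ^ nat (n - ?a) * norm (P ?a *v \<phi> ?a) + K * \<alpha> ^ nat (?b - n) * norm (\<phi> ?b - P ?b *v \<phi> ?b)
     + 2 * K * C * (\<epsilon> * S) / (1 - \<alpha>)"
  proof (rule estimate[OF I2])
    fix k assume k: "?a \<le> k" "k < ?b"
    have "\<epsilon> * norm (\<phi> k) \<le> \<epsilon> * S" using k \<phi>(1) C by (intro mult_left_mono) auto
    then show "norm (\<phi> (k + 1) - B k *v \<phi> k) \<le> \<epsilon> * S" using \<phi>(2)[of k] k by auto
  qed (use C bound in auto)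
  have 2: "K * \<alpha> ^ T * norm w \<le> 1/4 * S" if "norm w \<le> C * S" for w :: "real^'n"
  proof -
    have "K * \<alpha> ^ T * norm w \<le> 1 / (4 * (C + 1)) * (C * S)"
      using small(2) that C const by (intro mult_mono) auto
    also have "\<dots> = 1/4 * S * (C / (C + 1))" by simp
    also have "\<dots> \<le> 1/4 * S * 1" using C by (intro mult_left_mono) auto
    finally show ?thesis by simp
  qed
  have 3: "norm (P ?a *v \<phi> ?a) \<le> C * S" "norm (\<phi> ?b - P ?b *v \<phi> ?b) \<le> C * S"
    using bound[of ?a "\<phi> ?a"] bound[of ?b "\<phi> ?b"] \<phi>(1)[of ?a] \<phi>(1)[of ?b] C mult_left_mono[of _ S C]
    by (force intro: order_trans)+
  have "2 * K * C * (\<epsilon> * S) / (1 - \<alpha>) \<le> 1/4 * S"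
    using mult_right_mono[OF small(1) C(2)] by (simp add: mult_ac)
  with 1[unfolded nn] 2[OF 3(1)] 2[OF 3(2)] show ?thesis by simp
qed

text \<open>Every factor 3/4 costs a margin of \<open>T\<close> on either side, so the decay at
  \<open>n\<close> is governed by the distance from \<open>n\<close> to the ends of
  \<open>I\<close>.\<close>

lemma small_solution_power:
  assumes C: "0 \<le> C" "0 \<le> \<delta>" "0 \<le> \<epsilon>" and small: "2 * K * C * \<epsilon> / (1 - \<alpha>) \<le> 1/4"
    and bound: "\<And>k v. k \<in> I \<Longrightarrow> norm (P k *v v) \<le> C * norm v \<and> norm (v - P k *v v) \<le> C * norm v"
    and \<phi>: "\<And>k. k \<in> I \<Longrightarrow> norm (\<phi> k) \<le> \<delta>" "\<And>k. k \<in> I \<Longrightarrow> norm (\<phi> (k + 1) - B k *v \<phi> k) \<le> \<epsilon> * norm (\<phi> k)"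
  shows "\<exists>T. \<forall>i n. {n - int (i * T)..n + int (i * T)} \<subseteq> I \<longrightarrow> norm (\<phi> n) \<le> (3/4) ^ i * \<delta>"
proof -
  obtain T where T: "K * \<alpha> ^ T \<le> 1 / (4 * (C + 1))"
    using small_power[of "1 / (4 * (C + 1))"] C by auto
  have "norm (\<phi> n) \<le> (3/4) ^ i * \<delta>" if "{n - int (i * T)..n + int (i * T)} \<subseteq> I" for i n
    using that
  proof (induction i arbitrary: n)
    case (Suc i)
    have sub: "{n - int (Suc i * T)..n + int (Suc i * T)} \<subseteq> I" by fact
    have e: "int (Suc i * T) = int T + int (i * T)" by simp
    have in': "k \<in> I" if "n - int T \<le> k" "k \<le> n + int T" for k
    proof (rule subsetD[OF sub])
      show "k \<in> {n - int (Suc i * T)..n + int (Suc i * T)}"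
        unfolding e atLeastAtMost_iff using that of_nat_0_le_iff[of "i * T", where 'a = int] by linarith
    qed
    have "norm (\<phi> n) \<le> 3/4 * ((3/4) ^ i * \<delta>)"
    proof (rule contraction_step[OF _ _ C(1) _ C(3) _ small T])
      fix k assume k: "n - int T \<le> k" "k \<le> n + int T"
      have "{k - int (i * T)..k + int (i * T)} \<subseteq> {n - int (Suc i * T)..n + int (Suc i * T)}"
        unfolding e using k by auto
      then show "norm (\<phi> k) \<le> (3/4) ^ i * \<delta>" using Suc.IH[of k] sub by blast
    qed (use C bound \<phi> in' in auto)
    then show ?case by simp
  qed (use \<phi>(1)[of n for n] in simp)
  then show ?thesis by blast
qed

end

lemma exists_small_power: "\<exists>i. (3/4) ^ i * \<delta> < (e::real)" if "0 < e" "0 \<le> \<delta>"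
proof -
  have "(\<lambda>i. (3/4) ^ i * \<delta>) \<longlonglongrightarrow> 0 * \<delta>"
    by (intro tendsto_mult_right LIMSEQ_power_zero) auto
  then have "eventually (\<lambda>i. (3/4) ^ i * \<delta> < e) sequentially"
    using that by (intro order_tendstoD(2)[of _ 0]) auto
  from eventually_happens'[OF sequentially_bot this] show ?thesis .
qed

section \<open>Excluding truncated solutions by passage to the limit\<close>

lemma compact_bounded_sequences: "compact {y :: int \<Rightarrow> 'v::euclidean_space. \<forall>n. norm (y n) \<le> \<delta>}"
proof -
  have "compactin (product_topology (\<lambda>_. euclidean) UNIV) (PiE UNIV (\<lambda>_::int. cball (0::'v) \<delta>))"
    by (simp add: compactin_PiE)
  moreover have "PiE UNIV (\<lambda>_::int. cball (0::'v) \<delta>) = {y. \<forall>n. norm (y n) \<le> \<delta>}"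
    by (auto simp: PiE_UNIV_domain Pi_iff)
  ultimately show ?thesis by (metis compactin_euclidean_iff euclidean_product_topology)
qed

text \<open>Solutions of truncated boundary value problems of size exactly \<open>\<delta>\<close> would accumulate, by
  the dichotomy estimates, at a nonzero solution on all of the integers.\<close>

lemma no_truncated_solution:
  fixes M :: "'p::metric_space set" and F :: "int \<Rightarrow> 'p \<Rightarrow> real^'d \<Rightarrow> real^'d"
    and A Pp Pm :: "'p \<Rightarrow> int \<Rightarrow> real^'d^'d"
  assumes M: "compact M" and cont: "\<And>n. continuous_on (M \<times> UNIV) (\<lambda>(\<mu>, x). F n \<mu> x)"
    and k: "km \<le> kp"
    and EDp: "\<And>\<mu>. \<mu> \<in> M \<Longrightarrow> ED_with (A \<mu>) {kp..} (Pp \<mu>) K1 \<alpha>1"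
    and EDm: "\<And>\<mu>. \<mu> \<in> M \<Longrightarrow> ED_with (A \<mu>) {..km} (Pm \<mu>) K2 \<alpha>2"
    and C: "0 < C" "0 \<le> \<epsilon>" "0 < \<delta>"
    and bp: "\<And>\<mu> n v. \<mu> \<in> M \<Longrightarrow> kp \<le> n \<Longrightarrow> norm (Pp \<mu> n *v v) \<le> C * norm v \<and> norm (v - Pp \<mu> n *v v) \<le> C * norm v"
    and bm: "\<And>\<mu> n v. \<mu> \<in> M \<Longrightarrow> n \<le> km \<Longrightarrow> norm (Pm \<mu> n *v v) \<le> C * norm v \<and> norm (v - Pm \<mu> n *v v) \<le> C * norm v"
    and small: "2 * K1 * C * \<epsilon> / (1 - \<alpha>1) \<le> 1/4" "2 * K2 * C * \<epsilon> / (1 - \<alpha>2) \<le> 1/4"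
    and rem: "\<And>\<mu> n x. \<mu> \<in> M \<Longrightarrow> norm x \<le> \<delta> \<Longrightarrow> norm (F n \<mu> x - A \<mu> n *v x) \<le> \<epsilon> * norm x"
    and uniq: "\<And>\<mu> \<phi> n. \<mu> \<in> M \<Longrightarrow> (\<And>n. norm (\<phi> n) \<le> \<delta>) \<Longrightarrow> (\<And>n. \<phi> (n + 1) = F n \<mu> (\<phi> n)) \<Longrightarrow> \<phi> n = 0"
  shows "\<exists>N\<ge>N0. \<forall>\<mu>\<in>M. \<forall>x. (\<forall>n\<in>{-N..N}. norm (x n) \<le> \<delta>) \<longrightarrow> (\<exists>n\<in>{-N..N}. norm (x n) = \<delta>) \<longrightarrow>
      (\<forall>n\<in>{-N..<N}. x (n + 1) = F n \<mu> (x n)) \<longrightarrow> Pp \<mu> N *v x N = x N \<longrightarrow> Pm \<mu> (- N) *v x (- N) = 0 \<longrightarrow> False"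
proof (rule ccontr)
  assume neg: "\<not> ?thesis"
  define bad where "bad N \<mu> x \<longleftrightarrow> \<mu> \<in> M \<and> (\<forall>n\<in>{-N..N}. norm (x n) \<le> \<delta>) \<and> (\<exists>n\<in>{-N..N}. norm (x n) = \<delta>) \<and>
      (\<forall>n\<in>{-N..<N}. x (n + 1) = F n \<mu> (x n)) \<and> Pp \<mu> N *v x N = x N \<and> Pm \<mu> (- N) *v x (- N) = 0" for N \<mu> x
  define L where "L = max N0 (max \<bar>km\<bar> \<bar>kp\<bar>)"
  define NN where "NN i = L + int i" for i :: nat
  have NN: "N0 \<le> NN i" "kp \<le> NN i" "- NN i \<le> km" "int i \<le> NN i" for i
    by (auto simp: NN_def L_def)
  have "\<exists>\<mu> x. bad (NN i) \<mu> x" for i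
    using neg NN(1)[of i] unfolding bad_def by blast
  then obtain \<mu> x where bad: "\<And>i. bad (NN i) (\<mu> i) (x i)" by metis
  \<comment> \<open>A lower bound on the window \<open>{km..kp}\<close> that does not depend on
    \<open>i\<close>. From \<open>\<delta> \<le> K * p * w + \<delta> / 4\<close> with
    \<open>p \<le> 1\<close> and \<open>w\<close> at most \<open>C\<close> times the norm at the
    edge of the window, that norm is at least \<open>\<delta> / (2 * K * C)\<close>, with room to
    spare.\<close>
  define \<gamma> where "\<gamma> = min \<delta> (min (\<delta> / (2 * K1 * C)) (\<delta> / (2 * K2 * C)))"
  have K: "K1 \<ge> 1" "K2 \<ge> 1" "0 < \<alpha>1" "\<alpha>1 < 1" "0 < \<alpha>2" "\<alpha>2 < 1"
    using bad[of 0] EDp[of "\<mu> 0"] EDm[of "\<mu> 0"] by (auto simp: bad_def ED_with_def)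
  have \<gamma>: "\<gamma> > 0" using K C by (simp add: \<gamma>_def)
  have lower: "\<exists>n\<in>{km..kp}. \<gamma> \<le> norm (x i n)" for i
  proof -
    let ?N = "NN i" and ?x = "x i" and ?\<mu> = "\<mu> i"
    have b: "?\<mu> \<in> M" "\<And>n. n \<in> {-?N..?N} \<Longrightarrow> norm (?x n) \<le> \<delta>" "\<And>n. n \<in> {-?N..<?N} \<Longrightarrow> ?x (n + 1) = F n ?\<mu> (?x n)"
      "Pp ?\<mu> ?N *v ?x ?N = ?x ?N" "Pm ?\<mu> (- ?N) *v ?x (- ?N) = 0"
      using bad[of i] by (auto simp: bad_def)
    obtain n0 where n0: "n0 \<in> {-?N..?N}" "norm (?x n0) = \<delta>" using bad[of i] by (auto simp: bad_def)
    have res: "norm (?x (n + 1) - A ?\<mu> n *v ?x n) \<le> \<epsilon> * \<delta>" if "n \<in> {-?N..<?N}" for n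
    proof -
      have "norm (?x n) \<le> \<delta>" using b(2)[of n] that by auto
      then have "norm (F n ?\<mu> (?x n) - A ?\<mu> n *v ?x n) \<le> \<epsilon> * norm (?x n)" by (rule rem[OF b(1)])
      also have "\<dots> \<le> \<epsilon> * \<delta>" using \<open>norm (?x n) \<le> \<delta>\<close> C by (intro mult_left_mono) auto
      finally show ?thesis using b(3)[OF that] by simp
    qed
    have half: "2 * K * C * (\<epsilon> * \<delta>) / (1 - \<alpha>) \<le> \<delta> / 4" if "2 * K * C * \<epsilon> / (1 - \<alpha>) \<le> 1/4" for K \<alpha>
      using mult_right_mono[OF that less_imp_le[OF C(3)]] by (simp add: mult_ac)
    have fin: "\<gamma> \<le> norm v" if "\<delta> \<le> K * p * w + \<delta> / 4" "w \<le> C * norm v" "0 < p" "p \<le> 1" "1 \<le> K" "\<gamma> \<le> \<delta> / (2 * K * C)"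
      for K p w and v :: "real^'d"
    proof -
      have "K * p * w \<le> K * p * (C * norm v)" using that by (intro mult_left_mono) auto
      also have "\<dots> \<le> K * 1 * (C * norm v)" using that C by (intro mult_right_mono mult_left_mono) auto
      finally have "\<delta> / 2 \<le> K * C * norm v" using that(1) C by simp
      then have "\<delta> / (2 * K * C) \<le> norm v" using that C by (simp add: field_simps)
      with that(6) show ?thesis by linarith
    qed
    consider "n0 \<in> {km..kp}" | "kp < n0" | "n0 < km" by force
    then show ?thesis
    proof cases
      case 1
      then show ?thesis using n0 by (intro bexI[of _ n0]) (auto simp: \<gamma>_def)
    next
      case 2
      interpret dichotomy "A ?\<mu>" "{kp..}" "Pp ?\<mu>" K1 \<alpha>1
        by unfold_locales (use EDp[OF b(1)] in auto)
      \<comment> \<open>The boundary condition at \<open>?N\<close> removes the kernel term, so size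
        \<open>\<delta>\<close> to the right of the window forces a sizeable value at
        \<open>kp\<close>. The left side is symmetric, with the range term removed at
        \<open>- ?N\<close>.\<close>
      have "norm (?x n0) \<le> K1 * \<alpha>1 ^ nat (n0 - kp) * norm (Pp ?\<mu> kp *v ?x kp) +
          K1 * \<alpha>1 ^ nat (?N - n0) * norm (?x ?N - Pp ?\<mu> ?N *v ?x ?N) + 2 * K1 * C * (\<epsilon> * \<delta>) / (1 - \<alpha>1)"
        by (rule estimate) (use 2 n0 NN[of i] C bp[OF b(1)] res k in auto)
      then have "\<delta> \<le> K1 * \<alpha>1 ^ nat (n0 - kp) * norm (Pp ?\<mu> kp *v ?x kp) + \<delta> / 4"
        using half[OF small(1)] b(4) n0(2) by simp
      then have "\<gamma> \<le> norm (?x kp)"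
        by (rule fin) (use K bp[OF b(1), of kp] in \<open>auto simp: \<gamma>_def power_le_one\<close>)
      then show ?thesis using k by (intro bexI[of _ kp]) auto
    next
      case 3
      interpret dichotomy "A ?\<mu>" "{..km}" "Pm ?\<mu>" K2 \<alpha>2
        by unfold_locales (use EDm[OF b(1)] in auto)
      have "norm (?x n0) \<le> K2 * \<alpha>2 ^ nat (n0 - (- ?N)) * norm (Pm ?\<mu> (- ?N) *v ?x (- ?N)) +
          K2 * \<alpha>2 ^ nat (km - n0) * norm (?x km - Pm ?\<mu> km *v ?x km) + 2 * K2 * C * (\<epsilon> * \<delta>) / (1 - \<alpha>2)"
        by (rule estimate) (use 3 n0 NN[of i] C bm[OF b(1)] res k in auto)
      then have "\<delta> \<le> K2 * \<alpha>2 ^ nat (km - n0) * norm (?x km - Pm ?\<mu> km *v ?x km) + \<delta> / 4"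
        using half[OF small(2)] b(5) n0(2) by simp
      then have "\<gamma> \<le> norm (?x km)"
        by (rule fin) (use K bm[OF b(1), of km] in \<open>auto simp: \<gamma>_def power_le_one\<close>)
      then show ?thesis using k by (intro bexI[of _ km]) auto
    qed
  qed
  \<comment> \<open>The value 0 outside the truncation interval is a filler: it keeps all sequences
    in one compact space, and it drops out of the limit because the intervals exhaust the
    integers.\<close>
  define y where "y i n = (if n \<in> {-NN i..NN i} then x i n else 0)" for i n
  have mem: "(\<mu> i, y i) \<in> M \<times> {y. \<forall>n. norm (y n) \<le> \<delta>}" for i
    using bad[of i] C by (auto simp: bad_def y_def)
  have sc: "seq_compact (M \<times> {y :: int \<Rightarrow> real^'d. \<forall>n. norm (y n) \<le> \<delta>})"
    by (intro compact_imp_seq_compact compact_Times M compact_bounded_sequences)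
  obtain l r where lr: "l \<in> M \<times> {y. \<forall>n. norm (y n) \<le> \<delta>}" "strict_mono r" "((\<lambda>i. (\<mu> i, y i)) \<circ> r) \<longlonglongrightarrow> l"
    using seq_compactE[OF sc, of "\<lambda>i. (\<mu> i, y i)"] mem by blast
  obtain \<mu>' \<phi> where l: "l = (\<mu>', \<phi>)" by (cases l)
  have M': "\<mu>' \<in> M" "\<And>n. norm (\<phi> n) \<le> \<delta>" using lr(1) l by auto
  have lim\<mu>: "(\<lambda>i. \<mu> (r i)) \<longlonglongrightarrow> \<mu>'"
    using tendsto_fst[OF lr(3)] by (simp add: l o_def)
  have "(\<lambda>i. y (r i)) \<longlonglongrightarrow> \<phi>"
    using tendsto_snd[OF lr(3)] by (simp add: l o_def)
  then have limy: "(\<lambda>i. y (r i) n) \<longlonglongrightarrow> \<phi> n" for n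
    using continuous_on_tendsto_compose[OF continuous_on_product_coordinates[of n]] by fastforce
  have sol: "\<phi> (n + 1) = F n \<mu>' (\<phi> n)" for n
  proof (rule LIMSEQ_unique)
    show "(\<lambda>i. y (r i) (n + 1)) \<longlonglongrightarrow> \<phi> (n + 1)" by (rule limy)
    have "(\<lambda>i. (\<lambda>(\<mu>, x). F n \<mu> x) (\<mu> (r i), y (r i) n)) \<longlonglongrightarrow> (\<lambda>(\<mu>, x). F n \<mu> x) (\<mu>', \<phi> n)"
      by (rule continuous_on_tendsto_compose[OF cont tendsto_Pair[OF lim\<mu> limy]])
        (use M' bad in \<open>auto simp: bad_def\<close>)
    moreover have "eventually (\<lambda>i. F n (\<mu> (r i)) (y (r i) n) = y (r i) (n + 1)) sequentially"
      unfolding eventually_sequentially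
    proof (intro exI[of _ "nat (\<bar>n\<bar> + 1)"] allI impI)
      fix i assume "nat (\<bar>n\<bar> + 1) \<le> i"
      moreover have "i \<le> r i" by (rule seq_suble[OF lr(2)])
      ultimately have "\<bar>n\<bar> + 1 \<le> NN (r i)" using NN(4)[of "r i"] by linarith
      then have "n \<in> {- NN (r i)..<NN (r i)}" "n \<in> {- NN (r i)..NN (r i)}" "n + 1 \<in> {- NN (r i)..NN (r i)}" by auto
      then show "F n (\<mu> (r i)) (y (r i) n) = y (r i) (n + 1)"
        using bad[of "r i"] by (simp add: bad_def y_def)
    qed
    ultimately show "(\<lambda>i. y (r i) (n + 1)) \<longlonglongrightarrow> F n \<mu>' (\<phi> n)"
      using Lim_transform_eventually by force
  qed
  have \<phi>0: "\<phi> n = 0" for n by (rule uniq[OF M' sol])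
  \<comment> \<open>The limit vanishes, and pointwise convergence is uniform on the finite window,
    against the lower bound \<open>\<gamma>\<close>.\<close>
  have ev: "eventually (\<lambda>i. \<forall>n\<in>{km..kp}. norm (y (r i) n) < \<gamma>) sequentially"
  proof (rule eventually_ball_finite)
    show "\<forall>n\<in>{km..kp}. eventually (\<lambda>i. norm (y (r i) n) < \<gamma>) sequentially"
      using limy \<phi>0 \<gamma> by (auto intro!: order_tendstoD(2)[OF tendsto_norm_zero])
  qed simp
  obtain i where "\<forall>n\<in>{km..kp}. norm (y (r i) n) < \<gamma>"
    using eventually_happens'[OF sequentially_bot ev] by blast
  moreover obtain n where n: "n \<in> {km..kp}" "\<gamma> \<le> norm (x (r i) n)" using lower by blast
  moreover have "y (r i) n = x (r i) n" using NN[of "r i"] n(1) by (auto simp: y_def)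
  ultimately show False by force
qed

section \<open>The truncated problem as a map between sphere bundles\<close>

lemma fst_triv: "fst (triv r) = r"
  by (simp add: triv_def)

text \<open>Fibres consist of flat coordinate vectors, while the unknown of the truncated problem is
  a finite sequence of vectors; \<open>blk\<close> and \<open>ublk\<close> cut and join blocks of
  length \<open>CARD('d)\<close>.\<close>

definition blk :: "nat \<Rightarrow> rvec \<Rightarrow> real^'d" where
  "blk j x = unrv (\<lambda>i. x (j * CARD('d) + i))"

definition ublk :: "nat \<Rightarrow> (nat \<Rightarrow> real^'d) \<Rightarrow> rvec" where
  "ublk m w = (\<lambda>i. if i < m * CARD('d) then w (i div CARD('d)) $ idx_enum (i mod CARD('d)) else 0)"

lemma blk_component: "i < CARD('d) \<Longrightarrow> (blk j x :: real^'d) $ idx_enum i = x (j * CARD('d) + i)"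
  by (simp add: blk_def unrv_component)

lemma vec_eq_idx: "(\<And>i. i < CARD('d) \<Longrightarrow> v $ idx_enum i = w $ idx_enum i) \<Longrightarrow> v = (w :: real^'d)"
  unfolding vec_eq_iff using idx_enum_surj by metis

lemma blk_ublk: "j < m \<Longrightarrow> blk j (ublk m w) = (w j :: real^'d)"
proof (rule vec_eq_idx)
  fix i assume i: "i < CARD('d)" and j: "j < m"
  have "j * CARD('d) + i < Suc j * CARD('d)" using i by simp
  also have "\<dots> \<le> m * CARD('d)" using j by (intro mult_le_mono1) simp
  finally show "(blk j (ublk m w) :: real^'d) $ idx_enum i = w j $ idx_enum i"
    using i by (simp add: blk_component ublk_def)
qed

lemma ublk_blk:
  assumes "\<And>i. m * CARD('d) \<le> i \<Longrightarrow> x i = 0"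
  shows "ublk m (\<lambda>j. blk j x :: real^'d) = x"
proof
  fix i
  show "ublk m (\<lambda>j. blk j x :: real^'d) i = x i"
    using assms[of i] by (simp add: ublk_def blk_component)
qed

lemma ublk_support: "m * CARD('d) \<le> i \<Longrightarrow> ublk m (w :: nat \<Rightarrow> real^'d) i = 0"
  by (simp add: ublk_def)

lemma blk_linear: "blk j (\<lambda>i. a * x i + b * y i) = a *\<^sub>R blk j x + b *\<^sub>R (blk j y :: real^'d)"
  by (rule vec_eq_idx) (simp add: blk_component)

lemma rv_linear: "rv (a *\<^sub>R u + b *\<^sub>R v) = (\<lambda>i. a * rv u i + b * rv v i)"
  by (auto simp: rv_def)

lemma ublk_linear: "ublk m (\<lambda>j. a *\<^sub>R u j + b *\<^sub>R v j) = (\<lambda>i. a * ublk m u i + b * ublk m v i)"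
  by (auto simp: ublk_def)

lemma ublk_cong: "(\<And>j. j < m \<Longrightarrow> u j = v j) \<Longrightarrow> ublk m u = ublk m (v :: nat \<Rightarrow> real^'d)"
  by (auto simp: ublk_def less_mult_imp_div_less intro!: ext)

lemma vcat_linear: "vcat N (\<lambda>i. a * u i + b * v i) (\<lambda>i. a * u' i + b * v' i) = (\<lambda>i. a * vcat N u u' i + b * vcat N v v' i)"
  by (auto simp: vcat_def)

lemma continuous_on_vcat:
  assumes "continuous_on S u" "continuous_on S v" shows "continuous_on S (\<lambda>s. vcat N (u s) (v s))"
proof (rule continuous_on_coordinatewise_then_product)
  fix i show "continuous_on S (\<lambda>s. vcat N (u s) (v s) i)"
    by (cases "i < N") (simp_all add: vcat_def assms[THEN continuous_on_product_then_coordinatewise])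
qed

lemma continuous_on_rv:
  assumes "continuous_on S u" shows "continuous_on S (\<lambda>s. rv (u s :: real^'d))"
proof (rule continuous_on_coordinatewise_then_product)
  fix i show "continuous_on S (\<lambda>s. rv (u s) i)"
    by (cases "i < CARD('d)") (simp_all add: rv_def continuous_on_component assms)
qed

lemma continuous_on_ublk:
  assumes "\<And>j. j < m \<Longrightarrow> continuous_on S (\<lambda>s. u s j)" shows "continuous_on S (\<lambda>s. ublk m (u s :: nat \<Rightarrow> real^'d))"
proof (rule continuous_on_coordinatewise_then_product)
  fix i show "continuous_on S (\<lambda>s. ublk m (u s) i)"
    by (cases "i < m * CARD('d)") (simp_all add: ublk_def continuous_on_component assms less_mult_imp_div_less)
qed

lemma continuous_on_blk:
  assumes "continuous_on S u" shows "continuous_on S (\<lambda>s. blk j (u s) :: real^'d)"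
  unfolding blk_def unrv_def
  by (intro continuous_on_vec_lambda continuous_on_product_then_coordinatewise[OF assms])

lemma continuous_on_matrix_vector:
  fixes A :: "'a::topological_space \<Rightarrow> real^'n^'m"
  assumes "continuous_on S A" "continuous_on S u" shows "continuous_on S (\<lambda>s. A s *v u s)"
  unfolding matrix_vector_mult_def
  by (intro continuous_on_vec_lambda continuous_intros continuous_on_component assms)

lemma continuous_on_Max_lessThan:
  assumes "\<And>j. continuous_on S (\<lambda>s. f j s :: real)"
  shows "continuous_on S (\<lambda>s. Max ((\<lambda>j. f j s) ` {..<Suc q}))"
proof (induction q)
  case 0
  show ?case by (simp add: lessThan_Suc assms)
next
  case (Suc q)
  have "Max ((\<lambda>j. f j s) ` {..<Suc (Suc q)}) = max (f (Suc q) s) (Max ((\<lambda>j. f j s) ` {..<Suc q}))" for s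
    unfolding lessThan_Suc[of "Suc q"] image_insert by (rule Max_insert) auto
  then show ?case by (simp add: continuous_on_max assms Suc)
qed

lemma linear_rvec_eq_mvr:
  assumes lin: "\<And>a b x y. f (\<lambda>i. a * x i + b * y i) = (\<lambda>i. a * f x i + b * f y i)"
    and sup: "\<And>x i. M \<le> i \<Longrightarrow> f x i = 0" and x: "\<And>i. N \<le> i \<Longrightarrow> x i = 0"
  shows "f x = mvr M N (\<lambda>i j. f (\<lambda>k. if k = j then 1 else 0) i) x"
proof -
  have f0: "f (\<lambda>_. 0) = (\<lambda>_. 0)" using lin[of 0 "\<lambda>_. 0" 0 "\<lambda>_. 0"] by simp
  have "f (\<lambda>i. if i < n then x i else 0) = (\<lambda>i. \<Sum>j<n. f (\<lambda>k. if k = j then 1 else 0) i * x j)" for n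
  proof (induction n)
    case (Suc n)
    have eq: "(\<lambda>i. if i < Suc n then x i else 0) = (\<lambda>i. 1 * (if i < n then x i else 0) + x n * (if i = n then 1 else 0))"
      by (auto simp: less_Suc_eq)
    show ?case unfolding eq lin Suc by (simp add: mult.commute)
  qed (simp add: f0)
  moreover have "(\<lambda>i. if i < N then x i else 0) = x"
    using x by (auto simp: not_less)
  ultimately have "f x = (\<lambda>i. \<Sum>j<N. f (\<lambda>k. if k = j then 1 else 0) i * x j)"
    by metis
  then show ?thesis using sup by (auto simp: mvr_def intro!: ext)
qed

text \<open>The unknowns are \<open>q + 1\<close> vectors, hence a trivial bundle; the values are
  the \<open>q\<close> residuals of the recursion, the kernel part at the last time and the range
  part at the first. \<open>M\<close> joins the problem at \<open>t = 1\<close> over the whole base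
  with a deformation over \<open>l0\<close> alone, and nonvanishing on \<open>M\<close> is exactly
  what the map and its homotopy consume. Over \<open>l0\<close> at \<open>t = 0\<close> the map is
  linear and bijective.\<close>

theorem fibre_homotopy_equiv_of_truncated_problem:
  fixes \<Lambda> :: "'a::metric_space set" and F :: "nat \<Rightarrow> 'a \<Rightarrow> real \<Rightarrow> real^'d \<Rightarrow> real^'d"
    and P R :: "'a \<Rightarrow> real^'d^'d" and A :: "nat \<Rightarrow> real^'d^'d" and l0 :: 'a
  defines "M \<equiv> \<Lambda> \<times> {1} \<union> {l0} \<times> {0..1}"
  assumes cpt: "compact \<Lambda>" and conn: "connected \<Lambda>" and l0: "l0 \<in> \<Lambda>"
    and cont: "continuous_on \<Lambda> P" "continuous_on \<Lambda> R"
      "\<And>j. continuous_on (M \<times> UNIV) (\<lambda>((l, t), x). F j l t x)"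
    and idem: "\<And>l. l \<in> \<Lambda> \<Longrightarrow> P l ** P l = P l" "\<And>l. l \<in> \<Lambda> \<Longrightarrow> R l ** R l = R l"
    and lin: "\<And>j x. F j l0 0 x = A j *v x" and \<delta>: "0 < \<delta>"
    and nonzero: "\<And>l t X. (l, t) \<in> M \<Longrightarrow> (\<And>j. j \<le> q \<Longrightarrow> norm (X j) \<le> \<delta>) \<Longrightarrow> \<exists>j\<le>q. norm (X j) = \<delta> \<Longrightarrow>
        (\<And>j. j < q \<Longrightarrow> X (Suc j) = F j l t (X j)) \<Longrightarrow> P l *v X q = X q \<Longrightarrow> R l *v X 0 = 0 \<Longrightarrow> False"
    and surj: "\<And>w a b. P l0 *v a = 0 \<Longrightarrow> R l0 *v b = b \<Longrightarrow>
        \<exists>X. (\<forall>j<q. X (Suc j) - A j *v X j = w j) \<and> X q - P l0 *v X q = a \<and> R l0 *v X 0 = b"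
  shows "fibre_homotopy_equiv \<Lambda> (triv (q * CARD('d) + CARD('d)))
      (dsum (dsum (triv (q * CARD('d))) (mat_bundle (\<lambda>l. mat 1 - P l))) (mat_bundle R))"
proof -
  let ?d = "CARD('d)"
  let ?k = "q * ?d"
  let ?KP = "mat_bundle (\<lambda>l. mat 1 - P l)"
  define E :: "'a vbundle" where "E = triv (?k + ?d)"
  define B where "B = dsum (dsum (triv ?k) ?KP) (mat_bundle R)"
  have fB: "fst B = ?k + ?d + ?d" by (simp add: B_def dsum_eq(1)) (simp add: fst_triv)
  have fE: "fst E = ?k + ?d" by (simp add: E_def fst_triv)
  have vE: "is_vbundle V E" for V by (simp add: E_def is_vbundle_triv)
  have vB: "is_vbundle \<Lambda> B"
    unfolding B_def
    by (intro is_vbundle_dsum is_vbundle_triv is_vbundle_mat_bundle continuous_intros cont idem idem_complement)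
  have fibE: "fibre E l = {x. \<forall>i\<ge>?k + ?d. x i = 0}" for l
    by (simp add: E_def fibre_triv)
  define H where "H l t x = vcat (?k + ?d) (vcat ?k (ublk q (\<lambda>j. blk (Suc j) x - F j l t (blk j x)))
      (rv ((mat 1 - P l) *v blk q x))) (rv (R l *v blk 0 x))" for l t x
  have Hfib: "H l t x \<in> fibre B l" for l t x
    unfolding H_def B_def
    by (intro vcat_in_fibre) (auto simp: fibre_triv ublk_support fibre_mat_bundle dsum_eq(1) fst_triv)
  have Hsup: "H l t x i = 0" if "?k + ?d + ?d \<le> i" for l t x i
    by (rule fibre_support[OF Hfib[of l t x]]) (simp add: fB that)
  have H0: "(\<forall>j<q. blk (Suc j) x = F j l t (blk j x)) \<and> P l *v blk q x = blk q x \<and> R l *v blk 0 x = 0"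
    if "vn (fst B) (H l t x) = 0" for l t x
  proof -
    have H: "H l t x = (\<lambda>_. 0)"
    proof
      fix i show "H l t x i = 0"
      proof (cases "i < fst B")
        case True
        then show ?thesis using that by (simp add: L2_set_eq_0_iff)
      qed (simp add: Hsup fB)
    qed
    have "rv (R l *v blk 0 x) = (\<lambda>_. 0)"
      using arg_cong[OF H, of "vshift (?k + ?d)"] by (simp add: H_def) (simp add: vshift_def)
    then have "rv (R l *v blk 0 x) = rv (0 :: real^'d)" by (simp add: rv_def[of "0 :: real^'d"] fun_eq_iff)
    then have 1: "R l *v blk 0 x = 0" by simp
    have z: "vcat ?k (ublk q (\<lambda>j. blk (Suc j) x - F j l t (blk j x))) (rv ((mat 1 - P l) *v blk q x)) i = 0" if "i < ?k + ?d" for i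
      using fun_cong[OF H, of i] that by (simp add: H_def vcat_def)
    have "(mat 1 - P l) *v blk q x = 0"
    proof (rule vec_eq_idx)
      fix i assume "i < ?d"
      then show "((mat 1 - P l) *v blk q x) $ idx_enum i = 0 $ idx_enum i"
        using z[of "?k + i"] by (simp add: vcat_def rv_def)
    qed
    then have 2: "P l *v blk q x = blk q x" by (simp add: matrix_vector_mult_diff_rdistrib)
    have u: "ublk q (\<lambda>j. blk (Suc j) x - F j l t (blk j x)) = (\<lambda>_. 0)"
    proof
      fix i show "ublk q (\<lambda>j. blk (Suc j) x - F j l t (blk j x)) i = 0"
        using z[of i] by (cases "i < ?k") (auto simp: vcat_def ublk_support)
    qed
    have "blk (Suc j) x - F j l t (blk j x) = 0" if "j < q" for j
    proof -
      have "blk (Suc j) x - F j l t (blk j x) = blk j (\<lambda>_. 0)"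
        using blk_ublk[OF that, of "\<lambda>j. blk (Suc j) x - F j l t (blk j x)"] unfolding u by simp
      also have "\<dots> = 0" by (rule vec_eq_idx) (simp add: blk_component)
      finally show ?thesis .
    qed
    with 1 2 show ?thesis by simp
  qed
  \<comment> \<open>\<open>nonzero\<close> measures size by the maximum over blocks, the sphere
    bundle by the Euclidean norm; multiplying by \<open>\<delta> / mx x\<close> turns a unit vector
    into one of maximal block norm \<open>\<delta>\<close>.\<close>
  define mx where "mx x = Max ((\<lambda>j. norm (blk j x :: real^'d)) ` {..<Suc q})" for x
  have mx_ge: "norm (blk j x :: real^'d) \<le> mx x" if "j \<le> q" for j x
    unfolding mx_def using that by (intro Max_ge) auto
  have mx_ex: "\<exists>j\<le>q. norm (blk j x :: real^'d) = mx x" for x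
  proof -
    have "mx x \<in> (\<lambda>j. norm (blk j x :: real^'d)) ` {..<Suc q}" unfolding mx_def by (intro Max_in) auto
    then show ?thesis by (auto simp: less_Suc_eq_le)
  qed
  have mx_pos: "0 < mx x" if x: "x \<in> fibre E l" "x \<noteq> (\<lambda>_. 0)" for x l
  proof (rule ccontr)
    assume m: "\<not> 0 < mx x"
    have b0: "(blk j x :: real^'d) = 0" if "j \<le> q" for j
    proof -
      have "norm (blk j x :: real^'d) \<le> 0" using mx_ge[OF that, of x] m by linarith
      then show ?thesis by simp
    qed
    have "ublk (Suc q) (\<lambda>j. blk j x :: real^'d) = ublk (Suc q) (\<lambda>_. 0 :: real^'d)"
      by (rule ublk_cong) (simp add: b0)
    moreover have "ublk (Suc q) (\<lambda>j. blk j x :: real^'d) = x"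
      by (rule ublk_blk) (use x in \<open>simp add: fibE add.commute\<close>)
    moreover have "ublk (Suc q) (\<lambda>_. 0 :: real^'d) = (\<lambda>_. 0)"
      by (rule ext) (simp add: ublk_def)
    ultimately show False using x(2) by simp
  qed
  define sc where "sc x = (\<lambda>i. (\<delta> / mx x) * x i)" for x
  have blk_sc: "blk j (sc x) = (\<delta> / mx x) *\<^sub>R (blk j x :: real^'d)" for j x
    using blk_linear[of j "\<delta> / mx x" x 0 x] by (simp add: sc_def)
  have Hnz: "vn (fst B) (H l t (sc x)) \<noteq> 0" if M: "(l, t) \<in> M" and x: "x \<in> fibre E l" "x \<noteq> (\<lambda>_. 0)" for l t x
  proof
    assume "vn (fst B) (H l t (sc x)) = 0"
    note h = H0[OF this]
    have m: "0 < mx x" by (rule mx_pos[OF x])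
    have nb: "norm (blk j (sc x) :: real^'d) = \<delta> * (norm (blk j x :: real^'d) / mx x)" for j
      using m \<delta> by (simp add: blk_sc)
    show False
    proof (rule nonzero[OF M, of "\<lambda>j. blk j (sc x)"])
      show "norm (blk j (sc x) :: real^'d) \<le> \<delta>" if "j \<le> q" for j
        unfolding nb using mx_ge[OF that, of x] m \<delta> by (simp add: pos_divide_le_eq)
      show "\<exists>j\<le>q. norm (blk j (sc x) :: real^'d) = \<delta>"
        unfolding nb using mx_ex[of x] m by force
    qed (use h in auto)
  qed
  define G where "G t z = (fst z, nz (fst B) (H (fst z) t (sc (snd z))))" for t z
  have SE: "fst z \<in> \<Lambda> \<and> snd z \<in> fibre E (fst z) \<and> snd z \<noteq> (\<lambda>_. 0)" if "z \<in> sphere_bundle \<Lambda> E" for z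
    using that by (auto simp: sphere_bundle_def)
  have Gin: "G t z \<in> sphere_bundle \<Lambda> B" if "z \<in> sphere_bundle \<Lambda> E" "(fst z, t) \<in> M" for t z
  proof -
    obtain N Q where B': "B = (N, Q)" by (cases B)
    have "mvr N N (Q (fst z)) (H (fst z) t (sc (snd z))) = H (fst z) t (sc (snd z))"
      using fibre_iff[OF vB[unfolded B']] Hfib[of "fst z"] SE[OF that(1)] by (simp add: B')
    then show ?thesis
      using SE[OF that(1)] vn_nz[OF Hnz[OF that(2)]] B'
      by (simp add: G_def mem_sphere_bundle[OF vB[unfolded B']]) (simp add: nz_def mvr_scale)
  qed
  have contG: "continuous_on S (\<lambda>s. G (u s) (v s))"
    if cu: "continuous_on S u" and cv: "continuous_on S v"
      and S: "\<And>s. s \<in> S \<Longrightarrow> v s \<in> sphere_bundle \<Lambda> E \<and> (fst (v s), u s) \<in> M" for S :: "(real \<times> 'a \<times> rvec) set" and u v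
  proof -
    have c1: "continuous_on S (\<lambda>s. fst (v s))" and c2: "continuous_on S (\<lambda>s. snd (v s))"
      using cv by (auto intro: continuous_intros)
    have cmx: "continuous_on S (\<lambda>s. mx (snd (v s)))"
      unfolding mx_def by (intro continuous_on_Max_lessThan continuous_intros continuous_on_blk c2)
    have csc: "continuous_on S (\<lambda>s. sc (snd (v s)))"
      unfolding sc_def
    proof (intro continuous_on_coordinatewise_then_product continuous_intros cmx continuous_on_product_then_coordinatewise[OF c2] ballI)
      fix s assume "s \<in> S"
      then show "mx (snd (v s)) \<noteq> 0" using mx_pos[of "snd (v s)" "fst (v s)"] SE[of "v s"] S[of s] by force
    qed
    have cF: "continuous_on S (\<lambda>s. F j (fst (v s)) (u s) (blk j (sc (snd (v s)))))" for j
    proof -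
      have "continuous_on S (\<lambda>s. (\<lambda>((l, t), x). F j l t x) ((fst (v s), u s), blk j (sc (snd (v s)))))"
        by (rule continuous_on_compose2[OF cont(3)])
          (use S in \<open>auto intro!: continuous_on_Pair c1 cu continuous_on_blk csc\<close>)
      then show ?thesis by simp
    qed
    have cP: "continuous_on S (\<lambda>s. P (fst (v s)))" and cR: "continuous_on S (\<lambda>s. R (fst (v s)))"
      by (rule continuous_on_compose2[OF cont(1) c1] continuous_on_compose2[OF cont(2) c1]; use S SE in blast)+
    have cH: "continuous_on S (\<lambda>s. H (fst (v s)) (u s) (sc (snd (v s))))"
      unfolding H_def
      by (intro continuous_on_vcat continuous_on_rv continuous_on_ublk continuous_on_matrix_vector
          continuous_on_diff continuous_on_const cP cR cF continuous_on_blk csc)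
    show ?thesis
      unfolding G_def
    proof (intro continuous_on_Pair c1 continuous_on_nz cH)
      fix s assume "s \<in> S"
      then show "vn (fst B) (H (fst (v s)) (u s) (sc (snd (v s)))) \<noteq> 0"
        using Hnz SE[of "v s"] S[of s] by blast
    qed
  qed
  have M1: "(l, 1) \<in> M" if "l \<in> \<Lambda>" for l using that by (simp add: M_def)
  have fm: "fmap (sphere_bundle \<Lambda> E) (sphere_bundle \<Lambda> B) (G 1)"
  proof (rule fmapI)
    \<comment> \<open>\<open>contG\<close> is stated for domains with a real factor, so the
      parameter is frozen on the one-point interval.\<close>
    have c: "continuous_on ({1::real} \<times> sphere_bundle \<Lambda> E) (\<lambda>s. G 1 (snd s))"
      by (rule contG[of _ "\<lambda>_. 1" snd]) (use SE M1 in \<open>auto intro!: continuous_intros\<close>)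
    have "continuous_on (sphere_bundle \<Lambda> E) (\<lambda>z. (1 :: real, z))" by (intro continuous_intros)
    from continuous_on_compose2[OF c this] show "continuous_on (sphere_bundle \<Lambda> E) (G 1)" by auto
    show "G 1 z \<in> sphere_bundle \<Lambda> B" if "z \<in> sphere_bundle \<Lambda> E" for z
      by (rule Gin[OF that M1]) (use SE[OF that] in simp)
  qed (simp add: G_def)
  have sub: "sphere_bundle {l0} E \<subseteq> sphere_bundle \<Lambda> E" using l0 by (auto simp: sphere_bundle_def)
  have hom: "fhom (sphere_bundle {l0} E) (sphere_bundle {l0} B) (G 0) (G 1)"
  proof (rule fhomI[of _ "\<lambda>s. G (fst s) (snd s)"])
    have l0z: "fst z = l0" if "z \<in> sphere_bundle {l0} E" for z using that by (auto simp: sphere_bundle_def)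
    show "continuous_on ({0..1::real} \<times> sphere_bundle {l0} E) (\<lambda>s. G (fst s) (snd s))"
      by (rule contG[of _ fst snd]) (use sub l0z in \<open>auto intro!: continuous_intros simp: M_def\<close>)
    fix t :: real and z assume tz: "t \<in> {0..1}" "z \<in> sphere_bundle {l0} E"
    then have "G t z \<in> sphere_bundle \<Lambda> B"
      using sub l0z[OF tz(2)] by (intro Gin) (auto simp: M_def)
    then show "G (fst (t, z)) (snd (t, z)) \<in> sphere_bundle {l0} B"
      using l0z[OF tz(2)] by (simp add: G_def sphere_bundle_def)
  qed (auto simp: G_def)
  \<comment> \<open>The linear endpoint of the deformation. It is injective because a zero could be
    rescaled to block norm \<open>\<delta>\<close>, and onto by \<open>surj\<close>;
    \<open>D\<close> is its matrix, as required by \<open>fheq_linear\<close>.\<close>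
  define h where "h x = H l0 0 x" for x
  have hlin: "h (\<lambda>i. a * x i + b * y i) = (\<lambda>i. a * h x i + b * h y i)" for a b x y
  proof -
    have e: "(blk (Suc j) (\<lambda>i. a * x i + b * y i) :: real^'d) - A j *v blk j (\<lambda>i. a * x i + b * y i)
      = a *\<^sub>R (blk (Suc j) x - A j *v blk j x) + b *\<^sub>R (blk (Suc j) y - A j *v blk j y)" for j
      by (simp add: blk_linear algebra_simps)
    have e': "B *v blk j (\<lambda>i. a * x i + b * y i) = a *\<^sub>R (B *v blk j x) + b *\<^sub>R (B *v (blk j y :: real^'d))" for j B
      by (simp add: blk_linear matrix_vector_right_distrib matrix_vector_mult_scaleR)
    show ?thesis unfolding h_def H_def lin e unfolding e' rv_linear ublk_linear vcat_linear by (rule refl)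
  qed
  define D where "D i j = h (\<lambda>k. if k = j then 1 else 0) i" for i j
  have hD: "h x = mvr (fst B) (fst E) D x" if "x \<in> fibre E l0" for x
    unfolding D_def by (rule linear_rvec_eq_mvr[OF hlin]) (use that in \<open>auto simp: h_def Hsup fB fibE fE\<close>)
  \<comment> \<open>For a linear map the rescaling inside \<open>G\<close> is absorbed by the final
    normalisation, so \<open>G 0\<close> is the normalised matrix \<open>D\<close> over
    \<open>l0\<close>.\<close>
  have h_sc: "nz (fst B) (h (sc x)) = nz (fst B) (h x)" if "0 < mx x" for x
  proof -
    have "h (sc x) = (\<lambda>i. h x i / (mx x / \<delta>))"
      using hlin[of "\<delta> / mx x" x 0 x] by (simp add: sc_def mult.commute)
    then show ?thesis using nz_divide[of "mx x / \<delta>"] that \<delta> by simp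
  qed
  have hnz: "vn (fst B) (h x) \<noteq> 0" if "x \<in> fibre E l0" "x \<noteq> (\<lambda>_. 0)" for x
  proof
    assume 0: "vn (fst B) (h x) = 0"
    have "h (sc x) = (\<lambda>i. (\<delta> / mx x) * h x i)" using hlin[of "\<delta> / mx x" x 0 x] by (simp add: sc_def)
    then have "vn (fst B) (h (sc x)) = 0" using 0 by (simp add: L2_set_eq_0_iff)
    moreover have "vn (fst B) (h (sc x)) \<noteq> 0"
      unfolding h_def by (rule Hnz) (use that in \<open>auto simp: M_def\<close>)
    ultimately show False by simp
  qed
  have bij: "bij_betw (mvr (fst B) (fst E) D) (fibre E l0) (fibre B l0)"
  proof -
    have inj: "inj_on h (fibre E l0)"
    proof (rule inj_onI)
      fix x y assume xy: "x \<in> fibre E l0" "y \<in> fibre E l0" "h x = h y"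
      let ?z = "\<lambda>i. 1 * x i + (-1) * y i"
      have "h ?z = (\<lambda>_. 0)" unfolding hlin using xy(3) by simp
      then have "vn (fst B) (h ?z) = 0" by (simp add: L2_set_def)
      moreover have "?z \<in> fibre E l0" using xy by (simp add: fibE)
      ultimately have "?z = (\<lambda>_. 0)" using hnz by blast
      then show "x = y" by (auto simp: fun_eq_iff)
    qed
    have "y \<in> h ` fibre E l0" if y: "y \<in> fibre B l0" for y
    proof -
      obtain u v where uv: "u \<in> fibre (dsum (triv ?k) ?KP) l0" "v \<in> fibre (mat_bundle R) l0"
          "y = vcat (fst (dsum (triv ?k :: 'a vbundle) ?KP)) u v"
        using y unfolding B_def by (rule fibre_dsumE) blast
      obtain w a' where w: "w \<in> fibre (triv ?k) l0" "a' \<in> fibre ?KP l0" "u = vcat ?k w a'"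
        using uv(1) by (elim fibre_dsumE) (simp add: fst_triv)
      obtain a where a: "a' = rv a" "P l0 *v a = 0"
        using w(2) fibre_mat_bundle_iff[of "\<lambda>l. mat 1 - P l", OF idem_complement[OF idem(1)[OF l0]]]
        by (auto simp: matrix_vector_mult_diff_rdistrib)
      obtain b where b: "v = rv b" "R l0 *v b = b"
        using uv(2) fibre_mat_bundle_iff[of R, OF idem(2)[OF l0]] by auto
      obtain X where X: "\<And>j. j < q \<Longrightarrow> X (Suc j) - A j *v X j = blk j w" "X q - P l0 *v X q = a" "R l0 *v X 0 = b"
        using surj[OF a(2) b(2), of "\<lambda>j. blk j w"] by blast
      define x where "x = ublk (Suc q) X"
      have bx: "blk j x = X j" if "j \<le> q" for j
        unfolding x_def by (rule blk_ublk) (use that in simp)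
      have "ublk q (\<lambda>j. blk (Suc j) x - F j l0 0 (blk j x)) = ublk q (\<lambda>j. blk j w :: real^'d)"
        by (rule ublk_cong) (simp add: bx lin X(1))
      also have "\<dots> = w" by (rule ublk_blk) (use w(1) in \<open>simp add: fibre_triv\<close>)
      finally have "h x = y"
        by (simp add: h_def H_def bx matrix_vector_mult_diff_rdistrib X uv w(3) a(1) b(1) dsum_eq(1) fst_triv)
      moreover have "x \<in> fibre E l0" by (auto simp: fibE x_def intro!: ublk_support)
      ultimately show ?thesis by blast
    qed
    then have "h ` fibre E l0 = fibre B l0" using Hfib[of l0 0] by (auto simp: h_def)
    with inj have "bij_betw h (fibre E l0) (fibre B l0)" by (simp add: bij_betw_def)
    then show ?thesis using hD by (simp cong: bij_betw_cong)
  qed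
  have "fheq (sphere_bundle {l0} E) (sphere_bundle {l0} B) (\<lambda>z. (fst z, nz (fst B) (mvr (fst B) (fst E) D (snd z))))"
    using fheq_linear[of l0 "fst E" "snd E" "fst B" "snd B" D] vE[of "{l0}"] is_vbundle_subset[OF vB, of "{l0}"] l0 bij by simp
  then have "fheq (sphere_bundle {l0} E) (sphere_bundle {l0} B) (G 0)"
  proof (rule fheq_cong)
    fix z assume z: "z \<in> sphere_bundle {l0} E"
    then have "fst z = l0" "snd z \<in> fibre E l0" "snd z \<noteq> (\<lambda>_. 0)" by (auto simp: sphere_bundle_def)
    then show "(fst z, nz (fst B) (mvr (fst B) (fst E) D (snd z))) = G 0 z"
      using h_sc[OF mx_pos] hD[of "snd z"] by (simp add: G_def h_def)
  qed
  then have "fheq (sphere_bundle {l0} E) (sphere_bundle {l0} B) (G 1)"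
    by (rule fheq_hom[OF _ hom])
  then show ?thesis
    using fibre_homotopy_equiv_of_fibre[OF cpt conn vE vB fm l0] unfolding E_def B_def by blast
qed

section \<open>Transport of kernels along the evolution\<close>

lemma ED_idem: "ED_with B I P K \<alpha> \<Longrightarrow> n \<in> I \<Longrightarrow> P n ** P n = P n"
  by (simp add: ED_with_def regular_proj_def invariant_proj_def projector_on_def)

lemma continuous_on_Phi:
  fixes A :: "'a::topological_space \<Rightarrow> int \<Rightarrow> real^'d^'d"
  assumes "\<And>n. continuous_on \<Lambda> (\<lambda>l. A l n)" shows "continuous_on \<Lambda> (\<lambda>l. Phi (A l) (a + int m) a)"
proof (induction m)
  case (Suc m)
  have "Phi (A l) (a + int (Suc m)) a = A l (a + int m) ** Phi (A l) (a + int m) a" for l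
    using Phi_Suc[of a "a + int m" "A l"] by (simp add: algebra_simps)
  then show ?case by (simp add: continuous_on_matrix_mult assms Suc)
qed simp

context dichotomy
begin

lemma bij_Phi_kernel:
  assumes "a \<in> I" "a + int m \<in> I"
  shows "bij_betw (\<lambda>x. Phi B (a + int m) a *v x) {x. P a *v x = 0} {x. P (a + int m) *v x = 0}"
  unfolding bij_betw_def
proof
  let ?F = "Phi B (a + int m) a"
  show "inj_on (\<lambda>x. ?F *v x) {x. P a *v x = 0}"
  proof (rule inj_onI)
    fix x y assume xy: "x \<in> {x. P a *v x = 0}" "y \<in> {x. P a *v x = 0}" "?F *v x = ?F *v y"
    have "norm (x - y) \<le> K * \<alpha> ^ m * norm (?F *v (x - y))"
      by (rule unstable[OF assms]) (use xy in \<open>simp add: matrix_vector_mult_diff_distrib\<close>)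
    then show "x = y" using xy by (simp add: matrix_vector_mult_diff_distrib)
  qed
  have "?F *v x \<in> {x. P (a + int m) *v x = 0}" if "P a *v x = 0" for x
    using inv_Phi[OF assms, of x] that by simp
  moreover have "y \<in> (\<lambda>x. ?F *v x) ` {x. P a *v x = 0}" if "P (a + int m) *v y = 0" for y
    using surj_Phi[OF assms that] by blast
  ultimately show "(\<lambda>x. ?F *v x) ` {x. P a *v x = 0} = {x. P (a + int m) *v x = 0}" by blast
qed

lemma dim_kernel_eq:
  assumes "a \<in> I" "a + int m \<in> I"
  shows "dim {x. P (a + int m) *v x = 0} = dim {x. P a *v x = 0}"
proof -
  have "subspace {x. P a *v x = 0}"
    by (auto simp: subspace_def matrix_vector_right_distrib matrix_vector_mult_scaleR)
  then have "dim ((\<lambda>x. Phi B (a + int m) a *v x) ` {x. P a *v x = 0}) = dim {x. P a *v x = 0}"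
    using bij_Phi_kernel[OF assms] by (intro dim_image_eq matrix_vector_mul_linear) (auto simp: bij_betw_def span_eq_iff[THEN iffD2])
  then show ?thesis using bij_Phi_kernel[OF assms] by (simp add: bij_betw_def)
qed

end

text \<open>The truncated problem involves projectors at the outer times \<open>N\<close> and
  \<open>- N\<close>, the claim those at the inner ends of the half-lines. The evolution operator
  maps one kernel bijectively onto the other and is continuous in the parameter; it may fail to do
  this for the ranges, so the comparison goes through the kernels.\<close>

lemma kernel_bundle_iso:
  fixes A P :: "'a::topological_space \<Rightarrow> int \<Rightarrow> real^'d^'d"
  assumes ED: "\<And>l. l \<in> \<Lambda> \<Longrightarrow> ED_with (A l) I (P l) K \<alpha>" and I: "int_interval I" "a \<in> I" "a + int m \<in> I"
    and cont: "continuous_on \<Lambda> (\<lambda>l. P l a)" "\<And>n. continuous_on \<Lambda> (\<lambda>l. A l n)"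
  shows "bundle_iso \<Lambda> (mat_bundle (\<lambda>l. mat 1 - P l a)) (mat_bundle (\<lambda>l. mat 1 - P l (a + int m)))"
proof (rule bundle_iso_of_bij[where T = "\<lambda>l. Phi (A l) (a + int m) a"])
  show "continuous_on \<Lambda> (\<lambda>l. mat 1 - P l a)" by (intro continuous_intros cont)
  show "continuous_on \<Lambda> (\<lambda>l. Phi (A l) (a + int m) a)" by (rule continuous_on_Phi[OF cont(2)])
  fix l assume l: "l \<in> \<Lambda>"
  interpret dichotomy "A l" I "P l" K \<alpha> by unfold_locales (use assms(1)[OF l] assms(2) in auto)
  show "(mat 1 - P l a) ** (mat 1 - P l a) = mat 1 - P l a"
    "(mat 1 - P l (a + int m)) ** (mat 1 - P l (a + int m)) = mat 1 - P l (a + int m)"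
    using ED_idem[OF assms(1)[OF l]] assms(2-4) by (auto intro!: idem_complement)
  show "bij_betw ((*v) (Phi (A l) (a + int m) a)) {x. (mat 1 - P l a) *v x = x} {x. (mat 1 - P l (a + int m)) *v x = x}"
    using bij_Phi_kernel[OF assms(3,4)] by (simp add: matrix_vector_mult_diff_rdistrib)
qed

lemma dim_kernel_idem:
  fixes P :: "real^'d^'d" assumes "P ** P = P"
  shows "rank (mat 1 - P) = dim {x. P *v x = 0}" "rank (mat 1 - P) + rank P = CARD('d)"
proof -
  show 1: "rank (mat 1 - P) = dim {x. P *v x = 0}"
    using rank_eq_dim_fixed[OF idem_complement[OF assms]] by (simp add: matrix_vector_mult_diff_rdistrib)
  let ?V = "{x. P *v x = 0}" and ?W = "{x. P *v x = x}"
  have "subspace ?V" "subspace ?W"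
    by (auto simp: subspace_def matrix_vector_right_distrib matrix_vector_mult_scaleR)
  then have "dim {x + y |x y. x \<in> ?V \<and> y \<in> ?W} + dim (?V \<inter> ?W) = dim ?V + dim ?W"
    by (rule dim_sums_Int)
  moreover have "?V \<inter> ?W = {0}" by auto
  moreover have "{x + y |x y. x \<in> ?V \<and> y \<in> ?W} = UNIV"
  proof -
    have "x = (x - P *v x) + P *v x \<and> x - P *v x \<in> ?V \<and> P *v x \<in> ?W" for x
      using assms by (simp add: matrix_vector_mult_diff_distrib matrix_vector_mul_assoc)
    then show ?thesis by blast
  qed
  ultimately show "rank (mat 1 - P) + rank P = CARD('d)"
    using 1 rank_eq_dim_fixed[OF assms] by simp
qed

section \<open>Linearisation bounds uniform in time and parameter\<close>

lemma remainder_bound: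
  fixes f :: "real^'d \<Rightarrow> real^'d" and D :: "real^'d \<Rightarrow> real^'d^'d"
  assumes der: "\<And>x. (f has_derivative (\<lambda>h. D x *v h)) (at x)" and "f 0 = 0"
    and D: "\<And>x. norm x \<le> \<delta> \<Longrightarrow> norm (D x - D 0) \<le> \<epsilon>" and x: "norm x \<le> \<delta>"
  shows "norm (f x - D 0 *v x) \<le> \<epsilon> * norm x"
proof -
  have "norm (f x - f 0 - D 0 *v (x - 0)) \<le> norm (x - 0) * \<epsilon>"
  proof (rule differentiable_bound_linearization[where S = "cball 0 \<delta>" and f' = "\<lambda>x h. D x *v h" and ?x0.0 = 0])
    show "0 + t *\<^sub>R (x - 0) \<in> cball 0 \<delta>" if "t \<in> {0..1}" for t
      using mult_mono[of t 1 "norm x" \<delta>] x that by simp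
    show "(f has_derivative (*v) (D y)) (at y within cball 0 \<delta>)" for y
      using der by (rule has_derivative_at_withinI)
    show "onorm ((*v) (D y) - (*v) (D 0)) \<le> \<epsilon>" if "y \<in> cball 0 \<delta>" for y
    proof (rule onorm_le, unfold fun_diff_def)
      fix h
      have "norm (D y *v h - D 0 *v h) \<le> norm (D y - D 0) * norm h"
        using norm_matrix_vector_mult_le[of "D y - D 0" h] by (simp add: matrix_vector_mult_diff_rdistrib)
      also have "\<dots> \<le> \<epsilon> * norm h" using D[of y] that by (intro mult_right_mono) auto
      finally show "norm (D y *v h - D 0 *v h) \<le> \<epsilon> * norm h" .
    qed
    show "0 \<in> cball 0 \<delta>" using order_trans[OF norm_ge_zero x] by simp
  qed
  then show ?thesis using \<open>f 0 = 0\<close> by (simp add: mult.commute)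
qed

text \<open>Equicontinuity is given point by point, with a neighbourhood of \<open>(p, 0)\<close>
  that serves all times. The estimates concern a neighbourhood of the zero section, so compactness
  of \<open>\<Lambda>\<close> makes them uniform.\<close>

lemma equicontinuous_derivative_bounds:
  fixes Df :: "int \<Rightarrow> 'a::metric_space \<Rightarrow> real^'d \<Rightarrow> real^'d^'d"
  assumes cpt: "compact \<Lambda>" and r0: "0 < r0"
    and eq: "equicontinuous_on (\<Lambda> \<times> cball 0 r0) (\<lambda>n (l, x). Df n l x)"
    and bd: "pointwise_bounded_on (\<Lambda> \<times> cball 0 r0) (\<lambda>n (l, x). Df n l x)"
  shows "\<exists>c\<ge>0. \<forall>l\<in>\<Lambda>. \<forall>n. norm (Df n l 0) \<le> c"
    and "0 < \<epsilon> \<Longrightarrow> \<exists>\<delta>>0. \<forall>l\<in>\<Lambda>. \<forall>n x. norm x \<le> \<delta> \<longrightarrow> norm (Df n l x - Df n l 0) \<le> \<epsilon>"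
proof -
  have near: "\<exists>d>0. \<forall>n. \<forall>q\<in>\<Lambda>. \<forall>x. dist q p < d \<longrightarrow> norm x \<le> d \<longrightarrow> norm x \<le> r0 \<longrightarrow> dist (Df n q x) (Df n p 0) < e"
    if p: "p \<in> \<Lambda>" and e: "0 < e" for p and e :: real
  proof -
    have "(p, 0) \<in> \<Lambda> \<times> cball 0 r0" using p r0 by simp
    then obtain d where d: "d > 0" "\<And>n q x. q \<in> \<Lambda> \<Longrightarrow> norm x \<le> r0 \<Longrightarrow> dist (q, x) (p, 0) < d \<Longrightarrow> dist (Df n q x) (Df n p 0) < e"
      using eq e unfolding equicontinuous_on_def by fastforce
    have "dist (q, x) (p, 0) < d" if "dist q p < d / 2" "norm x \<le> d / 2" for q and x :: "real^'d"
      using sqrt_sum_squares_le_sum[of "dist q p" "norm x"] that by (simp add: dist_Pair_Pair)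
    then show ?thesis using d by (intro exI[of _ "d / 2"]) auto
  qed
  \<comment> \<open>The bound is written as \<open>1 / d\<close>, so that shrinking \<open>d\<close>
    weakens it and \<open>compact_uniform\<close> can deliver an upper bound.\<close>
  have "\<exists>d>0. \<forall>q\<in>\<Lambda>. \<forall>n. norm (Df n q 0) \<le> 1 / d"
  proof (rule compact_uniform[OF cpt])
    fix p assume p: "p \<in> \<Lambda>"
    obtain d where d: "d > 0" "\<And>n q. q \<in> \<Lambda> \<Longrightarrow> dist q p < d \<Longrightarrow> dist (Df n q 0) (Df n p 0) < 1"
      using near[OF p zero_less_one] r0 by fastforce
    have "(p, 0) \<in> \<Lambda> \<times> cball 0 r0" using p r0 by simp
    then obtain C where C: "\<And>n. norm (Df n p 0) \<le> C" using bd unfolding pointwise_bounded_on_def by fastforce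
    show "\<exists>d>0. \<forall>q\<in>\<Lambda>. dist q p < d \<longrightarrow> (\<forall>n. norm (Df n q 0) \<le> 1 / d)"
    proof (intro exI[of _ "min d (1 / (\<bar>C\<bar> + 1))"] conjI ballI impI allI)
      show "0 < min d (1 / (\<bar>C\<bar> + 1))" using d by simp
      fix q n assume q: "q \<in> \<Lambda>" "dist q p < min d (1 / (\<bar>C\<bar> + 1))"
      have "norm (Df n q 0) \<le> norm (Df n p 0) + dist (Df n q 0) (Df n p 0)"
        using norm_triangle_sub[of "Df n q 0" "Df n p 0"] by (simp add: dist_norm)
      also have "\<dots> \<le> \<bar>C\<bar> + 1" using C[of n] d(2)[of q n] q by auto
      also have "\<dots> \<le> 1 / min d (1 / (\<bar>C\<bar> + 1))"
        using d(1) by (simp add: pos_le_divide_eq min_def field_simps)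
      finally show "norm (Df n q 0) \<le> 1 / min d (1 / (\<bar>C\<bar> + 1))" .
    qed
  next
    fix q d d' assume "\<forall>n. norm (Df n q 0) \<le> 1 / d" and d: "0 < d'" "d' \<le> (d::real)"
    moreover have "1 / d \<le> 1 / d'" using d by (intro divide_left_mono) auto
    ultimately show "\<forall>n. norm (Df n q 0) \<le> 1 / d'" by (meson order_trans)
  qed
  then show "\<exists>c\<ge>0. \<forall>l\<in>\<Lambda>. \<forall>n. norm (Df n l 0) \<le> c"
    by (metis less_imp_le zero_less_divide_1_iff)
  assume \<epsilon>: "0 < \<epsilon>"
  have "\<exists>d>0. \<forall>q\<in>\<Lambda>. \<forall>n x. norm x \<le> d \<longrightarrow> norm x \<le> r0 \<longrightarrow> norm (Df n q x - Df n q 0) \<le> \<epsilon>"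
  proof (rule compact_uniform[OF cpt])
    fix p assume p: "p \<in> \<Lambda>"
    obtain d where d: "d > 0" "\<And>n q x. q \<in> \<Lambda> \<Longrightarrow> dist q p < d \<Longrightarrow> norm x \<le> d \<Longrightarrow> norm x \<le> r0 \<Longrightarrow> dist (Df n q x) (Df n p 0) < \<epsilon> / 2"
      using near[OF p, of "\<epsilon> / 2"] \<epsilon> by auto
    have "norm (Df n q x - Df n q 0) \<le> \<epsilon>" if "q \<in> \<Lambda>" "dist q p < d" "norm x \<le> d" "norm x \<le> r0" for q n x
    proof -
      have "dist (Df n q x) (Df n p 0) < \<epsilon> / 2" "dist (Df n q 0) (Df n p 0) < \<epsilon> / 2"
        using d(2)[OF that(1,2), of x n] d(2)[OF that(1,2), of 0 n] that d(1) r0 by auto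
      then have "dist (Df n q x) (Df n q 0) < \<epsilon>" by (rule dist_triangle_half_l)
      then show ?thesis by (simp add: dist_norm)
    qed
    then show "\<exists>d>0. \<forall>q\<in>\<Lambda>. dist q p < d \<longrightarrow> (\<forall>n x. norm x \<le> d \<longrightarrow> norm x \<le> r0 \<longrightarrow> norm (Df n q x - Df n q 0) \<le> \<epsilon>)"
      using d(1) by blast
  qed auto
  then obtain d where "d > 0" "\<forall>q\<in>\<Lambda>. \<forall>n x. norm x \<le> d \<longrightarrow> norm x \<le> r0 \<longrightarrow> norm (Df n q x - Df n q 0) \<le> \<epsilon>" by blast
  then show "\<exists>\<delta>>0. \<forall>l\<in>\<Lambda>. \<forall>n x. norm x \<le> \<delta> \<longrightarrow> norm (Df n l x - Df n l 0) \<le> \<epsilon>"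
    using r0 by (intro exI[of _ "min d r0"]) auto
qed

section \<open>Decay and vanishing of small bounded solutions\<close>

context dichotomy
begin

text \<open>Far to the right, windows for any prescribed number of contraction steps fit into
  \<open>I\<close>. With the mirror statement at the other end, this puts small bounded solutions
  into \<open>ell0\<close>, where the absence of bifurcation can be applied.\<close>

lemma decay_at_top:
  assumes I: "{k..} \<subseteq> I" and C: "0 \<le> C" "0 \<le> \<delta>" "0 \<le> \<epsilon>" and small: "2 * K * C * \<epsilon> / (1 - \<alpha>) \<le> 1/4"
    and bound: "\<And>n v. n \<in> I \<Longrightarrow> norm (P n *v v) \<le> C * norm v \<and> norm (v - P n *v v) \<le> C * norm v"
    and \<phi>: "\<And>n. norm (\<phi> n) \<le> \<delta>" "\<And>n. norm (\<phi> (n + 1) - B n *v \<phi> n) \<le> \<epsilon> * norm (\<phi> n)"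
  shows "(\<phi> \<longlongrightarrow> 0) at_top"
proof -
  obtain T where T: "\<And>i n. {n - int (i * T)..n + int (i * T)} \<subseteq> I \<Longrightarrow> norm (\<phi> n) \<le> (3/4) ^ i * \<delta>"
    using small_solution_power[OF C small bound \<phi>] by blast
  show ?thesis
  proof (rule tendstoI)
    fix e :: real assume "0 < e"
    then obtain i where i: "(3/4) ^ i * \<delta> < e" using exists_small_power C by blast
    have "norm (\<phi> n) < e" if n: "n \<ge> k + int (i * T)" for n
    proof -
      have "{n - int (i * T)..n + int (i * T)} \<subseteq> {k..}" using n by auto
      then show ?thesis using T[of n i] i I by fastforce
    qed
    then show "eventually (\<lambda>n. dist (\<phi> n) 0 < e) at_top"
      unfolding eventually_at_top_linorder by (auto simp: dist_norm)
  qed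
qed

lemma decay_at_bot:
  assumes I: "{..k} \<subseteq> I" and C: "0 \<le> C" "0 \<le> \<delta>" "0 \<le> \<epsilon>" and small: "2 * K * C * \<epsilon> / (1 - \<alpha>) \<le> 1/4"
    and bound: "\<And>n v. n \<in> I \<Longrightarrow> norm (P n *v v) \<le> C * norm v \<and> norm (v - P n *v v) \<le> C * norm v"
    and \<phi>: "\<And>n. norm (\<phi> n) \<le> \<delta>" "\<And>n. norm (\<phi> (n + 1) - B n *v \<phi> n) \<le> \<epsilon> * norm (\<phi> n)"
  shows "(\<phi> \<longlongrightarrow> 0) at_bot"
proof -
  obtain T where T: "\<And>i n. {n - int (i * T)..n + int (i * T)} \<subseteq> I \<Longrightarrow> norm (\<phi> n) \<le> (3/4) ^ i * \<delta>"
    using small_solution_power[OF C small bound \<phi>] by blast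
  show ?thesis
  proof (rule tendstoI)
    fix e :: real assume "0 < e"
    then obtain i where i: "(3/4) ^ i * \<delta> < e" using exists_small_power C by blast
    have "norm (\<phi> n) < e" if n: "n \<le> k - int (i * T)" for n
    proof -
      have "{n - int (i * T)..n + int (i * T)} \<subseteq> {..k}" using n by auto
      then show ?thesis using T[of n i] i I by fastforce
    qed
    then show "eventually (\<lambda>n. dist (\<phi> n) 0 < e) at_bot"
      unfolding eventually_at_bot_linorder by (auto simp: dist_norm)
  qed
qed

text \<open>On the whole line every window fits, so the contraction can be repeated indefinitely at
  the same \<open>n\<close>.\<close>

lemma entire_solution_zero:
  assumes I: "I = UNIV" and C: "0 \<le> C" "0 \<le> \<delta>" "0 \<le> \<epsilon>" and small: "2 * K * C * \<epsilon> / (1 - \<alpha>) \<le> 1/4"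
    and bound: "\<And>n v. n \<in> I \<Longrightarrow> norm (P n *v v) \<le> C * norm v \<and> norm (v - P n *v v) \<le> C * norm v"
    and \<phi>: "\<And>n. norm (\<phi> n) \<le> \<delta>" "\<And>n. norm (\<phi> (n + 1) - B n *v \<phi> n) \<le> \<epsilon> * norm (\<phi> n)"
  shows "\<phi> n = 0"
proof (rule ccontr)
  assume "\<phi> n \<noteq> 0"
  then obtain i where i: "(3/4) ^ i * \<delta> < norm (\<phi> n)" using exists_small_power[of "norm (\<phi> n)" \<delta>] C by auto
  obtain T where T: "\<And>i n. {n - int (i * T)..n + int (i * T)} \<subseteq> I \<Longrightarrow> norm (\<phi> n) \<le> (3/4) ^ i * \<delta>"
    using small_solution_power[OF C small bound \<phi>] by blast
  show False using T[of n i] i by (simp add: I)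
qed

end

text \<open>Running the recursion from \<open>b\<close> meets the left condition and leaves a defect
  \<open>v\<close> in the right one. A homogeneous solution starting in the kernel of the whole-line
  projector corrects it: that kernel lies in the kernel of \<open>Pm\<close> at \<open>N'\<close>,
  so the left condition survives. At \<open>N\<close> the correction equals \<open>v\<close> up to a
  vector in the range of \<open>Q N\<close>, which lies in the range of \<open>Pp N\<close> and is
  therefore invisible to the right condition.\<close>

lemma truncated_inhomogeneous_solvable:
  fixes B :: "int \<Rightarrow> real^'d^'d"
  assumes EDp: "ED_with B {N..} Pp K1 \<alpha>1" and EDm: "ED_with B {..N'} Pm K2 \<alpha>2" and ED: "ED_with B UNIV Q K0 \<alpha>0"
    and N: "N = N' + int q" and ab: "Pp N *v a = 0" "Pm N' *v b = b"
  shows "\<exists>X. (\<forall>j<q. X (Suc j) - B (N' + int j) *v X j = w j) \<and> X q - Pp N *v X q = a \<and> Pm N' *v X 0 = b"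
proof -
  interpret dichotomy B UNIV Q K0 \<alpha>0 by unfold_locales (use ED in auto)
  define Z where "Z = rec_nat b (\<lambda>j z. B (N' + int j) *v z + w j)"
  have Z: "Z 0 = b" "Z (Suc j) = B (N' + int j) *v Z j + w j" for j
    by (simp_all add: Z_def)
  define v where "v = a - (Z q - Pp N *v Z q)"
  have idem: "Pp N *v (Pp N *v x) = Pp N *v x" for x
    using ED_idem[OF EDp, of N] by (simp add: matrix_vector_mul_assoc)
  have v: "Pp N *v v = 0"
    using ab(1) idem by (simp add: v_def matrix_vector_mult_diff_distrib)
  have QP: "Pp N *v (Q N *v v) = Q N *v v"
    by (rule ED_range_unique[OF ED_with_subset[OF ED subset_UNIV] EDp]) (simp add: proj)
  have "Q (N' + int q) *v (v - Q N *v v) = 0"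
    using proj[of N v] by (simp add: N matrix_vector_mult_diff_distrib)
  then obtain \<eta> where \<eta>: "Q N' *v \<eta> = 0" "Phi B N N' *v \<eta> = v - Q N *v v"
    using surj_Phi[of N' q] unfolding N by auto
  have P\<eta>: "Pm N' *v \<eta> = 0"
    by (rule ED_kernel_unique[OF ED_with_subset[OF ED subset_UNIV] EDm \<eta>(1)])
  define X where "X j = Z j + Phi B (N' + int j) N' *v \<eta>" for j
  have "X (Suc j) - B (N' + int j) *v X j = w j" for j
    using Phi_Suc_vec[of N' "N' + int j" B \<eta>]
    by (simp add: X_def Z matrix_vector_right_distrib algebra_simps)
  moreover have "X q - Pp N *v X q = a"
  proof -
    have "X q = Z q + (v - Q N *v v)" using \<eta>(2) by (simp add: X_def N)
    then have "X q - Pp N *v X q = Z q - Pp N *v Z q + v"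
      using v QP by (simp add: matrix_vector_right_distrib matrix_vector_mult_diff_distrib)
    then show ?thesis by (simp add: v_def)
  qed
  moreover have "Pm N' *v X 0 = b"
    using ab(2) P\<eta> by (simp add: X_def Z matrix_vector_right_distrib)
  ultimately show ?thesis by blast
qed

text \<open>Ranks are compared through a dichotomy on the whole line, where the rank of the projector is constant.\<close>

lemma dichotomy_ranks:
  fixes B :: "int \<Rightarrow> real^'d^'d"
  assumes ED: "ED_with B UNIV Q K0 \<alpha>0"
  shows "ED_with B {k..} Pp K1 \<alpha>1 \<Longrightarrow> rank (Pp k) = rank (Q 0)"
    and "ED_with B {..k} Pm K2 \<alpha>2 \<Longrightarrow> rank (Pm k) = rank (Q 0)"
proof -
  interpret dichotomy B UNIV Q K0 \<alpha>0 by unfold_locales (use ED in auto)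
  have idQ: "Q n ** Q n = Q n" for n by (rule ED_idem[OF ED]) simp
  have kerQ: "dim {x. Q n *v x = 0} = dim {x. Q 0 *v x = 0}" for n
  proof (cases "n \<ge> 0")
    case True
    then show ?thesis using dim_kernel_eq[of 0 "nat n"] by simp
  next
    case False
    then show ?thesis using dim_kernel_eq[of n "nat (- n)"] by simp
  qed
  then have rQ: "rank (Q n) = rank (Q 0)" for n
    using dim_kernel_idem[OF idQ, of n] dim_kernel_idem[OF idQ, of 0] kerQ[of n] by linarith
  show "rank (Pp k) = rank (Q 0)" if E: "ED_with B {k..} Pp K1 \<alpha>1"
  proof -
    have idP: "Pp k ** Pp k = Pp k" by (rule ED_idem[OF E]) simp
    have Q: "ED_with B {k..} Q K0 \<alpha>0" by (rule ED_with_subset[OF ED]) simp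
    have "{x. Pp k *v x = x} = {x. Q k *v x = x}"
      using ED_range_unique[OF E Q] ED_range_unique[OF Q E] by blast
    then show ?thesis using rank_eq_dim_fixed[OF idP] rank_eq_dim_fixed[OF idQ, of k] rQ[of k] by simp
  qed
  show "rank (Pm k) = rank (Q 0)" if E: "ED_with B {..k} Pm K2 \<alpha>2"
  proof -
    have idP: "Pm k ** Pm k = Pm k" by (rule ED_idem[OF E]) simp
    have Q: "ED_with B {..k} Q K0 \<alpha>0" by (rule ED_with_subset[OF ED]) simp
    have "{x. Pm k *v x = 0} = {x. Q k *v x = 0}"
      using ED_kernel_unique[OF E Q] ED_kernel_unique[OF Q E] by blast
    then show ?thesis using dim_kernel_idem[OF idP] dim_kernel_idem[OF idQ, of k] rQ[of k] by simp
  qed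
qed

section \<open>Contradiction from the absence of bifurcation\<close>

theorem theorem6p1:
  fixes \<Lambda> :: "'a::metric_space set"
    and f :: "int \<Rightarrow> 'a \<Rightarrow> real^'d \<Rightarrow> real^'d"
    and Df :: "int \<Rightarrow> 'a \<Rightarrow> real^'d \<Rightarrow> real^'d^'d"
    and Pp Pm :: "'a \<Rightarrow> int \<Rightarrow> real^'d^'d"
    and kp km :: int
  assumes cpt: "compact \<Lambda>" and pc: "path_connected \<Lambda>"
    and cont: "\<And>n. continuous_on (\<Lambda> \<times> UNIV) (\<lambda>(l, x). f n l x)"
    and zero: "\<And>n l. l \<in> \<Lambda> \<Longrightarrow> f n l 0 = 0"
    and F0_deriv: "\<And>n l x. l \<in> \<Lambda> \<Longrightarrow> (f n l has_derivative (\<lambda>h. Df n l x *v h)) (at x)"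
    and F0_cont: "\<And>n. continuous_on (\<Lambda> \<times> UNIV) (\<lambda>(l, x). Df n l x)"
    and F1: "\<exists>r0>0. equicontinuous_on (\<Lambda> \<times> cball 0 r0) (\<lambda>n (l, x). f n l x) \<and>
                    equicontinuous_on (\<Lambda> \<times> cball 0 r0) (\<lambda>n (l, x). Df n l x) \<and>
                    pointwise_bounded_on (\<Lambda> \<times> cball 0 r0) (\<lambda>n (l, x). Df n l x)"
    and F2_k: "km < 0" "0 < kp"
    and F2_plus: "has_param_ED \<Lambda> (\<lambda>l n. Df n l 0) {kp..} Pp"
    and F2_minus: "has_param_ED \<Lambda> (\<lambda>l n. Df n l 0) {..km} Pm"
    and F3: "\<exists>l0\<in>\<Lambda>. has_ED (\<lambda>n. Df n l0 0) UNIV"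
    and Jneq: "\<not> J_eq \<Lambda> (IM_bundle Pp kp) (IM_bundle Pm km)"
  shows "\<exists>ls\<in>\<Lambda>. \<forall>e>0. \<exists>l\<in>\<Lambda>. \<exists>\<phi>\<in>ell0. dist l ls < e \<and> (\<forall>n. norm (\<phi> n) < e) \<and>
            (\<exists>n. \<phi> n \<noteq> 0) \<and> (\<forall>n. \<phi> (n + 1) = f n l (\<phi> n))"
proof (rule ccontr)
  assume neg: "\<not> ?thesis"
  define A where "A l n = Df n l 0" for l n
  have conn: "connected \<Lambda>" using pc by (rule path_connected_imp_connected)
  obtain r0 where r0: "0 < r0" "equicontinuous_on (\<Lambda> \<times> cball 0 r0) (\<lambda>n (l, x). Df n l x)"
    "pointwise_bounded_on (\<Lambda> \<times> cball 0 r0) (\<lambda>n (l, x). Df n l x)"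
    using F1 by blast
  obtain c where c: "0 \<le> c" "\<And>l n. l \<in> \<Lambda> \<Longrightarrow> norm (A l n) \<le> c"
    using equicontinuous_derivative_bounds(1)[OF cpt r0] unfolding A_def by blast
  have cA: "norm (A l n *v v) \<le> c * norm v" if "l \<in> \<Lambda>" for l n v
    using norm_matrix_vector_mult_le[of "A l n" v] mult_right_mono[OF c(2)[OF that] norm_ge_zero, of n v] by linarith
  have contA: "continuous_on \<Lambda> (\<lambda>l. A l n)" for n
  proof -
    have "continuous_on \<Lambda> (\<lambda>l. (\<lambda>(l, x). Df n l x) (l, 0))"
      by (rule continuous_on_compose2[OF F0_cont[of n]]) (auto intro!: continuous_intros)
    then show ?thesis by (simp add: A_def)
  qed
  \<comment> \<open>Each base point has a neighbourhood free of small nonzero solutions; compactness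
    turns these into one isolating radius for all parameters.\<close>
  obtain e where e: "0 < e" "\<And>l \<phi> n. l \<in> \<Lambda> \<Longrightarrow> \<phi> \<in> ell0 \<Longrightarrow> (\<And>n. norm (\<phi> n) < e) \<Longrightarrow>
      (\<And>n. \<phi> (n + 1) = f n l (\<phi> n)) \<Longrightarrow> \<phi> n = 0"
  proof -
    have "\<exists>e>0. \<forall>l\<in>\<Lambda>. \<forall>\<phi>\<in>ell0. (\<forall>n. norm (\<phi> n) < e) \<longrightarrow> (\<forall>n. \<phi> (n + 1) = f n l (\<phi> n)) \<longrightarrow> (\<forall>n. \<phi> n = 0)"
    proof (rule compact_uniform[OF cpt])
      fix ls assume "ls \<in> \<Lambda>"
      then show "\<exists>d>0. \<forall>l\<in>\<Lambda>. dist l ls < d \<longrightarrow>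
          (\<forall>\<phi>\<in>ell0. (\<forall>n. norm (\<phi> n) < d) \<longrightarrow> (\<forall>n. \<phi> (n + 1) = f n l (\<phi> n)) \<longrightarrow> (\<forall>n. \<phi> n = 0))"
        using neg by blast
    qed (meson order_less_le_trans)
    then show ?thesis using that by blast
  qed
  obtain l0 Q K0 \<alpha>0 where l0: "l0 \<in> \<Lambda>" and ED0: "ED_with (A l0) UNIV Q K0 \<alpha>0"
    using F3 unfolding has_ED_def A_def by blast
  obtain K1 \<alpha>1 where EDp: "\<And>l. l \<in> \<Lambda> \<Longrightarrow> ED_with (A l) {kp..} (Pp l) K1 \<alpha>1"
    and contPp: "\<And>n. kp \<le> n \<Longrightarrow> continuous_on \<Lambda> (\<lambda>l. Pp l n)"
    using F2_plus unfolding has_param_ED_def A_def by auto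
  obtain K2 \<alpha>2 where EDm: "\<And>l. l \<in> \<Lambda> \<Longrightarrow> ED_with (A l) {..km} (Pm l) K2 \<alpha>2"
    and contPm: "\<And>n. n \<le> km \<Longrightarrow> continuous_on \<Lambda> (\<lambda>l. Pm l n)"
    using F2_minus unfolding has_param_ED_def A_def by auto
  interpret d0: dichotomy "A l0" UNIV Q K0 \<alpha>0 by unfold_locales (use ED0 in auto)
  have dp: "dichotomy (A l) {kp..} (Pp l) K1 \<alpha>1" if "l \<in> \<Lambda>" for l
    by unfold_locales (use EDp[OF that] in auto)
  have dm: "dichotomy (A l) {..km} (Pm l) K2 \<alpha>2" if "l \<in> \<Lambda>" for l
    by unfold_locales (use EDm[OF that] in auto)
  \<comment> \<open>1/3 is the threshold of \<open>projector_bound\<close>. \<open>K1\<close> and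
    \<open>\<alpha>1\<close> are common to all parameters, so \<open>m1\<close> chosen at
    \<open>l0\<close> serves everywhere.\<close>
  obtain m1 where m1: "K1 * \<alpha>1 ^ m1 \<le> 1/3" using dichotomy.small_power[OF dp[OF l0], of "1/3"] by auto
  obtain m2 where m2: "K2 * \<alpha>2 ^ m2 \<le> 1/3" using dichotomy.small_power[OF dm[OF l0], of "1/3"] by auto
  obtain C0 where C0: "C0 \<ge> 0" "\<And>n v. norm (Q n *v v) \<le> C0 * norm v \<and> norm (v - Q n *v v) \<le> C0 * norm v"
    using d0.proj_bounded by auto
  define C where "C = (c ^ m1 + 2) + (c ^ m2 + 2) + C0"
  have C: "0 < C" "c ^ m1 + 2 \<le> C" "c ^ m2 + 2 \<le> C" "C0 \<le> C"
    using c(1) C0(1) zero_le_power[OF c(1), of m1] zero_le_power[OF c(1), of m2] unfolding C_def by linarith+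
  \<comment> \<open>The uniform projector bound looks \<open>m2\<close> steps ahead, which inside
    \<open>{..km}\<close> is possible up to \<open>km - m2\<close>; on the right half-line there is
    always room ahead.\<close>
  define km' where "km' = km - int m2"
  have up: "b * norm v \<le> C * norm v" if "b \<le> C" for b and v :: "real^'d"
    using that by (rule mult_right_mono) simp
  have bp: "norm (Pp l n *v v) \<le> C * norm v \<and> norm (v - Pp l n *v v) \<le> C * norm v" if "l \<in> \<Lambda>" "kp \<le> n" for l n v
    using dichotomy.projector_bound[OF dp[OF that(1)], of n m1 c v] that m1 c(1) cA[OF that(1)] up[OF C(2), of v] by fastforce
  have bm: "norm (Pm l n *v v) \<le> C * norm v \<and> norm (v - Pm l n *v v) \<le> C * norm v" if "l \<in> \<Lambda>" "n \<le> km'" for l n v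
    using dichotomy.projector_bound[OF dm[OF that(1)], of n m2 c v] that m2 c(1) cA[OF that(1)] up[OF C(3), of v]
    unfolding km'_def by fastforce
  have bq: "norm (Q n *v v) \<le> C * norm v \<and> norm (v - Q n *v v) \<le> C * norm v" for n v
    using C0(2)[where n = n and v = v] up[OF C(4), of v] by linarith
  have K: "0 < K0" "\<alpha>0 < 1" "0 < K1" "\<alpha>1 < 1" "0 < K2" "\<alpha>2 < 1"
    using d0.const dichotomy.const[OF dp[OF l0]] dichotomy.const[OF dm[OF l0]] by auto
  \<comment> \<open>Solving \<open>2 * K * C * \<epsilon> / (1 - \<alpha>) \<le> 1/4\<close> for the
    three dichotomies at once.\<close>
  define \<epsilon> where "\<epsilon> = min ((1 - \<alpha>0) / (8 * K0 * C)) (min ((1 - \<alpha>1) / (8 * K1 * C)) ((1 - \<alpha>2) / (8 * K2 * C)))"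
  have \<epsilon>: "0 < \<epsilon>" using K C by (simp add: \<epsilon>_def)
  have sm: "2 * K * C * \<epsilon> / (1 - \<alpha>) \<le> 1/4" if "0 < K" "\<alpha> < 1" "\<epsilon> \<le> (1 - \<alpha>) / (8 * K * C)" for K \<alpha>
    using that C by (simp add: field_simps)
  have sm0: "2 * K0 * C * \<epsilon> / (1 - \<alpha>0) \<le> 1/4" and sm1: "2 * K1 * C * \<epsilon> / (1 - \<alpha>1) \<le> 1/4"
    and sm2: "2 * K2 * C * \<epsilon> / (1 - \<alpha>2) \<le> 1/4"
    by (rule sm; use K in \<open>simp add: \<epsilon>_def\<close>)+
  obtain \<delta>' where \<delta>': "0 < \<delta>'" "\<And>l n x. l \<in> \<Lambda> \<Longrightarrow> norm x \<le> \<delta>' \<Longrightarrow> norm (Df n l x - Df n l 0) \<le> \<epsilon>"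
    using equicontinuous_derivative_bounds(2)[OF cpt r0 \<epsilon>] by blast
  \<comment> \<open>Half of \<open>e\<close>, because the isolating radius asks for a strict bound
    while truncated solutions satisfy \<open>norm (x n) \<le> \<delta>\<close>.\<close>
  define \<delta> where "\<delta> = min \<delta>' (e / 2)"
  have \<delta>: "0 < \<delta>" "\<delta> \<le> \<delta>'" "\<delta> < e" using \<delta>' e(1) by (auto simp: \<delta>_def)
  have rem: "norm (f n l x - A l n *v x) \<le> \<epsilon> * norm x" if "l \<in> \<Lambda>" "norm x \<le> \<delta>" for n l x
    unfolding A_def
    by (rule remainder_bound[where \<delta> = \<delta>]) (use F0_deriv zero \<delta>'(2) that \<delta>(2) in auto)
  define M where "M = \<Lambda> \<times> {1} \<union> {l0} \<times> {0..1::real}"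
  \<comment> \<open>Linear at \<open>snd \<mu> = 0\<close> and equal to \<open>f\<close> at
    \<open>snd \<mu> = 1\<close>. The remainder is only scaled down in between, so the same
    \<open>\<epsilon>\<close> serves on all of \<open>M\<close>.\<close>
  define F where "F n \<mu> x = A (fst \<mu>) n *v x + snd \<mu> *\<^sub>R (f n (fst \<mu>) x - A (fst \<mu>) n *v x)" for n and \<mu> :: "'a \<times> real" and x
  have M: "fst \<mu> \<in> \<Lambda>" "0 \<le> snd \<mu>" "snd \<mu> \<le> 1" if "\<mu> \<in> M" for \<mu> using that l0 by (auto simp: M_def)
  have remF: "norm (F n \<mu> x - A (fst \<mu>) n *v x) \<le> \<epsilon> * norm x" if "\<mu> \<in> M" "norm x \<le> \<delta>" for \<mu> n x
  proof -
    have "norm (F n \<mu> x - A (fst \<mu>) n *v x) = snd \<mu> * norm (f n (fst \<mu>) x - A (fst \<mu>) n *v x)"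
      using M[OF that(1)] by (simp add: F_def)
    also have "\<dots> \<le> 1 * norm (f n (fst \<mu>) x - A (fst \<mu>) n *v x)"
      using M[OF that(1)] by (intro mult_right_mono) auto
    also have "\<dots> \<le> \<epsilon> * norm x" using rem[OF M(1)[OF that(1)] that(2)] by simp
    finally show ?thesis .
  qed
  have cM: "compact M" unfolding M_def by (intro compact_Un compact_Times cpt) auto
  have contF: "continuous_on (M \<times> UNIV) (\<lambda>(\<mu>, x). F n \<mu> x)" for n
  proof -
    have 1: "continuous_on (M \<times> UNIV) (\<lambda>p. A (fst (fst p)) n)"
      by (rule continuous_on_compose2[OF contA[of n]]) (use M in \<open>auto intro!: continuous_intros\<close>)
    have "continuous_on (M \<times> UNIV) (\<lambda>p. (\<lambda>(l, x). f n l x) (fst (fst p), snd p))"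
      by (rule continuous_on_compose2[OF cont[of n]]) (use M in \<open>auto intro!: continuous_intros\<close>)
    then have "continuous_on (M \<times> UNIV) (\<lambda>p. F n (fst p) (snd p))"
      unfolding F_def by (intro continuous_intros continuous_on_matrix_vector 1) simp_all
    then show ?thesis by (simp add: case_prod_unfold)
  qed
  have uniq: "\<phi> n = 0" if \<mu>: "\<mu> \<in> M" and \<phi>: "\<And>n. norm (\<phi> n) \<le> \<delta>" "\<And>n. \<phi> (n + 1) = F n \<mu> (\<phi> n)" for \<mu> \<phi> n
  proof -
    have res: "norm (\<phi> (n + 1) - A (fst \<mu>) n *v \<phi> n) \<le> \<epsilon> * norm (\<phi> n)" for n
      using remF[OF \<mu> \<phi>(1)[of n], of n] \<phi>(2)[of n] by simp
    \<comment> \<open>At the nonlinear end a small bounded solution decays on both sides and is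
      excluded by the radius \<open>e\<close>; over \<open>l0\<close>, for every value of
      \<open>snd \<mu>\<close>, the whole-line dichotomy excludes it directly.\<close>
    consider "fst \<mu> \<in> \<Lambda>" "snd \<mu> = 1" | "fst \<mu> = l0" using \<mu> by (auto simp: M_def)
    then show ?thesis
    proof cases
      case 1
      interpret p: dichotomy "A (fst \<mu>)" "{kp..}" "Pp (fst \<mu>)" K1 \<alpha>1 by (rule dp[OF 1(1)])
      interpret m: dichotomy "A (fst \<mu>)" "{..km'}" "Pm (fst \<mu>)" K2 \<alpha>2
        by unfold_locales (use ED_with_subset[OF EDm[OF 1(1)], of "{..km'}"] in \<open>auto simp: km'_def\<close>)
      have "(\<phi> \<longlongrightarrow> 0) at_top"
        by (rule p.decay_at_top[OF order_refl _ _ _ sm1 _ \<phi>(1) res]) (use C \<delta> \<epsilon> bp[OF 1(1)] in auto)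
      moreover have "(\<phi> \<longlongrightarrow> 0) at_bot"
        by (rule m.decay_at_bot[OF order_refl _ _ _ sm2 _ \<phi>(1) res]) (use C \<delta> \<epsilon> bm[OF 1(1)] in auto)
      ultimately have "\<phi> \<in> ell0" by (simp add: ell0_def)
      then show ?thesis
      proof (rule e(2)[OF 1(1)])
        show "norm (\<phi> n) < e" for n using \<phi>(1)[of n] \<delta>(3) by linarith
        show "\<phi> (n + 1) = f n (fst \<mu>) (\<phi> n)" for n using \<phi>(2)[of n] 1(2) by (simp add: F_def)
      qed
    next
      case 2
      show ?thesis
        by (rule d0.entire_solution_zero[OF refl _ _ _ sm0 _ \<phi>(1) res[unfolded 2]]) (use C \<delta> \<epsilon> bq in auto)
    qed
  qed
  have "\<exists>N\<ge>max kp (- km'). \<forall>\<mu>\<in>M. \<forall>x. (\<forall>n\<in>{-N..N}. norm (x n) \<le> \<delta>) \<longrightarrow> (\<exists>n\<in>{-N..N}. norm (x n) = \<delta>) \<longrightarrow>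
    (\<forall>n\<in>{-N..<N}. x (n + 1) = F n \<mu> (x n)) \<longrightarrow> Pp (fst \<mu>) N *v x N = x N \<longrightarrow> Pm (fst \<mu>) (- N) *v x (- N) = 0 \<longrightarrow> False"
  proof (rule no_truncated_solution[where A = "\<lambda>\<mu>. A (fst \<mu>)" and Pp = "\<lambda>\<mu>. Pp (fst \<mu>)" and Pm = "\<lambda>\<mu>. Pm (fst \<mu>)" and km = km' and kp = kp])
    show "km' \<le> kp" using F2_k by (simp add: km'_def)
    show "ED_with (A (fst \<mu>)) {..km'} (Pm (fst \<mu>)) K2 \<alpha>2" if "\<mu> \<in> M" for \<mu>
      by (rule ED_with_subset[OF EDm[OF M(1)[OF that]]]) (auto simp: km'_def)
    show "\<phi> n = 0" if "\<mu> \<in> M" "\<And>n. norm (\<phi> n) \<le> \<delta>" "\<And>n. \<phi> (n + 1) = F n \<mu> (\<phi> n)" for \<mu> \<phi> n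
      by (rule uniq[OF that])
  qed (use cM contF EDp bp bm M C \<epsilon> \<delta> sm1 sm2 remF in auto)
  then obtain N where N: "N \<ge> max kp (- km')"
    "\<forall>\<mu>\<in>M. \<forall>x. (\<forall>n\<in>{-N..N}. norm (x n) \<le> \<delta>) \<longrightarrow> (\<exists>n\<in>{-N..N}. norm (x n) = \<delta>) \<longrightarrow>
      (\<forall>n\<in>{-N..<N}. x (n + 1) = F n \<mu> (x n)) \<longrightarrow> Pp (fst \<mu>) N *v x N = x N \<longrightarrow> Pm (fst \<mu>) (- N) *v x (- N) = 0 \<longrightarrow> False"
    by (elim exE conjE)
  \<comment> \<open>The interval \<open>{- N..N}\<close> has \<open>2 * N\<close> steps, and block
    \<open>j\<close> stands for time \<open>- N + int j\<close>.\<close>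
  define q where "q = nat (2 * N)"
  have Nq: "N = - N + int q" "kp \<le> N" "- N \<le> km'" "- N \<le> km"
    using N(1) F2_k by (auto simp: q_def km'_def)
  have EDpN: "ED_with (A l) {N..} (Pp l) K1 \<alpha>1" if "l \<in> \<Lambda>" for l
    by (rule ED_with_subset[OF EDp[OF that]]) (use Nq in auto)
  have EDmN: "ED_with (A l) {..- N} (Pm l) K2 \<alpha>2" if "l \<in> \<Lambda>" for l
    by (rule ED_with_subset[OF EDm[OF that]]) (use Nq in auto)
  have idp: "Pp l n ** Pp l n = Pp l n" if "l \<in> \<Lambda>" "kp \<le> n" for l n
    by (rule ED_idem[OF EDp]) (use that in auto)
  have idm: "Pm l n ** Pm l n = Pm l n" if "l \<in> \<Lambda>" "n \<le> km" for l n
    by (rule ED_idem[OF EDm]) (use that in auto)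
  have fhe: "fibre_homotopy_equiv \<Lambda> (triv (q * CARD('d) + CARD('d)))
      (dsum (dsum (triv (q * CARD('d))) (mat_bundle (\<lambda>l. mat 1 - Pp l N))) (mat_bundle (\<lambda>l. Pm l (- N))))"
  proof (rule fibre_homotopy_equiv_of_truncated_problem[where ?l0.0 = l0 and \<delta> = \<delta>
        and F = "\<lambda>j l t x. F (- N + int j) (l, t) x" and A = "\<lambda>j. A l0 (- N + int j)"])
    show "continuous_on ((\<Lambda> \<times> {1} \<union> {l0} \<times> {0..1}) \<times> UNIV) (\<lambda>((l, t), x). F (- N + int j) (l, t) x)" for j
      using contF[of "- N + int j"] by (simp add: M_def case_prod_unfold)
    show "F (- N + int j) (l0, 0) x = A l0 (- N + int j) *v x" for j x by (simp add: F_def)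
    show "\<exists>X. (\<forall>j<q. X (Suc j) - A l0 (- N + int j) *v X j = w j) \<and> X q - Pp l0 N *v X q = a \<and> Pm l0 (- N) *v X 0 = b"
      if "Pp l0 N *v a = 0" "Pm l0 (- N) *v b = b" for w a b
      by (rule truncated_inhomogeneous_solvable[OF EDpN[OF l0] EDmN[OF l0] ED0 Nq(1) that])
    fix l t and X :: "nat \<Rightarrow> real^'d"
    assume M: "(l, t) \<in> \<Lambda> \<times> {1} \<union> {l0} \<times> {0..1}" and X: "\<And>j. j \<le> q \<Longrightarrow> norm (X j) \<le> \<delta>" "\<exists>j\<le>q. norm (X j) = \<delta>"
      "\<And>j. j < q \<Longrightarrow> X (Suc j) = F (- N + int j) (l, t) (X j)" "Pp l N *v X q = X q" "Pm l (- N) *v X 0 = 0"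
    show False
    proof (rule N(2)[rule_format, of "(l, t)" "\<lambda>n. X (nat (n + N))"])
      show "(l, t) \<in> M" using M by (simp add: M_def)
      show "norm (X (nat (n + N))) \<le> \<delta>" if "n \<in> {- N..N}" for n
        by (rule X(1)) (use that in \<open>auto simp: q_def\<close>)
      obtain j where j: "j \<le> q" "norm (X j) = \<delta>" using X(2) by blast
      then show "\<exists>n\<in>{- N..N}. norm (X (nat (n + N))) = \<delta>"
        using Nq(1) by (intro bexI[of _ "int j - N"]) auto
      show "X (nat (n + 1 + N)) = F n (l, t) (X (nat (n + N)))" if "n \<in> {- N..<N}" for n
      proof -
        have "nat (n + 1 + N) = Suc (nat (n + N))" "nat (n + N) < q" "- N + int (nat (n + N)) = n"
          using that by (auto simp: q_def)
        then show ?thesis using X(3)[of "nat (n + N)"] by simp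
      qed
      show "Pp (fst (l, t)) N *v X (nat (N + N)) = X (nat (N + N))"
        using X(4) by (simp add: q_def)
      show "Pm (fst (l, t)) (- N) *v X (nat (- N + N)) = 0" using X(5) by simp
    qed
  qed (use cpt conn l0 contPp contPm Nq idp idm \<delta>(1) in auto)
  \<comment> \<open>Over \<open>l0\<close> all ranks equal that of the whole-line projector, and
    ranks are constant along the connected base; so the kernel at \<open>N\<close> and the range at
    \<open>- N\<close> have complementary dimensions over every parameter.\<close>
  have rk: "rank (Pp l0 n) = rank (Q 0)" if "kp \<le> n" for n
    by (rule dichotomy_ranks(1)[OF ED0 ED_with_subset[OF EDp[OF l0]]]) (use that in auto)
  have rk': "rank (Pm l0 n) = rank (Q 0)" if "n \<le> km" for n
    by (rule dichotomy_ranks(2)[OF ED0 ED_with_subset[OF EDm[OF l0]]]) (use that in auto)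
  have rkp: "rank (Pp l n) = rank (Q 0)" if "l \<in> \<Lambda>" "kp \<le> n" for l n
    using rank_constant[OF conn contPp[OF that(2)] idp[OF _ that(2)] that(1) l0] rk[OF that(2)] by simp
  have rkm: "rank (Pm l n) = rank (Q 0)" if "l \<in> \<Lambda>" "n \<le> km" for l n
    using rank_constant[OF conn contPm[OF that(2)] idm[OF _ that(2)] that(1) l0] rk'[OF that(2)] by simp
  have rkk: "rank (mat 1 - Pp l N) = CARD('d) - rank (Q 0)" if "l \<in> \<Lambda>" for l
    using dim_kernel_idem(2)[OF idp[OF that Nq(2)]] rkp[OF that Nq(2)] by simp
  have "rank (Q 0) \<le> CARD('d)"
    using dim_kernel_idem(2)[OF idp[OF l0 Nq(2)]] rkp[OF l0 Nq(2)] by simp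
  moreover have "bundle_iso \<Lambda> (mat_bundle (\<lambda>l. mat 1 - Pp l kp)) (mat_bundle (\<lambda>l. mat 1 - Pp l N))"
    using kernel_bundle_iso[where \<Lambda> = \<Lambda> and a = kp and m = "nat (N - kp)", OF EDp] contPp contA Nq(2) by simp
  moreover have "bundle_iso \<Lambda> (mat_bundle (\<lambda>l. mat 1 - Pm l (- N))) (mat_bundle (\<lambda>l. mat 1 - Pm l km))"
    using kernel_bundle_iso[where \<Lambda> = \<Lambda> and a = "- N" and m = "nat (km + N)", OF EDm] contPm contA Nq(4) by simp
  ultimately have "J_eq \<Lambda> (mat_bundle (\<lambda>l. Pp l kp)) (mat_bundle (\<lambda>l. Pm l km))"
    by (intro J_eq_if_fibre_homotopy_equiv[where P' = "\<lambda>l. Pp l N" and R' = "\<lambda>l. Pm l (- N)"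
        and r = "rank (Q 0)" and r' = "CARD('d) - rank (Q 0)" and k = "q * CARD('d)"])
      (use contPp contPm idp idm rkp rkm rkk fhe Nq in auto)
  with Jneq show False by (simp add: IM_bundle_eq)
qed

end
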